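(* Let $r\in \mathbb{N}$ with $r\geq 2$. Let $G$ be a connected finite-dimensional Lie group which is equipped with a bi-invariant Riemannian metric, let $E$ and $B$ be closed manifolds with smooth left $G$-actions $\Phi\colon G\times E\to E$ and $\varphi\colon G\times B\to B$, and let $p\colon E\to B$ be a smooth $G$-equivariant fiber bundle with path-connected fibers. Assume that $E$ is equipped with a $\Phi$-invariant Riemannian metric and that $B$ is equipped with a Riemannian metric for which $p$ is a Riemannian submersion. Assume that the $G$-action $\varphi$ on $B$ is transitive. Then for any $G$-invariant function $f \in C^1(E)$ it holds that $$\mathsf{TC}_r[p\colon E\to B] \leq \sum_{\mu \in \mathbb{R}} \max \Big\{ \mathsf{TC}_{r,p} (\mathrm{Crit}_{\mu_1} f \times_B \dots \times_B \mathrm{Crit}_{\mu_r} f) \ \Big| \ \mu_1,\dots,\mu_r \in \mathbb{R}, \ \sum_{i=1}^r \mu_i =\mu\Big\}.$$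
   Context: For $f\in C^1(E)$ (real-valued) and $\mu\in\mathbb{R}$, $\mathrm{Crit}_\mu f=\{x\in E\mid Df_x=0,\ f(x)=\mu\}$. For $A_1,\dots,A_r\subset E$, $A_1\times_B\dots\times_BA_r=\{(a_1,\dots,a_r)\in\prod_iA_i\mid p(a_1)=\dots=p(a_r)\}$. Put $E^r_B=\{(u_1,\dots,u_r)\in E^r\mid p(u_1)=\dots=p(u_r)\}$, $E^I_B=\{\gamma\in C^0([0,1],E)\mid p(\gamma(t))=p(\gamma(0))\ \forall t\}$ (compact-open topology) and $\Pi_r\colon E^I_B\to E^r_B$, $\Pi_r(\gamma)=(\gamma(0),\gamma(\tfrac1{r-1}),\dots,\gamma(\tfrac{r-2}{r-1}),\gamma(1))$. For $A\subset E^r_B$, $\mathsf{TC}_{r,p}(A)$ is the minimal $n$ for which there exist open subsets $U_1,\dots,U_n\subset E^r_B$ with $A\subset\bigcup_{i=1}^nU_i$ such that each $U_i$ admits a continuous local section $U_i\to E^I_B$ of $\Pi_r$ ($\infty$ if no such $n$ exists); $\mathsf{TC}_{r,p}(\emptyset)=0$. The $r$-th sequential parametrized topological complexity is $\mathsf{TC}_r[p\colon E\to B]=\mathsf{TC}_{r,p}(E^r_B)$. *)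

theory Defs
  imports "HOL-Analysis.Analysis" "HOL-Algebra.Group_Action"
begin

section \<open>Smooth manifolds\<close>

text \<open>
  A manifold is a topology together with a smooth atlas. A chart is a pair of an open set and a map
  that sends it homeomorphically onto an open subset of the model space. The model space is a
  finite-dimensional real inner product space. The class \<^class>\<open>euclidean_space\<close> is not
  used for it because it forces the dimension to be positive, while a point and a
  zero-dimensional Lie group have to count as manifolds.
\<close>

type_synonym ('a, 'm) chart = "'a set \<times> ('a \<Rightarrow> 'm)"

record ('a, 'm) mfd =
  mtop :: "'a topology"
  charts :: "('a, 'm) chart set"

abbreviation pts :: "('a, 'm) mfd \<Rightarrow> 'a set" where
  "pts M \<equiv> topspace (mtop M)"

text \<open>
  \<open>Ck_on k f S\<close> is meant for open \<open>S\<close> and finite-dimensional domain, where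
  continuity of the derivative is the same as continuity of each directional derivative.
\<close>

primrec Ck_on :: "nat \<Rightarrow> ('m::real_normed_vector \<Rightarrow> 'n::real_normed_vector) \<Rightarrow> 'm set \<Rightarrow> bool" where
  "Ck_on 0 f S = continuous_on S f"
| "Ck_on (Suc k) f S =
     (\<exists>f'. (\<forall>x\<in>S. (f has_derivative f' x) (at x)) \<and> (\<forall>v. Ck_on k (\<lambda>x. f' x v) S))"

definition smooth_on :: "('m::real_normed_vector \<Rightarrow> 'n::real_normed_vector) \<Rightarrow> 'm set \<Rightarrow> bool" where
  "smooth_on f S \<longleftrightarrow> (\<forall>k. Ck_on k f S)"

definition chart_inv :: "('a, 'm) chart \<Rightarrow> 'm \<Rightarrow> 'a" where
  "chart_inv c = inv_into (fst c) (snd c)"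

definition is_chart :: "'a topology \<Rightarrow> ('a, 'm::real_inner) chart \<Rightarrow> bool" where
  "is_chart X c \<longleftrightarrow> openin X (fst c) \<and> open (snd c ` fst c) \<and>
     homeomorphic_map (subtopology X (fst c)) (top_of_set (snd c ` fst c)) (snd c)"

definition smooth_manifold :: "('a, 'm::real_inner) mfd \<Rightarrow> bool" where
  "smooth_manifold M \<longleftrightarrow>
     (\<exists>S::'m set. finite S \<and> span S = UNIV) \<and>
     Hausdorff_space (mtop M) \<and> second_countable (mtop M) \<and>
     (\<forall>c\<in>charts M. is_chart (mtop M) c) \<and>
     (\<Union>c\<in>charts M. fst c) = pts M \<and>
     (\<forall>c\<in>charts M. \<forall>d\<in>charts M. smooth_on (snd d \<circ> chart_inv c) (snd c ` (fst c \<inter> fst d)))"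

definition closed_manifold :: "('a, 'm::real_inner) mfd \<Rightarrow> bool" where
  "closed_manifold M \<longleftrightarrow> smooth_manifold M \<and> compact_space (mtop M)"

definition Ck_map :: "nat \<Rightarrow> ('a, 'm::real_inner) mfd \<Rightarrow> ('b, 'n::real_inner) mfd \<Rightarrow> ('a \<Rightarrow> 'b) \<Rightarrow> bool" where
  "Ck_map k M N f \<longleftrightarrow> continuous_map (mtop M) (mtop N) f \<and>
     (\<forall>c\<in>charts M. \<forall>d\<in>charts N.
        Ck_on k (snd d \<circ> f \<circ> chart_inv c) (snd c ` (fst c \<inter> f -` fst d)))"

definition smooth_map :: "('a, 'm::real_inner) mfd \<Rightarrow> ('b, 'n::real_inner) mfd \<Rightarrow> ('a \<Rightarrow> 'b) \<Rightarrow> bool" where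
  "smooth_map M N f \<longleftrightarrow> (\<forall>k. Ck_map k M N f)"

definition diffeomorphism :: "('a, 'm::real_inner) mfd \<Rightarrow> ('b, 'n::real_inner) mfd \<Rightarrow> ('a \<Rightarrow> 'b) \<Rightarrow> bool" where
  "diffeomorphism M N f \<longleftrightarrow> smooth_map M N f \<and>
     (\<exists>g. smooth_map N M g \<and> (\<forall>x\<in>pts M. g (f x) = x) \<and> (\<forall>y\<in>pts N. f (g y) = y))"

definition real_mfd :: "(real, real) mfd" where
  "real_mfd = \<lparr>mtop = euclidean, charts = {(UNIV, id)}\<rparr>"

definition prod_mfd :: "('a, 'm) mfd \<Rightarrow> ('b, 'n) mfd \<Rightarrow> ('a \<times> 'b, 'm \<times> 'n) mfd" where
  "prod_mfd M N = \<lparr>mtop = prod_topology (mtop M) (mtop N),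
     charts = {(fst c \<times> fst d, map_prod (snd c) (snd d)) | c d. c \<in> charts M \<and> d \<in> charts N}\<rparr>"

definition open_submfd :: "('a, 'm) mfd \<Rightarrow> 'a set \<Rightarrow> ('a, 'm) mfd" where
  "open_submfd M U = \<lparr>mtop = subtopology (mtop M) U,
     charts = {(fst c \<inter> U, snd c) | c. c \<in> charts M}\<rparr>"


section \<open>Tangent vectors and Riemannian metrics\<close>

text \<open>
  A tangent vector at \<open>x\<close> is given by its coordinates in all charts around \<open>x\<close>, subject to
  the usual transformation law; the value at all other charts is fixed to be \<open>0\<close>. So the zero
  vector is \<open>\<lambda>_. 0\<close>.
\<close>

type_synonym ('a, 'm) tvec = "('a, 'm) chart \<Rightarrow> 'm"

definition charts_at :: "('a, 'm) mfd \<Rightarrow> 'a \<Rightarrow> ('a, 'm) chart set" where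
  "charts_at M x = {c \<in> charts M. x \<in> fst c}"

definition tangent_space :: "('a, 'm::real_inner) mfd \<Rightarrow> 'a \<Rightarrow> ('a, 'm) tvec set" where
  "tangent_space M x = {v.
     (\<forall>c. c \<notin> charts_at M x \<longrightarrow> v c = 0) \<and>
     (\<forall>c\<in>charts_at M x. \<forall>d\<in>charts_at M x.
        v d = frechet_derivative (snd d \<circ> chart_inv c) (at (snd c x)) (v c))}"

text \<open>The tangent vector at \<open>x\<close> whose coordinates in the chart \<open>c\<close> are \<open>u\<close>.\<close>

definition tangent_of :: "('a, 'm::real_inner) mfd \<Rightarrow> 'a \<Rightarrow> ('a, 'm) chart \<Rightarrow> 'm \<Rightarrow> ('a, 'm) tvec" where
  "tangent_of M x c u = (\<lambda>d. if d \<in> charts_at M x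
     then frechet_derivative (snd d \<circ> chart_inv c) (at (snd c x)) u else 0)"

text \<open>
  For \<open>f\<close> differentiable at \<open>x\<close> and \<open>v\<close> in the tangent space at \<open>x\<close>, the choice of the
  chart around \<open>x\<close> does not matter, by the chain rule.
\<close>

definition differential ::
  "('a, 'm::real_inner) mfd \<Rightarrow> ('b, 'n::real_inner) mfd \<Rightarrow> ('a \<Rightarrow> 'b) \<Rightarrow> 'a \<Rightarrow> ('a, 'm) tvec \<Rightarrow> ('b, 'n) tvec" where
  "differential M N f x v = (let c = (SOME c. c \<in> charts_at M x) in
     (\<lambda>d. if d \<in> charts_at N (f x)
       then frechet_derivative (snd d \<circ> f \<circ> chart_inv c) (at (snd c x)) (v c) else 0))"

type_synonym ('a, 'm) metric = "'a \<Rightarrow> ('a, 'm) tvec \<Rightarrow> ('a, 'm) tvec \<Rightarrow> real"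

definition riemannian_metric :: "('a, 'm::real_inner) mfd \<Rightarrow> ('a, 'm) metric \<Rightarrow> bool" where
  "riemannian_metric M g \<longleftrightarrow>
     (\<forall>x\<in>pts M. \<forall>c\<in>charts_at M x.
        bilinear (\<lambda>u w. g x (tangent_of M x c u) (tangent_of M x c w))) \<and>
     (\<forall>x\<in>pts M. \<forall>v\<in>tangent_space M x. \<forall>w\<in>tangent_space M x. g x v w = g x w v) \<and>
     (\<forall>x\<in>pts M. \<forall>v\<in>tangent_space M x. v \<noteq> (\<lambda>_. 0) \<longrightarrow> g x v v > 0) \<and>
     (\<forall>c\<in>charts M. \<forall>u w.
        smooth_on (\<lambda>y. g (chart_inv c y) (tangent_of M (chart_inv c y) c u)
                                         (tangent_of M (chart_inv c y) c w)) (snd c ` fst c))"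

definition preserves_metric :: "('a, 'm::real_inner) mfd \<Rightarrow> ('a, 'm) metric \<Rightarrow> ('a \<Rightarrow> 'a) \<Rightarrow> bool" where
  "preserves_metric M g F \<longleftrightarrow>
     (\<forall>x\<in>pts M. \<forall>v\<in>tangent_space M x. \<forall>w\<in>tangent_space M x.
        g (F x) (differential M M F x v) (differential M M F x w) = g x v w)"

definition horizontal_space ::
  "('a, 'm::real_inner) mfd \<Rightarrow> ('a, 'm) metric \<Rightarrow> ('b, 'n::real_inner) mfd \<Rightarrow> ('a \<Rightarrow> 'b) \<Rightarrow> 'a \<Rightarrow> ('a, 'm) tvec set" where
  "horizontal_space M g N p x = {v \<in> tangent_space M x.
     \<forall>w\<in>tangent_space M x. differential M N p x w = (\<lambda>_. 0) \<longrightarrow> g x v w = 0}"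

definition riemannian_submersion ::
  "('a, 'm::real_inner) mfd \<Rightarrow> ('a, 'm) metric \<Rightarrow> ('b, 'n::real_inner) mfd \<Rightarrow> ('b, 'n) metric \<Rightarrow> ('a \<Rightarrow> 'b) \<Rightarrow> bool" where
  "riemannian_submersion M g N h p \<longleftrightarrow> smooth_map M N p \<and>
     (\<forall>x\<in>pts M. differential M N p x ` tangent_space M x = tangent_space N (p x)) \<and>
     (\<forall>x\<in>pts M. \<forall>v\<in>horizontal_space M g N p x. \<forall>w\<in>horizontal_space M g N p x.
        h (p x) (differential M N p x v) (differential M N p x w) = g x v w)"

definition critical_set :: "('a, 'm::real_inner) mfd \<Rightarrow> ('a \<Rightarrow> real) \<Rightarrow> real \<Rightarrow> 'a set" where
  "critical_set M f \<mu> = {x \<in> pts M.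
     (\<forall>v\<in>tangent_space M x. differential M real_mfd f x v = (\<lambda>_. 0)) \<and> f x = \<mu>}"


section \<open>Lie groups, smooth actions, fiber bundles\<close>

definition lie_group :: "('g, 'z) monoid_scheme \<Rightarrow> ('g, 'm::real_inner) mfd \<Rightarrow> bool" where
  "lie_group G M \<longleftrightarrow> group G \<and> smooth_manifold M \<and> pts M = carrier G \<and>
     smooth_map (prod_mfd M M) M (\<lambda>(a, b). a \<otimes>\<^bsub>G\<^esub> b) \<and>
     smooth_map M M (\<lambda>a. inv\<^bsub>G\<^esub> a)"

definition bi_invariant :: "('g, 'z) monoid_scheme \<Rightarrow> ('g, 'm::real_inner) mfd \<Rightarrow> ('g, 'm) metric \<Rightarrow> bool" where
  "bi_invariant G M g \<longleftrightarrow>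
     (\<forall>a\<in>carrier G. preserves_metric M g (\<lambda>b. a \<otimes>\<^bsub>G\<^esub> b) \<and> preserves_metric M g (\<lambda>b. b \<otimes>\<^bsub>G\<^esub> a))"

definition smooth_action ::
  "('g, 'z) monoid_scheme \<Rightarrow> ('g, 'k::real_inner) mfd \<Rightarrow> ('a, 'm::real_inner) mfd \<Rightarrow> ('g \<Rightarrow> 'a \<Rightarrow> 'a) \<Rightarrow> bool" where
  "smooth_action G MG M \<Phi> \<longleftrightarrow> group_action G (pts M) \<Phi> \<and>
     smooth_map (prod_mfd MG M) M (\<lambda>(a, x). \<Phi> a x)"

definition smooth_fiber_bundle ::
  "('a, 'm::real_inner) mfd \<Rightarrow> ('b, 'n::real_inner) mfd \<Rightarrow> ('f, 'k::real_inner) mfd \<Rightarrow> ('a \<Rightarrow> 'b) \<Rightarrow> bool" where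
  "smooth_fiber_bundle E B F p \<longleftrightarrow>
     smooth_manifold E \<and> smooth_manifold B \<and> smooth_manifold F \<and>
     smooth_map E B p \<and> p ` pts E = pts B \<and>
     (\<forall>b\<in>pts B. \<exists>U \<psi>. openin (mtop B) U \<and> b \<in> U \<and>
        diffeomorphism (open_submfd E (pts E \<inter> p -` U)) (prod_mfd (open_submfd B U) F) \<psi> \<and>
        (\<forall>x \<in> pts E \<inter> p -` U. fst (\<psi> x) = p x))"


section \<open>Sequential parametrized topological complexity\<close>

text \<open>Maps are made extensional on the domain, so that equality of points is equality of maps.\<close>

definition compact_open_topology :: "'a topology \<Rightarrow> 'b topology \<Rightarrow> ('a \<Rightarrow> 'b) topology" where
  "compact_open_topology X Y = topology_generated_by
     {{\<gamma> \<in> extensional (topspace X). continuous_map X Y \<gamma> \<and> \<gamma> ` K \<subseteq> W} | K W.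
        compactin X K \<and> openin Y W}"

text \<open>Tuples \<open>(a\<^sub>1, \<dots>, a\<^sub>r)\<close> are indexed by \<open>{..<r}\<close>.\<close>

definition fiber_product :: "nat \<Rightarrow> ('a \<Rightarrow> 'b) \<Rightarrow> (nat \<Rightarrow> 'a set) \<Rightarrow> (nat \<Rightarrow> 'a) set" where
  "fiber_product r p A = {a \<in> (\<Pi>\<^sub>E i\<in>{..<r}. A i). \<forall>i<r. \<forall>j<r. p (a i) = p (a j)}"

definition fiber_power_space :: "nat \<Rightarrow> 'a topology \<Rightarrow> ('a \<Rightarrow> 'b) \<Rightarrow> (nat \<Rightarrow> 'a) topology" where
  "fiber_power_space r X p =
     subtopology (product_topology (\<lambda>_. X) {..<r}) (fiber_product r p (\<lambda>_. topspace X))"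

definition fiber_path_space :: "'a topology \<Rightarrow> ('a \<Rightarrow> 'b) \<Rightarrow> (real \<Rightarrow> 'a) topology" where
  "fiber_path_space X p =
     subtopology (compact_open_topology (top_of_set {0..1}) X) {\<gamma>. \<forall>t\<in>{0..1}. p (\<gamma> t) = p (\<gamma> 0)}"

definition path_eval :: "nat \<Rightarrow> (real \<Rightarrow> 'a) \<Rightarrow> nat \<Rightarrow> 'a" where
  "path_eval r \<gamma> = (\<lambda>i\<in>{..<r}. \<gamma> (real i / real (r - 1)))"

definition TC_rel :: "nat \<Rightarrow> 'a topology \<Rightarrow> ('a \<Rightarrow> 'b) \<Rightarrow> (nat \<Rightarrow> 'a) set \<Rightarrow> enat" where
  "TC_rel r X p A = Inf {enat n | n. \<exists>U.
     (\<forall>i<n. openin (fiber_power_space r X p) (U i) \<and>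
        (\<exists>s. continuous_map (subtopology (fiber_power_space r X p) (U i)) (fiber_path_space X p) s \<and>
             (\<forall>u\<in>U i. path_eval r (s u) = u))) \<and>
     A \<subseteq> (\<Union>i<n. U i)}"

definition TC_seq :: "nat \<Rightarrow> 'a topology \<Rightarrow> ('a \<Rightarrow> 'b) \<Rightarrow> enat" where
  "TC_seq r X p = TC_rel r X p (topspace (fiber_power_space r X p))"

end

theory Submission
  imports Defs
begin

text \<open>
  Since \<open>f\<close> is constant along the orbits and the orbit maps \<open>G \<rightarrow> B\<close> are submersions, the
  differential of \<open>f\<close> at a noncritical point does not vanish on the tangent space of the fiber of \<open>p\<close>.
  So near such a point \<open>f\<close> can be decreased by a deformation of \<open>E\<close> over \<open>B\<close> that is
  supported in a bundle chart. Finite compositions of these deformations replace the gradient flow, which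
  need not exist for \<open>f\<close> of class \<open>C\<^sup>1\<close>. They act componentwise on the fiber power, where they push
  a sublevel set of \<open>\<Sum>\<^sub>i f(u\<^sub>i)\<close> below a level, outside any neighborhood of the tuples of critical
  points on that level. As \<open>TC\<close> is subadditive and does not increase under deformations over
  \<open>B\<close>, passing the level \<open>\<mu>\<close> costs at most the \<open>\<mu>\<close>-summand. If the right-hand side is
  finite, then \<open>f\<close> has only finitely many critical values \<open>c\<close>, because the diagonal tuples of
  critical points contribute to the summand of \<open>\<mu> = r c\<close>.
\<close>

text \<open>Transitivity enters through measure theory. By equivariance an orbit map into
  \<open>B\<close> has constant rank. If it were not a submersion, its image would be covered by
  countably many null sets, whereas it is all of \<open>B\<close>. Hence the orbit directions at a
  point of \<open>E\<close> project onto the tangent space of the base and span the tangent space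
  together with the vertical directions. The derivative of \<open>f\<close> vanishes on the former,
  so at a noncritical point it cannot vanish on the latter. On one level the tuples of critical
  points fall into finitely many classes, according to their vectors of critical values. The classes
  have disjoint open neighborhoods, on which planners can be glued. This is why the summand of a
  level is a maximum and not a sum. The estimate for the passage from \<open>a\<close> to
  \<open>b\<close> is additive in the half-open interval \<open>{a<..b}\<close>, so it suffices to
  prove it on short intervals around each point, and the levels never have to be listed in
  order.\<close>

abbreviation unit_interval :: "real topology" where
  "unit_interval \<equiv> top_of_set {0..1}"

section \<open>Topology of the fiber powers\<close>

lemma topspace_fiber_power_space:
  "topspace (fiber_power_space r X p) = fiber_product r p (\<lambda>_. topspace X)"
  by (auto simp: fiber_power_space_def fiber_product_def)

lemma continuous_map_fiber_power_proj:
  "i < r \<Longrightarrow> continuous_map (fiber_power_space r X p) X (\<lambda>u. u i)"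
  unfolding fiber_power_space_def
  by (intro continuous_map_from_subtopology continuous_map_product_projection) auto

lemma continuous_map_into_fiber_power_space:
  assumes "\<And>i. i < r \<Longrightarrow> continuous_map Z X (\<lambda>z. g z i)"
    and "\<And>z i. z \<in> topspace Z \<Longrightarrow> \<not> i < r \<Longrightarrow> g z i = undefined"
    and "\<And>z i j. \<lbrakk>z \<in> topspace Z; i < r; j < r\<rbrakk> \<Longrightarrow> p (g z i) = p (g z j)"
  shows "continuous_map Z (fiber_power_space r X p) g"
  unfolding fiber_power_space_def
proof (rule continuous_map_into_subtopology)
  show "continuous_map Z (product_topology (\<lambda>_. X) {..<r}) g"
    using assms(1,2) by (auto simp: continuous_map_componentwise extensional_def)
  show "g \<in> topspace Z \<rightarrow> fiber_product r p (\<lambda>_. topspace X)"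
  proof
    fix z assume z: "z \<in> topspace Z"
    have "g z i \<in> topspace X" if "i < r" for i
      using continuous_map_funspace[OF assms(1)[OF that]] z by auto
    then have "g z \<in> (\<Pi>\<^sub>E i\<in>{..<r}. topspace X)"
      using assms(2)[OF z] by auto
    moreover have "\<forall>i<r. \<forall>j<r. p (g z i) = p (g z j)"
      using assms(3)[OF z] by blast
    ultimately show "g z \<in> fiber_product r p (\<lambda>_. topspace X)"
      unfolding fiber_product_def by (intro CollectI conjI)
  qed
qed

text \<open>As \<open>Y\<close> is Hausdorff, the conditions \<open>p (u i) = p (u j)\<close> are
  closed in the compact power of \<open>X\<close>.\<close>

lemma compact_space_fiber_power_space:
  assumes "compact_space X" and "Hausdorff_space Y" and "continuous_map X Y p"
  shows "compact_space (fiber_power_space r X p)"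
proof -
  let ?T = "product_topology (\<lambda>_::nat. X) {..<r}"
  have "compact_space ?T"
    using assms(1) by (simp add: compact_space_product_topology)
  have proj: "continuous_map ?T Y (\<lambda>u. p (u i))" if "i < r" for i
    using continuous_map_compose[OF _ assms(3), of ?T "\<lambda>u. u i"]
      continuous_map_product_projection[of i "{..<r}" "\<lambda>_. X"] that
    by (simp add: o_def)
  have cl: "closedin ?T {u \<in> topspace ?T. p (u i) = p (u j)}" if "i < r" "j < r" for i j
    using closedin_continuous_maps_eq[OF assms(2) proj proj] that by blast
  \<comment> \<open>Inserting the whole space keeps the intersected family nonempty for
    \<open>r = 0\<close>.\<close>
  have "fiber_product r p (\<lambda>_. topspace X) =
      \<Inter> (insert (topspace ?T) ((\<lambda>(i, j). {u \<in> topspace ?T. p (u i) = p (u j)}) ` ({..<r} \<times> {..<r})))"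
    by (auto simp: fiber_product_def)
  also have "closedin ?T \<dots>"
    using cl by (intro closedin_Inter) (auto simp del: topspace_product_topology)
  finally show ?thesis
    unfolding fiber_power_space_def
    by (metis \<open>compact_space ?T\<close> closedin_compact_space compact_space_subtopology)
qed

section \<open>The compact-open topology and motion planners\<close>

lemma topspace_compact_open_topology:
  "topspace (compact_open_topology X Y) = {\<gamma> \<in> extensional (topspace X). continuous_map X Y \<gamma>}"
  unfolding compact_open_topology_def topology_generated_by_topspace
proof (rule equalityI)
  let ?A = "{\<gamma> \<in> extensional (topspace X). continuous_map X Y \<gamma>}"
  let ?S = "{{\<gamma> \<in> extensional (topspace X). continuous_map X Y \<gamma> \<and> \<gamma> ` K \<subseteq> W} | K W. compactin X K \<and> openin Y W}"
  show "\<Union> ?S \<subseteq> ?A"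
    by blast
  \<comment> \<open>Empty \<open>K\<close> and \<open>W\<close> give a subbasic set that contains
    every extensional continuous map.\<close>
  have "?A = {\<gamma> \<in> extensional (topspace X). continuous_map X Y \<gamma> \<and> \<gamma> ` {} \<subseteq> {}}"
    by simp
  then have "?A \<in> ?S"
    using compactin_empty openin_empty by blast
  then show "?A \<subseteq> \<Union> ?S"
    by (rule Union_upper)
qed

text \<open>The complement of the preimage of the subbasic set of \<open>K\<close> and
  \<open>W\<close> is the projection to \<open>Z\<close> of the closed set of pairs over
  \<open>K\<close> that are sent outside \<open>W\<close>. Projecting along the compact
  \<open>K\<close> is a closed map.\<close>

lemma continuous_map_curry_compact_open:
  assumes "continuous_map (prod_topology X Z) Y (\<lambda>(x, z). \<sigma> x z)"
  shows "continuous_map Z (compact_open_topology X Y) (\<lambda>z. restrict (\<lambda>x. \<sigma> x z) (topspace X))"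
  unfolding compact_open_topology_def
proof (rule continuous_on_generated_topo)
  let ?f = "\<lambda>z. restrict (\<lambda>x. \<sigma> x z) (topspace X)"
  have cont: "continuous_map X Y (?f z)" if "z \<in> topspace Z" for z
  proof -
    have "continuous_map X Y ((\<lambda>(x, z). \<sigma> x z) \<circ> (\<lambda>x. (x, z)))"
      by (rule continuous_map_compose[OF _ assms]) (use that in \<open>auto simp: continuous_map_pairwise o_def\<close>)
    then show ?thesis
      by (rule continuous_map_eq) auto
  qed
  let ?S = "{{\<gamma> \<in> extensional (topspace X). continuous_map X Y \<gamma> \<and> \<gamma> ` K \<subseteq> W} | K W. compactin X K \<and> openin Y W}"
  show "?f ` topspace Z \<subseteq> \<Union> ?S"
  proof
    fix \<gamma> assume "\<gamma> \<in> ?f ` topspace Z"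
    then have "\<gamma> \<in> {\<gamma> \<in> extensional (topspace X). continuous_map X Y \<gamma> \<and> \<gamma> ` {} \<subseteq> {}}"
      using cont by auto
    moreover have "{\<gamma> \<in> extensional (topspace X). continuous_map X Y \<gamma> \<and> \<gamma> ` {} \<subseteq> {}} \<in> ?S"
      using compactin_empty openin_empty by blast
    ultimately show "\<gamma> \<in> \<Union> ?S"
      by (rule UnionI[rotated])
  qed
  fix U assume "U \<in> ?S"
  then obtain K W where KW: "compactin X K" "openin Y W"
    and U: "U = {\<gamma> \<in> extensional (topspace X). continuous_map X Y \<gamma> \<and> \<gamma> ` K \<subseteq> W}"
    by auto
  have KX: "K \<subseteq> topspace X"
    using KW compactin_subset_topspace by auto
  have "compact_space (subtopology X K)"
    using KW compact_space_subtopology by blast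
  then have clo: "closed_map (prod_topology (subtopology X K) Z) Z snd"
    by (rule closed_map_snd)
  have c2: "continuous_map (prod_topology (subtopology X K) Z) Y (\<lambda>(x, z). \<sigma> x z)"
    using continuous_map_from_subtopology[OF assms, of "K \<times> topspace Z"]
    using prod_topology_subtopology(1)[of X K Z] by simp
  let ?D = "{q \<in> topspace (prod_topology (subtopology X K) Z). (\<lambda>(x, z). \<sigma> x z) q \<in> topspace Y - W}"
  have "closedin (prod_topology (subtopology X K) Z) ?D"
    using KW by (intro closedin_continuous_map_preimage[OF c2]) auto
  then have "closedin Z (snd ` ?D)"
    using clo unfolding closed_map_def by blast
  then have op: "openin Z (topspace Z - snd ` ?D)"
    by blast
  have mem: "\<sigma> x z \<in> topspace Y" if "x \<in> K" "z \<in> topspace Z" for x z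
    using funcset_mem[OF continuous_map_funspace[OF cont[OF that(2)]], of x] KX that(1) by auto
  have "z \<in> snd ` ?D \<longleftrightarrow> \<not> ?f z ` K \<subseteq> W" if "z \<in> topspace Z" for z
  proof -
    have "z \<in> snd ` ?D \<longleftrightarrow> (\<exists>x\<in>K. \<sigma> x z \<notin> W)"
      using that KX mem[OF _ that] by (force simp: image_iff)
    also have "\<dots> \<longleftrightarrow> \<not> ?f z ` K \<subseteq> W"
      using KX by auto
    finally show ?thesis .
  qed
  then have "?f -` U \<inter> topspace Z = topspace Z - snd ` ?D"
    using cont unfolding U by blast
  with op show "openin Z (?f -` U \<inter> topspace Z)"
    by simp
qed

text \<open>Local compactness of the interval is the point: a compact neighborhood \<open>K\<close>
  of \<open>t\<close> is still sent into \<open>W\<close> by \<open>s z\<close>, and hence by all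
  maps \<open>s z'\<close> in the subbasic set of \<open>K\<close> and \<open>W\<close>, which is a
  neighborhood of \<open>s z\<close>.\<close>

lemma continuous_map_uncurry_compact_open:
  assumes s: "continuous_map Z (compact_open_topology unit_interval Y) s"
  shows "continuous_map (prod_topology unit_interval Z) Y (\<lambda>(t, z). s z t)"
proof -
  have sp: "continuous_map unit_interval Y (s z)" if "z \<in> topspace Z" for z
    using continuous_map_image_subset_topspace[OF s] that
    by (auto simp: topspace_compact_open_topology)
  show ?thesis
    unfolding continuous_map_def
  proof (intro conjI allI impI)
    show "(\<lambda>(t, z). s z t) \<in> topspace (prod_topology unit_interval Z) \<rightarrow> topspace Y"
      using sp by (fastforce simp: continuous_map_def Pi_iff)
    fix W assume W: "openin Y W"
    let ?Q = "{q \<in> topspace (prod_topology unit_interval Z). (\<lambda>(t, z). s z t) q \<in> W}"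
    show "openin (prod_topology unit_interval Z) ?Q"
    proof (subst openin_subopen, safe)
      fix t z assume tz: "(t, z) \<in> topspace (prod_topology unit_interval Z)" and sW: "s z t \<in> W"
      then have t: "t \<in> {0..1}" and z: "z \<in> topspace Z" by auto
      have "openin unit_interval {t \<in> {0..1}. s z t \<in> W}"
        using sp[OF z] W by (auto simp: continuous_map_def)
      then obtain O' where O': "open O'" "{t \<in> {0..1}. s z t \<in> W} = {0..1} \<inter> O'"
        by (auto simp: openin_open)
      then obtain e where e: "e > 0" "cball t e \<subseteq> O'"
        using t sW open_contains_cball by blast
      define K where "K = {0..1} \<inter> cball t e"
      have "compactin unit_interval K"
        unfolding K_def by (simp add: compactin_subtopology compactin_euclidean_iff compact_Int)
      define N where "N = {\<gamma> \<in> extensional {0..1}. continuous_map unit_interval Y \<gamma> \<and> \<gamma> ` K \<subseteq> W}"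
      have "openin (compact_open_topology unit_interval Y) N"
        unfolding compact_open_topology_def N_def
        by (rule topology_generated_by_Basis) (use \<open>compactin unit_interval K\<close> W in auto)
      then have "openin Z {z \<in> topspace Z. s z \<in> N}"
        using s by (auto simp: continuous_map_def)
      moreover have "openin unit_interval ({0..1} \<inter> ball t e)"
        by (simp add: openin_open_Int)
      moreover have "s z \<in> N"
      proof -
        have "K \<subseteq> {t \<in> {0..1}. s z t \<in> W}"
          using e O' by (auto simp: K_def)
        moreover have "s z \<in> extensional {0..1}"
          using continuous_map_image_subset_topspace[OF s] z
          by (auto simp: topspace_compact_open_topology)
        ultimately show ?thesis
          using sp[OF z] by (auto simp: N_def)
      qed
      ultimately show "\<exists>T. openin (prod_topology unit_interval Z) T \<and> (t, z) \<in> T \<and> T \<subseteq> ?Q"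
        using t z e by (intro exI[where x="({0..1} \<inter> ball t e) \<times> {z \<in> topspace Z. s z \<in> N}"])
           (auto simp: openin_prod_Times_iff N_def K_def image_subset_iff)
    qed
  qed
qed

section \<open>Open sets that carry a motion planner\<close>

definition planned :: "nat \<Rightarrow> 'a topology \<Rightarrow> ('a \<Rightarrow> 'b) \<Rightarrow> (nat \<Rightarrow> 'a) set \<Rightarrow> bool" where
  "planned r X p U \<longleftrightarrow> openin (fiber_power_space r X p) U \<and>
     (\<exists>s. continuous_map (subtopology (fiber_power_space r X p) U) (fiber_path_space X p) s \<and>
          (\<forall>u\<in>U. path_eval r (s u) = u))"

text \<open>The exponential law turns a section into the path space into a map of time and tuple. In
  this form planners can be reparametrized and pasted in time without reference to the compact-open
  topology.\<close>

lemma planned_iff: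
  "planned r X p U \<longleftrightarrow> openin (fiber_power_space r X p) U \<and>
     (\<exists>\<sigma>. continuous_map (prod_topology unit_interval (subtopology (fiber_power_space r X p) U)) X
              (\<lambda>(t, u). \<sigma> t u) \<and>
          (\<forall>u\<in>U. \<forall>t\<in>{0..1}. p (\<sigma> t u) = p (\<sigma> 0 u)) \<and>
          (\<forall>u\<in>U. \<forall>i<r. \<sigma> (real i / real (r - 1)) u = u i))"
  (is "_ \<longleftrightarrow> _ \<and> ?R")
proof (cases "openin (fiber_power_space r X p) U")
  case True
  let ?P = "fiber_power_space r X p"
  have UP: "topspace (subtopology ?P U) = U"
    using openin_subset[OF True] by auto
  \<comment> \<open>The equation \<open>path_eval r (s u) = u\<close> also concerns indices outside
    \<open>{..<r}\<close>, where both sides are \<open>undefined\<close>.\<close>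
  have ext: "u i = undefined" if "u \<in> U" "\<not> i < r" for u i
    using that openin_subset[OF True]
    by (auto simp: topspace_fiber_power_space fiber_product_def PiE_def extensional_def)
  have unit: "real i / real (r - 1) \<in> {0..1}" if "i < r" for i
    using that by (auto simp: divide_simps)
  have "planned r X p U \<longleftrightarrow> ?R"
  proof
    assume "planned r X p U"
    then obtain s where s: "continuous_map (subtopology ?P U) (fiber_path_space X p) s"
      and e: "\<forall>u\<in>U. path_eval r (s u) = u"
      by (auto simp: planned_def)
    have s1: "continuous_map (subtopology ?P U) (compact_open_topology unit_interval X) s"
      and s2: "\<forall>u\<in>U. \<forall>t\<in>{0..1}. p (s u t) = p (s u 0)"
      using s UP unfolding fiber_path_space_def continuous_map_in_subtopology by auto
    have "\<forall>u\<in>U. \<forall>i<r. path_eval r (s u) i = s u (real i / real (r - 1))"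
      by (simp add: path_eval_def)
    with e have "\<forall>u\<in>U. \<forall>i<r. s u (real i / real (r - 1)) = u i"
      by metis
    with s2 continuous_map_uncurry_compact_open[OF s1] show ?R
      by (intro exI[where x="\<lambda>t u. s u t"] conjI)
  next
    assume ?R
    then obtain \<sigma> where \<sigma>: "continuous_map (prod_topology unit_interval (subtopology ?P U)) X (\<lambda>(t, u). \<sigma> t u)"
      "\<forall>u\<in>U. \<forall>t\<in>{0..1}. p (\<sigma> t u) = p (\<sigma> 0 u)"
      "\<forall>u\<in>U. \<forall>i<r. \<sigma> (real i / real (r - 1)) u = u i"
      by blast
    define s where "s = (\<lambda>u. restrict (\<lambda>t. \<sigma> t u) {0..1})"
    have "continuous_map (subtopology ?P U) (fiber_path_space X p) s"
      unfolding fiber_path_space_def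
    proof (rule continuous_map_into_subtopology)
      show "continuous_map (subtopology ?P U) (compact_open_topology unit_interval X) s"
        using continuous_map_curry_compact_open[OF \<sigma>(1)] by (simp add: s_def)
      show "s \<in> topspace (subtopology ?P U) \<rightarrow> {\<gamma>. \<forall>t\<in>{0..1}. p (\<gamma> t) = p (\<gamma> 0)}"
      proof
        fix u assume "u \<in> topspace (subtopology ?P U)"
        then have "\<forall>t\<in>{0..1}. p (\<sigma> t u) = p (\<sigma> 0 u)"
          using UP \<sigma>(2) by blast
        then show "s u \<in> {\<gamma>. \<forall>t\<in>{0..1}. p (\<gamma> t) = p (\<gamma> 0)}"
          unfolding s_def mem_Collect_eq by (metis atLeastAtMost_iff order_refl restrict_apply' zero_le_one)
      qed
    qed
    moreover have "path_eval r (s u) i = u i" if "u \<in> U" for u i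
      using \<sigma>(3) that ext[OF that, of i] unit[of i] by (simp add: path_eval_def s_def restrict_def)
    ultimately show "planned r X p U"
      using True by (auto simp: planned_def fun_eq_iff)
  qed
  with True show ?thesis by simp
qed (simp add: planned_def)

lemma planned_openin: "planned r X p U \<Longrightarrow> openin (fiber_power_space r X p) U"
  by (simp add: planned_def)

lemma planned_empty: "planned r X p {}"
  by (auto simp: planned_def continuous_map_def)

lemma planned_subset:
  assumes "planned r X p U" and "openin (fiber_power_space r X p) V" and "V \<subseteq> U"
  shows "planned r X p V"
proof -
  obtain s where s: "continuous_map (subtopology (fiber_power_space r X p) U) (fiber_path_space X p) s"
    "\<forall>u\<in>U. path_eval r (s u) = u"
    using assms(1) unfolding planned_def by blast
  have "continuous_map (subtopology (fiber_power_space r X p) V) (fiber_path_space X p) s"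
    using continuous_map_from_subtopology_mono[OF s(1) assms(3)] .
  with s(2) assms(2,3) show ?thesis
    unfolding planned_def by blast
qed

text \<open>On disjoint open sets the sections paste without any compatibility condition, so
  arbitrarily many such pieces count as one member of a cover.\<close>

lemma planned_Union_disjoint:
  assumes pl: "\<And>i. i \<in> I \<Longrightarrow> planned r X p (U i)"
    and disj: "\<And>i j. \<lbrakk>i \<in> I; j \<in> I; i \<noteq> j\<rbrakk> \<Longrightarrow> U i \<inter> U j = {}"
  shows "planned r X p (\<Union>i\<in>I. U i)"
proof -
  let ?P = "fiber_power_space r X p"
  let ?V = "\<Union>i\<in>I. U i"
  have op: "openin ?P (U i)" if "i \<in> I" for i
    using pl[OF that] by (rule planned_openin)
  obtain s where s: "\<And>i. i \<in> I \<Longrightarrow> continuous_map (subtopology ?P (U i)) (fiber_path_space X p) (s i)"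
    and e: "\<And>i u. i \<in> I \<Longrightarrow> u \<in> U i \<Longrightarrow> path_eval r (s i u) = u"
    using pl unfolding planned_def by metis
  have sub: "subtopology (subtopology ?P ?V) (U i) = subtopology ?P (U i)" if "i \<in> I" for i
    using that by (simp add: subtopology_subtopology Int_absorb1 UN_upper)
  obtain k where k: "k u \<in> I" "u \<in> U (k u)" if "u \<in> ?V" for u
    by (metis UN_E)
  define g where "g u = s (k u) u" for u
  have g_eq: "g u = s i u" if "i \<in> I" "u \<in> U i" for i u
    using disj[of "k u" i] k[of u] that unfolding g_def by blast
  have VP: "topspace (subtopology ?P ?V) = ?V"
    using op openin_subset by fastforce
  have g: "continuous_map (subtopology ?P ?V) (fiber_path_space X p) g"
  proof (rule pasting_lemma[where I=I and T=U and f=s])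
    show "openin (subtopology ?P ?V) (U i)" if "i \<in> I" for i
      using that op openin_subtopology_Int2[of ?P "U i" ?V] by (simp add: Int_absorb1 UN_upper)
    show "continuous_map (subtopology (subtopology ?P ?V) (U i)) (fiber_path_space X p) (s i)" if "i \<in> I" for i
      unfolding sub[OF that] by (rule s[OF that])
    show "s i x = s j x" if "i \<in> I" "j \<in> I" "x \<in> topspace (subtopology ?P ?V) \<inter> U i \<inter> U j" for i j x
      using disj[of i j] that by blast
    show "\<exists>j. j \<in> I \<and> x \<in> U j \<and> g x = s j x" if "x \<in> topspace (subtopology ?P ?V)" for x
      using k[of x] that unfolding VP g_def by blast
  qed
  have "path_eval r (g u) = u" if "u \<in> ?V" for u
    using k[OF that] e unfolding g_def by blast
  moreover have "openin ?P ?V"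
    using op by blast
  ultimately show ?thesis
    using g
    unfolding planned_def by blast
qed

text \<open>An infimum below \<open>enat (Suc n)\<close> is witnessed by a cover with at most
  \<open>n\<close> members, which is filled up to length \<open>n\<close> with empty sets.\<close>

lemma TC_rel_le_iff:
  "TC_rel r X p A \<le> enat n \<longleftrightarrow> (\<exists>U. (\<forall>i<n. planned r X p (U i)) \<and> A \<subseteq> (\<Union>i<n. U i))"
proof
  let ?S = "{enat n | n. \<exists>U. (\<forall>i<n. planned r X p (U i)) \<and> A \<subseteq> (\<Union>i<n. U i)}"
  have TC: "TC_rel r X p A = Inf ?S"
    by (simp add: TC_rel_def planned_def)
  {
    assume "TC_rel r X p A \<le> enat n"
    then have "Inf ?S < enat (Suc n)"
      unfolding TC by (rule order_le_less_trans) simp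
    then obtain m U where m: "m \<le> n" and U: "\<forall>i<m. planned r X p (U i)" "A \<subseteq> (\<Union>i<m. U i)"
      by (auto simp: Inf_less_iff less_Suc_eq_le)
    have "(\<forall>i<n. planned r X p (if i < m then U i else {})) \<and> A \<subseteq> (\<Union>i<n. if i < m then U i else {})"
      using U m by (fastforce simp: planned_empty)
    then show "\<exists>U. (\<forall>i<n. planned r X p (U i)) \<and> A \<subseteq> (\<Union>i<n. U i)"
      by (intro exI[where x="\<lambda>i. if i < m then U i else {}"])
  }
  assume "\<exists>U. (\<forall>i<n. planned r X p (U i)) \<and> A \<subseteq> (\<Union>i<n. U i)"
  then show "TC_rel r X p A \<le> enat n"
    unfolding TC by (intro Inf_lower) auto
qed

lemma TC_rel_mono: "A \<subseteq> A' \<Longrightarrow> TC_rel r X p A \<le> TC_rel r X p A'"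
  by (cases "TC_rel r X p A'") (auto simp: TC_rel_le_iff dest!: eq_refl, blast)

lemma TC_rel_empty: "TC_rel r X p {} = 0"
  using TC_rel_le_iff[of r X p "{}" 0] by (simp flip: zero_enat_def)

lemma TC_rel_eq_0_iff: "TC_rel r X p A = 0 \<longleftrightarrow> A = {}"
  using TC_rel_le_iff[of r X p A 0] by (auto simp: TC_rel_empty simp flip: zero_enat_def)

lemma TC_rel_Un: "TC_rel r X p (A \<union> A') \<le> TC_rel r X p A + TC_rel r X p A'"
proof (cases "TC_rel r X p A"; cases "TC_rel r X p A'")
  fix m n assume mn: "TC_rel r X p A = enat m" "TC_rel r X p A' = enat n"
  then obtain U V where U: "\<forall>i<m. planned r X p (U i)" "A \<subseteq> (\<Union>i<m. U i)"
    and V: "\<forall>i<n. planned r X p (V i)" "A' \<subseteq> (\<Union>i<n. V i)"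
    by (metis TC_rel_le_iff order_refl)
  define W where "W i = (if i < m then U i else V (i - m))" for i
  have "\<forall>i<m + n. planned r X p (W i)"
    using U V by (auto simp: W_def)
  moreover have "A \<union> A' \<subseteq> (\<Union>i<m + n. W i)"
  proof
    fix u assume "u \<in> A \<union> A'"
    then consider i where "i < m" "u \<in> U i" | i where "i < n" "u \<in> V i"
      using U V by blast
    then show "u \<in> (\<Union>i<m + n. W i)"
    proof cases
      case 1 then show ?thesis by (auto simp: W_def intro!: bexI[of _ i])
    next
      case 2 then show ?thesis by (auto simp: W_def intro!: bexI[of _ "m + i"])
    qed
  qed
  ultimately show ?thesis
    unfolding mn plus_enat_simps TC_rel_le_iff by blast
qed auto

text \<open>The \<open>k\<close>-th members of all covers are cut down to the disjoint sets
  \<open>O' i\<close> and united, so the number of members does not grow with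
  \<open>I\<close>.\<close>

lemma TC_rel_UN_separated:
  assumes A: "\<And>i. i \<in> I \<Longrightarrow> TC_rel r X p (A i) \<le> m"
    and O: "\<And>i. i \<in> I \<Longrightarrow> openin (fiber_power_space r X p) (O' i)" "\<And>i. i \<in> I \<Longrightarrow> A i \<subseteq> O' i"
    and disj: "\<And>i j. \<lbrakk>i \<in> I; j \<in> I; i \<noteq> j\<rbrakk> \<Longrightarrow> O' i \<inter> O' j = {}"
  shows "TC_rel r X p (\<Union>i\<in>I. A i) \<le> m"
proof (cases m)
  case (enat n)
  have "\<forall>i\<in>I. \<exists>U. (\<forall>k<n. planned r X p (U k)) \<and> A i \<subseteq> (\<Union>k<n. U k)"
    using A unfolding enat TC_rel_le_iff by blast
  then obtain U where U: "\<And>i k. i \<in> I \<Longrightarrow> k < n \<Longrightarrow> planned r X p (U i k)"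
    "\<And>i. i \<in> I \<Longrightarrow> A i \<subseteq> (\<Union>k<n. U i k)"
    by metis
  have "planned r X p (\<Union>i\<in>I. U i k \<inter> O' i)" if "k < n" for k
  proof (rule planned_Union_disjoint)
    show "planned r X p (U i k \<inter> O' i)" if "i \<in> I" for i
      using planned_subset[OF U(1)[OF that \<open>k < n\<close>]] O(1)[OF that]
        planned_openin[OF U(1)[OF that \<open>k < n\<close>]] by blast
    show "U i k \<inter> O' i \<inter> (U j k \<inter> O' j) = {}" if "i \<in> I" "j \<in> I" "i \<noteq> j" for i j
      using disj[OF that] by blast
  qed
  moreover have "(\<Union>i\<in>I. A i) \<subseteq> (\<Union>k<n. \<Union>i\<in>I. U i k \<inter> O' i)"
    using U(2) O(2) by fastforce
  ultimately show ?thesis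
    unfolding enat TC_rel_le_iff by (intro exI[where x="\<lambda>k. \<Union>i\<in>I. U i k \<inter> O' i"]) blast
qed auto

section \<open>Fiberwise deformations\<close>

text \<open>The weak inequality \<open>f (h 1 x) \<le> f x\<close> would not be enough at time 1: a
  point could be moved within its level, away from the place where a later deformation would have
  lowered it. Nothing is required of \<open>f\<close> at intermediate times, because the tracks only
  serve to connect end points within fibers.\<close>

definition fiber_deformation :: "'a topology \<Rightarrow> ('a \<Rightarrow> 'b) \<Rightarrow> ('a \<Rightarrow> real) \<Rightarrow> (real \<Rightarrow> 'a \<Rightarrow> 'a) \<Rightarrow> bool" where
  "fiber_deformation X p f h \<longleftrightarrow>
     continuous_map (prod_topology unit_interval X) X (\<lambda>(t, x). h t x) \<and>
     (\<forall>x\<in>topspace X. h 0 x = x \<and> (\<forall>t\<in>{0..1}. p (h t x) = p x) \<and> (h 1 x = x \<or> f (h 1 x) < f x))"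

lemma fiber_deformation_in:
  "\<lbrakk>fiber_deformation X p f h; x \<in> topspace X; t \<in> {0..1}\<rbrakk> \<Longrightarrow> h t x \<in> topspace X"
  using funcset_mem[OF continuous_map_funspace, of "prod_topology unit_interval X" X "\<lambda>(t, x). h t x" "(t, x)"]
  by (auto simp: fiber_deformation_def)

lemma fiber_deformation_le:
  "\<lbrakk>fiber_deformation X p f h; x \<in> topspace X\<rbrakk> \<Longrightarrow> f (h 1 x) \<le> f x"
  unfolding fiber_deformation_def by fastforce

lemma continuous_map_fiber_deformation:
  assumes "fiber_deformation X p f h" and "t \<in> {0..1}"
  shows "continuous_map X X (h t)"
proof -
  have "continuous_map X X ((\<lambda>(t, x). h t x) \<circ> (\<lambda>x. (t, x)))"
    by (rule continuous_map_compose[where X'="prod_topology unit_interval X"])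
       (use assms in \<open>auto simp: fiber_deformation_def continuous_map_pairwise o_def\<close>)
  then show ?thesis
    by (simp add: o_def)
qed

lemma fiber_deformation_id: "fiber_deformation X p f (\<lambda>t x. x)"
  by (simp add: fiber_deformation_def case_prod_unfold continuous_map_snd)

text \<open>Both deformations run at the same time, which avoids pasting in time and is harmless as
  only the values of \<open>f\<close> at time 1 are constrained.\<close>

lemma fiber_deformation_comp:
  assumes h: "fiber_deformation X p f h" and k: "fiber_deformation X p f k"
  shows "fiber_deformation X p f (\<lambda>t x. k t (h t x))"
  unfolding fiber_deformation_def
proof (intro conjI ballI)
  let ?I = "prod_topology unit_interval X"
  have "continuous_map ?I ?I (\<lambda>q. (fst q, (\<lambda>(t, x). h t x) q))"
    using h unfolding fiber_deformation_def by (intro continuous_map_pairedI continuous_map_fst) auto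
  then have "continuous_map ?I X ((\<lambda>(t, x). k t x) \<circ> (\<lambda>q. (fst q, (\<lambda>(t, x). h t x) q)))"
    by (rule continuous_map_compose) (use k in \<open>simp add: fiber_deformation_def\<close>)
  then show "continuous_map ?I X (\<lambda>(t, x). k t (h t x))"
    by (simp add: o_def case_prod_unfold)
  fix x assume x: "x \<in> topspace X"
  show "k 0 (h 0 x) = x"
    using h k x by (simp add: fiber_deformation_def)
  show "p (k t (h t x)) = p x" if "t \<in> {0..1}" for t
    using h k x fiber_deformation_in[OF h x that] that unfolding fiber_deformation_def by metis
  have "h 1 x \<in> topspace X"
    using fiber_deformation_in[OF h x] by simp
  then show "k 1 (h 1 x) = x \<or> f (k 1 (h 1 x)) < f x"
    using h k x unfolding fiber_deformation_def by (metis order_less_trans)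
qed

text \<open>
  A path through \<open>h 1 u\<^sub>0, \<dots>, h 1 u\<^sub>r\<^sub>-\<^sub>1\<close> becomes a path through the \<open>u\<^sub>i\<close> once the
  track \<open>t \<mapsto> h t u\<^sub>i\<close> is inserted, backwards and forwards, around the \<open>i\<close>-th time. In the rescaled
  time \<open>(r - 1) t\<close> the excursion to \<open>u\<^sub>i\<close> takes place in \<open>[i - 1/3, i + 1/3]\<close>.
\<close>

lemma planned_deform:
  assumes r: "r \<ge> 2" and h: "fiber_deformation X p f h" and V: "planned r X p V"
  shows "planned r X p {u \<in> topspace (fiber_power_space r X p). (\<lambda>i\<in>{..<r}. h 1 (u i)) \<in> V}"
proof -
  let ?P = "fiber_power_space r X p"
  define H where "H u = (\<lambda>i\<in>{..<r}. h 1 (u i))" for u :: "nat \<Rightarrow> 'a"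
  define W where "W = {u \<in> topspace ?P. H u \<in> V}"
  have fp: "u i \<in> topspace X" "p (u i) = p (u j)" if "u \<in> topspace ?P" "i < r" "j < r" for u i j
  proof -
    have "u \<in> (\<Pi>\<^sub>E i\<in>{..<r}. topspace X)" "\<forall>i<r. \<forall>j<r. p (u i) = p (u j)"
      using that(1) unfolding topspace_fiber_power_space fiber_product_def by blast+
    with that(2,3) show "u i \<in> topspace X" "p (u i) = p (u j)"
      by blast+
  qed
  have h0: "h 0 x = x" and hp: "t \<in> {0..1} \<Longrightarrow> p (h t x) = p x" if "x \<in> topspace X" for x t
    using h that by (simp_all add: fiber_deformation_def)
  have Hcont: "continuous_map ?P ?P H"
  proof (rule continuous_map_into_fiber_power_space)
    show "continuous_map ?P X (\<lambda>u. H u i)" if "i < r" for i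
    proof -
      have "continuous_map ?P X (h 1 \<circ> (\<lambda>u. u i))"
        using continuous_map_compose[OF continuous_map_fiber_power_proj[OF that]
            continuous_map_fiber_deformation[OF h, of 1]] by simp
      then show ?thesis
        using that by (simp add: H_def o_def)
    qed
    show "H u i = undefined" if "\<not> i < r" for u i
      using that by (simp add: H_def)
    show "p (H u i) = p (H u j)" if "u \<in> topspace ?P" "i < r" "j < r" for u i j
      using that fp[OF that] fp(1)[OF that(1,3,2)] hp by (simp add: H_def)
  qed
  have opV: "openin ?P V"
    using V by (rule planned_openin)
  have opW: "openin ?P W"
    unfolding W_def using Hcont opV by (simp add: continuous_map_def)
  have WP: "W \<subseteq> topspace ?P"
    by (auto simp: W_def)
  have topW: "topspace (subtopology ?P W) = W"
    using WP by auto
  obtain \<sigma> where \<sigma>c: "continuous_map (prod_topology unit_interval (subtopology ?P V)) X (\<lambda>(t, u). \<sigma> t u)"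
    and \<sigma>p: "\<And>u t. u \<in> V \<Longrightarrow> t \<in> {0..1} \<Longrightarrow> p (\<sigma> t u) = p (\<sigma> 0 u)"
    and \<sigma>e: "\<And>u i. u \<in> V \<Longrightarrow> i < r \<Longrightarrow> \<sigma> (real i / real (r - 1)) u = u i"
    using V unfolding planned_iff by blast
  define R where "R = real (r - 1)"
  have R: "R \<ge> 1"
    using r by (simp add: R_def)
  \<comment> \<open>The \<open>i\<close>-th summand rises from 0 to 1 while \<open>R * t\<close>
    runs through \<open>[i + 1/3, i + 2/3]\<close>. So \<open>\<alpha>\<close> rests at
    \<open>j / R\<close> during the excursion to \<open>u j\<close>, and the planned path is
    traversed between the excursions.\<close>
  define \<alpha> where "\<alpha> t = (\<Sum>i<r - 1. max 0 (min 1 (3 * (R * t - real i) - 1))) / R" for t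
  \<comment> \<open>The excursion times \<open>D i\<close> and the moving times \<open>M\<close> are
    closed, cover the interval, and meet only at the seams, where \<open>R * t\<close> has distance
    1/3 from \<open>i\<close>.\<close>
  define D where "D i = {t \<in> {0..1}. \<bar>R * t - real i\<bar> \<le> 1/3}" for i
  define M where "M = {t \<in> {0..1}. \<forall>i<r. \<bar>R * t - real i\<bar> \<ge> 1/3}"
  have \<alpha>_cont: "continuous_on {0..1} \<alpha>"
    unfolding \<alpha>_def using R by (intro continuous_intros) auto
  have \<alpha>_range: "\<alpha> t \<in> {0..1}" for t
  proof -
    have "(\<Sum>i<r - 1. max 0 (min 1 (3 * (R * t - real i) - 1))) \<le> (\<Sum>i<r - 1. 1)"
      by (rule sum_mono) auto
    also have "\<dots> = R"
      by (simp add: R_def)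
    finally show ?thesis
      unfolding \<alpha>_def using R by (simp add: sum_nonneg)
  qed
  have \<alpha>_D: "\<alpha> t = real j / R" if "t \<in> D j" "j < r" for t j
  proof -
    have b: "real j - 1/3 \<le> R * t" "R * t \<le> real j + 1/3"
      using that(1) unfolding D_def mem_Collect_eq abs_le_iff by linarith+
    have "max 0 (min 1 (3 * (R * t - real i) - 1)) = (if i < j then 1 else 0)" for i
    proof (cases "i < j")
      case True
      then have "real i + 1 \<le> real j" by simp
      with b True show ?thesis by auto
    next
      case False
      then have "real j \<le> real i" by simp
      with b False show ?thesis by auto
    qed
    then have "(\<Sum>i<r - 1. max 0 (min 1 (3 * (R * t - real i) - 1))) = (\<Sum>i<r - 1. if i < j then 1 else (0::real))"
      by simp
    also have "\<dots> = (\<Sum>i\<in>{..<r - 1} \<inter> {..<j}. 1)"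
      by (simp add: sum.inter_restrict del: sum_constant)
    also have "{..<r - 1} \<inter> {..<j} = {..<j}"
      using that(2) by auto
    also have "(\<Sum>i\<in>{..<j}. 1) = real j"
      by simp
    finally show ?thesis
      by (simp add: \<alpha>_def)
  qed
  \<comment> \<open>Index \<open>r\<close> stands for the planned motion. The cap
    \<open>min 1\<close> keeps the deformation time in the interval outside \<open>D i\<close>, so
    that each \<open>g i\<close> is continuous on the whole domain.\<close>
  define g where "g i = (\<lambda>(t, u). if i < r then h (min 1 (3 * \<bar>R * t - real i\<bar>)) (u i) else \<sigma> (\<alpha> t) (H u))" for i :: nat
  define T where "T i = (if i < r then D i else M) \<times> W" for i
  define \<tau> where "\<tau> t u = g (if t \<in> M then r else (SOME i. i < r \<and> t \<in> D i)) (t, u)" for t u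
  let ?Z = "prod_topology unit_interval (subtopology ?P W)"
  have D_disj: "i = j" if "t \<in> D i" "t \<in> D j" for i j t
  proof (rule ccontr)
    assume "i \<noteq> j"
    then have "\<bar>real i - real j\<bar> \<ge> 1"
      by (cases "i < j") auto
    with that show False
      unfolding D_def by (auto simp: abs_le_iff abs_if split: if_splits)
  qed
  have D_ex: "\<exists>i<r. t \<in> D i" if "t \<in> {0..1}" "t \<notin> M" for t
    using that unfolding M_def D_def by fastforce
  \<comment> \<open>At a seam the track of \<open>u i\<close> has arrived at
    \<open>h 1 (u i)\<close>, and this is where the planned path for \<open>H u\<close> stands at
    time \<open>i / R\<close>.\<close>
  have agree: "g i (t, u) = g r (t, u)" if "i < r" "t \<in> D i" "t \<in> M" "u \<in> W" for i t u
  proof -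
    have "\<bar>R * t - real i\<bar> = 1/3"
      using that by (auto simp: D_def M_def intro!: order_antisym)
    moreover have "H u \<in> V"
      using that by (simp add: W_def)
    ultimately show ?thesis
      using \<sigma>e[of "H u" i] \<alpha>_D[OF that(2,1)] that(1) by (simp add: g_def H_def R_def)
  qed
  have \<tau>_D: "\<tau> t u = h (min 1 (3 * \<bar>R * t - real i\<bar>)) (u i)" if "i < r" "t \<in> D i" "u \<in> W" for i t u
  proof (cases "t \<in> M")
    case True
    then show ?thesis
      using agree[OF that(1,2) True that(3)] that(1) by (simp add: \<tau>_def g_def)
  next
    case False
    have "(SOME i. i < r \<and> t \<in> D i) = i"
      using that D_disj by (intro some_equality) auto
    with False that show ?thesis
      by (simp add: \<tau>_def g_def)
  qed
  have \<tau>_M: "\<tau> t u = \<sigma> (\<alpha> t) (H u)" if "t \<in> M" for t u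
    using that by (simp add: \<tau>_def g_def)
  have cont: "continuous_map ?Z X (\<lambda>(t, u). \<tau> t u)"
  proof (rule pasting_lemma_closed[where I="{..r}" and T=T and f=g])
    show "closedin ?Z (T i)" for i
    proof -
      have "closed (D i)" "closed M"
        unfolding D_def M_def by (intro closed_Collect_conj closed_Collect_all closed_Collect_imp
            closed_Collect_le continuous_intros open_Collect_const | simp)+
      then have "closedin unit_interval (if i < r then D i else M)"
        by (intro closed_subset) (auto simp: D_def M_def)
      moreover have "closedin (subtopology ?P W) W"
        using topW closedin_topspace by metis
      ultimately show ?thesis
        unfolding T_def by (simp add: closedin_prod_Times_iff)
    qed
    show "continuous_map (subtopology ?Z (T i)) X (g i)" if "i \<in> {..r}" for i
    proof (rule continuous_map_from_subtopology)
      show "continuous_map ?Z X (g i)"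
      proof (cases "i < r")
        case True
        have "continuous_map ?Z (prod_topology unit_interval X) (\<lambda>q. (min 1 (3 * \<bar>R * fst q - real i\<bar>), snd q i))"
        proof (rule continuous_map_pairedI)
          have c: "continuous_map unit_interval unit_interval (\<lambda>t. min 1 (3 * \<bar>R * t - real i\<bar>))"
            by (auto simp: continuous_map_in_subtopology intro!: continuous_intros)
          show "continuous_map ?Z unit_interval (\<lambda>q. min 1 (3 * \<bar>R * fst q - real i\<bar>))"
            using continuous_map_compose[OF continuous_map_fst c] by (simp only: o_def)
          have "continuous_map (subtopology ?P W) X (\<lambda>u. u i)"
            by (intro continuous_map_from_subtopology continuous_map_fiber_power_proj True)
          then show "continuous_map ?Z X (\<lambda>q. snd q i)"
            using continuous_map_compose[OF continuous_map_snd[of unit_interval "subtopology ?P W"]] by (simp add: o_def)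
        qed
        from continuous_map_compose[OF this, of X "\<lambda>(t, x). h t x"] show ?thesis
          using h True by (simp add: fiber_deformation_def g_def o_def case_prod_unfold)
      next
        case False
        have "continuous_map ?Z (prod_topology unit_interval (subtopology ?P V)) (\<lambda>q. (\<alpha> (fst q), H (snd q)))"
        proof (rule continuous_map_pairedI)
          have c: "continuous_map unit_interval unit_interval \<alpha>"
            using \<alpha>_cont \<alpha>_range by (auto simp: continuous_map_in_subtopology)
          show "continuous_map ?Z unit_interval (\<lambda>q. \<alpha> (fst q))"
            using continuous_map_compose[OF continuous_map_fst c] by (simp only: o_def)
          have "continuous_map (subtopology ?P W) (subtopology ?P V) H"
            using Hcont topW by (intro continuous_map_into_subtopology continuous_map_from_subtopology) (auto simp: W_def)
          then show "continuous_map ?Z (subtopology ?P V) (\<lambda>q. H (snd q))"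
            using continuous_map_compose[OF continuous_map_snd[of unit_interval "subtopology ?P W"]] by (simp add: o_def)
        qed
        from continuous_map_compose[OF this \<sigma>c] show ?thesis
          using False by (simp add: g_def o_def case_prod_unfold)
      qed
    qed
    show "g i q = g j q" if ij: "i \<in> {..r}" "j \<in> {..r}" and q: "q \<in> topspace ?Z \<inter> T i \<inter> T j" for i j q
    proof -
      obtain t u where tu: "q = (t, u)" "u \<in> W"
        using q unfolding T_def by (cases q) auto
      consider "i = j" | "i < r" "j < r" "t \<in> D i" "t \<in> D j" | "i < r" "j = r" "t \<in> D i" "t \<in> M"
        | "i = r" "j < r" "t \<in> D j" "t \<in> M"
        using ij q tu unfolding T_def by (cases "i < r"; cases "j < r") auto
      then show ?thesis
      proof cases
        case 2 then show ?thesis using D_disj by metis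
      qed (use tu agree in \<open>simp_all\<close>)
    qed
    show "\<exists>j. j \<in> {..r} \<and> q \<in> T j \<and> (\<lambda>(t, u). \<tau> t u) q = g j q" if "q \<in> topspace ?Z" for q
    proof -
      obtain t u where tu: "q = (t, u)" "t \<in> {0..1}" "u \<in> W"
        using \<open>q \<in> topspace ?Z\<close> topW by (cases q) auto
      show ?thesis
      proof (cases "t \<in> M")
        case True
        then show ?thesis
          using tu by (intro exI[of _ r]) (simp add: T_def \<tau>_M g_def)
      next
        case False
        then obtain i where "i < r" "t \<in> D i"
          using D_ex[OF tu(2)] by blast
        then show ?thesis
          using tu by (intro exI[of _ i]) (simp add: T_def \<tau>_D g_def)
      qed
    qed
  qed simp
  have \<tau>p: "p (\<tau> t u) = p (u 0)" if "u \<in> W" and t01: "t \<in> {0..1}" for t u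
  proof (cases "t \<in> M")
    case True
    have HV: "H u \<in> V"
      using that by (simp add: W_def)
    have "p (\<tau> t u) = p (\<sigma> 0 (H u))"
      using \<sigma>p[OF HV \<alpha>_range] True by (simp add: \<tau>_M)
    also have "\<dots> = p (h 1 (u 0))"
      using \<sigma>e[OF HV, of 0] r by (simp add: H_def)
    also have "\<dots> = p (u 0)"
      using fp(1)[of u 0 0] WP that r by (intro hp) auto
    finally show ?thesis .
  next
    case False
    then obtain i where i: "i < r" "t \<in> D i"
      using D_ex[OF t01] by blast
    have "p (\<tau> t u) = p (u i)"
      using \<tau>_D[OF i that(1)] fp(1)[of u i i] WP that i by (auto intro!: hp)
    also have "\<dots> = p (u 0)"
      using fp(2)[of u i 0] WP that r i by auto
    finally show ?thesis .
  qed
  have \<tau>e: "\<tau> (real i / real (r - 1)) u = u i" if "u \<in> W" "i < r" for u i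
  proof -
    have "R * (real i / real (r - 1)) = real i"
      using R by (simp add: R_def)
    moreover have "real i / real (r - 1) \<in> {0..1}"
      using that r by (auto simp: divide_simps)
    ultimately have "\<tau> (real i / real (r - 1)) u = h 0 (u i)"
      using \<tau>_D[OF that(2) _ that(1), of "real i / real (r - 1)"] by (simp add: D_def)
    then show ?thesis
      using h0[OF fp(1)[of u i i]] WP that by auto
  qed
  have "planned r X p W"
    unfolding planned_iff
  proof (intro conjI opW exI[of _ \<tau>] ballI allI impI cont \<tau>e)
    show "p (\<tau> t u) = p (\<tau> 0 u)" if "u \<in> W" "t \<in> {0..1}" for u t
      using \<tau>p[OF that] \<tau>p[OF that(1), of 0] by simp
  qed
  then show ?thesis
    by (simp add: W_def H_def)
qed

text \<open>The members of a cover of \<open>A'\<close> are replaced by their preimages under the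
  end map of the deformation, which are planned by \<open>planned_deform\<close>.\<close>

lemma TC_rel_deform:
  assumes r: "r \<ge> 2" and h: "fiber_deformation X p f h" and A: "A \<subseteq> topspace (fiber_power_space r X p)"
    and hA: "\<And>u. u \<in> A \<Longrightarrow> (\<lambda>i\<in>{..<r}. h 1 (u i)) \<in> A'"
  shows "TC_rel r X p A \<le> TC_rel r X p A'"
proof (cases "TC_rel r X p A'")
  case (enat n)
  then obtain V where V: "\<forall>k<n. planned r X p (V k)" "A' \<subseteq> (\<Union>k<n. V k)"
    by (metis TC_rel_le_iff order_refl)
  define W where "W k = {u \<in> topspace (fiber_power_space r X p). (\<lambda>i\<in>{..<r}. h 1 (u i)) \<in> V k}" for k
  have "\<forall>k<n. planned r X p (W k)"
    unfolding W_def using V(1) planned_deform[OF r h] by blast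
  moreover have "A \<subseteq> (\<Union>k<n. W k)"
  proof
    fix u assume u: "u \<in> A"
    then obtain k where "k < n" "(\<lambda>i\<in>{..<r}. h 1 (u i)) \<in> V k"
      using hA V(2) by blast
    with u A show "u \<in> (\<Union>k<n. W k)"
      unfolding W_def by blast
  qed
  ultimately show ?thesis
    unfolding enat TC_rel_le_iff by blast
qed auto

section \<open>Lusternik-Schnirelmann theory on the fiber power\<close>

lemma fiber_productI:
  assumes "\<And>i. i < r \<Longrightarrow> a i \<in> A i" and "a \<in> extensional {..<r}"
    and "\<And>i j. \<lbrakk>i < r; j < r\<rbrakk> \<Longrightarrow> p (a i) = p (a j)"
  shows "a \<in> fiber_product r p A"
  unfolding fiber_product_def
proof (intro CollectI conjI allI impI)
  show "a \<in> (\<Pi>\<^sub>E i\<in>{..<r}. A i)"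
    using assms(1,2) by (simp add: PiE_iff)
qed (rule assms(3))

lemma fiber_productD:
  assumes "a \<in> fiber_product r p A"
  shows "i < r \<Longrightarrow> a i \<in> A i" and "a \<in> extensional {..<r}"
    and "\<lbrakk>i < r; j < r\<rbrakk> \<Longrightarrow> p (a i) = p (a j)"
proof -
  have *: "a \<in> (\<Pi>\<^sub>E i\<in>{..<r}. A i)" "\<forall>i<r. \<forall>j<r. p (a i) = p (a j)"
    using assms unfolding fiber_product_def by blast+
  show "i < r \<Longrightarrow> a i \<in> A i" "a \<in> extensional {..<r}"
    using *(1) by (auto simp: PiE_iff)
  show "\<lbrakk>i < r; j < r\<rbrakk> \<Longrightarrow> p (a i) = p (a j)"
    using *(2) by blast
qed

text \<open>The deformations are composed one by one. A point has either been lowered by the earlier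
  ones, and the next one cannot undo this, or it has not been moved and meets the next one in its
  original place.\<close>

lemma finite_decrease_fiber_deformation:
  assumes "finite S" and "\<And>x. x \<in> S \<Longrightarrow> fiber_deformation X p f (h x)"
  obtains H where "fiber_deformation X p f H"
    "\<And>x y. \<lbrakk>x \<in> S; y \<in> topspace X; f (h x 1 y) < f y\<rbrakk> \<Longrightarrow> f (H 1 y) < f y"
proof -
  have "\<exists>H. fiber_deformation X p f H \<and>
     (\<forall>x\<in>S. \<forall>y\<in>topspace X. f (h x 1 y) < f y \<longrightarrow> f (H 1 y) < f y)"
    using assms
  proof (induction S)
    case empty
    show ?case
      using fiber_deformation_id by fastforce
  next
    case (insert a S)
    then obtain H where H: "fiber_deformation X p f H"
      "\<And>x y. \<lbrakk>x \<in> S; y \<in> topspace X; f (h x 1 y) < f y\<rbrakk> \<Longrightarrow> f (H 1 y) < f y"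
      by (meson insertCI)
    have a: "fiber_deformation X p f (h a)"
      using insert.prems by simp
    let ?K = "\<lambda>t y. h a t (H t y)"
    have K: "fiber_deformation X p f ?K"
      by (rule fiber_deformation_comp[OF H(1) a])
    have "f (?K 1 y) < f y" if x: "x \<in> insert a S" and y: "y \<in> topspace X" and lt: "f (h x 1 y) < f y" for x y
    proof -
      have Hy: "H 1 y \<in> topspace X"
        using fiber_deformation_in[OF H(1) y] by simp
      have le: "f (?K 1 y) \<le> f (H 1 y)"
        using fiber_deformation_le[OF a Hy] .
      consider "f (H 1 y) < f y" | "H 1 y = y"
        using H(1) y unfolding fiber_deformation_def by blast
      then show ?thesis
      proof cases
        case 1
        with le show ?thesis by simp
      next
        case 2
        have "x = a"
          using H(2)[of x y] x y lt 2 by auto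
        with lt 2 show ?thesis by simp
      qed
    qed
    with K show ?case by blast
  qed
  with that show thesis by blast
qed

lemma continuous_map_real_attains_sup:
  fixes g :: "'a \<Rightarrow> real"
  assumes "compactin X K" "K \<noteq> {}" "continuous_map X euclideanreal g"
  obtains x where "x \<in> K" "\<And>y. y \<in> K \<Longrightarrow> g y \<le> g x"
proof -
  have "compact (g ` K)"
    using image_compactin[OF assms(1,3)] by (simp add: compactin_euclidean_iff)
  then obtain s where "s \<in> g ` K" "\<forall>t\<in>g ` K. t \<le> s"
    using compact_attains_sup[of "g ` K"] assms(2) by auto
  with that show thesis by blast
qed

text \<open>A nonzero \<open>enat\<close> is at least 1, so infinitely many nonzero terms would have
  an infinite sum.\<close>

lemma enat_infsum_finite_support:
  fixes n :: "'a \<Rightarrow> enat"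
  assumes "(\<Sum>\<^sub>\<infinity>x\<in>UNIV. n x) \<noteq> \<infinity>"
  shows "finite {x. n x \<noteq> 0}" and "(\<Sum>\<^sub>\<infinity>x\<in>UNIV. n x) = sum n {x. n x \<noteq> 0}"
proof -
  have eq: "(\<Sum>\<^sub>\<infinity>x\<in>UNIV. n x) = (\<Sum>\<^sub>\<infinity>x\<in>{x. n x \<noteq> 0}. n x)"
    by (rule infsum_cong_neutral) auto
  show fin: "finite {x. n x \<noteq> 0}"
  proof (rule ccontr)
    assume "infinite {x. n x \<noteq> 0}"
    then have "(\<Sum>\<^sub>\<infinity>x\<in>{x. n x \<noteq> 0}. n x) = \<infinity>"
      by (intro infsum_superconst_infinite_enat[where b=1]) (auto simp: ileI1 one_eSuc)
    with eq assms show False by simp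
  qed
  then show "(\<Sum>\<^sub>\<infinity>x\<in>UNIV. n x) = sum n {x. n x \<noteq> 0}"
    using eq by simp
qed

text \<open>Separates the topological argument from the geometry: \<open>C\<close> stands for the
  set of critical points, and all that remains of invariance, transitivity and differentiability is
  \<open>local_decrease\<close>.\<close>

locale lusternik_schnirelmann =
  fixes r :: nat and X :: "'a topology" and Y :: "'b topology" and p :: "'a \<Rightarrow> 'b"
    and f :: "'a \<Rightarrow> real" and C :: "'a set"
  assumes r: "r \<ge> 2"
    and compact_X: "compact_space X" and Hausdorff_Y: "Hausdorff_space Y"
    and p_cont: "continuous_map X Y p" and f_cont: "continuous_map X euclideanreal f"
    and C_sub: "C \<subseteq> topspace X"
    and local_decrease: "\<And>x. \<lbrakk>x \<in> topspace X; x \<notin> C\<rbrakk> \<Longrightarrow>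
      \<exists>h. fiber_deformation X p f h \<and> f (h 1 x) < f x"
begin

abbreviation "P \<equiv> fiber_power_space r X p"

section \<open>Sublevel sets of the sum of the values over a tuple\<close>

definition total :: "(nat \<Rightarrow> 'a) \<Rightarrow> real" where
  "total u = (\<Sum>i<r. f (u i))"

definition sublevel :: "real \<Rightarrow> (nat \<Rightarrow> 'a) set" where
  "sublevel a = {u \<in> topspace P. total u \<le> a}"

definition critical_tuples :: "(nat \<Rightarrow> real) \<Rightarrow> (nat \<Rightarrow> 'a) set" where
  "critical_tuples \<nu> = fiber_product r p (\<lambda>i. {x \<in> C. f x = \<nu> i})"

definition level_bound :: "real \<Rightarrow> enat" where
  "level_bound \<mu> = (SUP \<nu> \<in> {\<nu>. (\<Sum>i<r. \<nu> i) = \<mu>}. TC_rel r X p (critical_tuples \<nu>))"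

lemma point_in: "\<lbrakk>u \<in> topspace P; i < r\<rbrakk> \<Longrightarrow> u i \<in> topspace X"
  using continuous_map_funspace[OF continuous_map_fiber_power_proj[of i r X p]] by blast

lemma compact_P: "compact_space P"
  by (rule compact_space_fiber_power_space[OF compact_X Hausdorff_Y p_cont])

lemma continuous_coord: "i < r \<Longrightarrow> continuous_map P euclideanreal (\<lambda>u. f (u i))"
  using continuous_map_compose[OF continuous_map_fiber_power_proj f_cont, of i r p] by (simp add: o_def)

lemma continuous_total: "continuous_map P euclideanreal total"
  unfolding total_def by (intro continuous_map_sum continuous_coord) auto

text \<open>Compactness of \<open>K\<close> is used twice: finitely many local deformations suffice
  and can be composed, and the resulting change of \<open>total\<close>, continuous and negative on
  \<open>K\<close>, has a negative maximum there.\<close>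

lemma strict_decrease:
  assumes K: "compactin P K" and nc: "\<And>u. u \<in> K \<Longrightarrow> \<exists>i<r. u i \<notin> C"
  obtains h e where "fiber_deformation X p f h" "e > 0"
    "\<And>u. u \<in> K \<Longrightarrow> total (\<lambda>i\<in>{..<r}. h 1 (u i)) \<le> total u - e"
proof (cases "K = {}")
  case True
  with that[OF fiber_deformation_id, of 1] show thesis by simp
next
  case False
  have KP: "K \<subseteq> topspace P"
    using K compactin_subset_topspace by blast
  obtain h where h: "\<And>x. \<lbrakk>x \<in> topspace X; x \<notin> C\<rbrakk> \<Longrightarrow> fiber_deformation X p f (h x) \<and> f (h x 1 x) < f x"
    using local_decrease by metis
  \<comment> \<open>The cover is indexed by points of \<open>X\<close> instead of tuples, because
    one deformation moves all entries of a tuple. A drop in a single entry suffices, since no entry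
    can rise.\<close>
  define N where "N x = {u \<in> topspace P. \<exists>i<r. f (h x 1 (u i)) < f (u i)}" for x
  have N_open: "openin P (N x)" if "x \<in> topspace X" "x \<notin> C" for x
  proof -
    have "continuous_map X X (h x 1)"
      using continuous_map_fiber_deformation[of X p f "h x" 1] h[OF that] by simp
    then have c: "continuous_map X euclideanreal (\<lambda>y. f (h x 1 y))"
      using continuous_map_compose[OF _ f_cont] by (fastforce simp: o_def)
    have "openin P {u \<in> topspace P. f (h x 1 (u i)) - f (u i) \<in> {..<0}}" if "i < r" for i
    proof (rule openin_continuous_map_preimage)
      show "continuous_map P euclideanreal (\<lambda>u. f (h x 1 (u i)) - f (u i))"
        using continuous_map_compose[OF continuous_map_fiber_power_proj[OF that] c] continuous_coord[OF that]
        by (intro continuous_map_diff) (simp_all add: o_def)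
    qed simp
    then have "openin P (\<Union>i<r. {u \<in> topspace P. f (h x 1 (u i)) - f (u i) \<in> {..<0}})"
      by blast
    also have "\<dots> = N x"
      by (auto simp: N_def)
    finally show ?thesis .
  qed
  obtain F where "finite F" "F \<subseteq> N ` (topspace X - C)" "K \<subseteq> \<Union> F"
  proof -
    have cover: "K \<subseteq> \<Union> (N ` (topspace X - C))"
    proof
      fix u assume u: "u \<in> K"
      then obtain i where i: "i < r" "u i \<notin> C"
        using nc by blast
      moreover have "u i \<in> topspace X"
        using point_in u KP i by blast
      ultimately have "u \<in> N (u i)"
        using h[of "u i"] u KP by (auto simp: N_def)
      with i \<open>u i \<in> topspace X\<close> show "u \<in> \<Union> (N ` (topspace X - C))"
        by blast
    qed
    have op: "\<And>V. V \<in> N ` (topspace X - C) \<Longrightarrow> openin P V"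
      using N_open by blast
    show thesis
      using compactinD[OF K op cover] that by blast
  qed
  then obtain S where S: "finite S" "S \<subseteq> topspace X - C" "K \<subseteq> (\<Union>x\<in>S. N x)"
    by (metis finite_subset_image)
  obtain H where H: "fiber_deformation X p f H"
    and dec: "\<And>x y. \<lbrakk>x \<in> S; y \<in> topspace X; f (h x 1 y) < f y\<rbrakk> \<Longrightarrow> f (H 1 y) < f y"
    using finite_decrease_fiber_deformation[of S X p f h] S h by blast
  define g where "g u = (\<Sum>i<r. f (H 1 (u i)) - f (u i))" for u
  have g_eq: "total (\<lambda>i\<in>{..<r}. H 1 (u i)) = total u + g u" for u
    by (simp add: total_def g_def sum_subtractf)
  have "continuous_map X X (H 1)"
    using continuous_map_fiber_deformation[OF H, of 1] by simp
  then have c: "continuous_map X euclideanreal (\<lambda>y. f (H 1 y))"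
    using continuous_map_compose[OF _ f_cont] by (fastforce simp: o_def)
  have g_cont: "continuous_map P euclideanreal g"
    unfolding g_def
  proof (intro continuous_map_sum continuous_map_diff continuous_coord)
    show "continuous_map P euclideanreal (\<lambda>u. f (H 1 (u i)))" if "i \<in> {..<r}" for i
      using continuous_map_compose[OF continuous_map_fiber_power_proj c, of i r p] that by (simp add: o_def)
  qed auto
  have g_neg: "g u < 0" if u: "u \<in> K" for u
  proof -
    have le: "f (H 1 (u i)) - f (u i) \<le> 0" if "i < r" for i
      using fiber_deformation_le[OF H point_in[OF _ that]] u KP by auto
    obtain x i where "x \<in> S" "i < r" "f (h x 1 (u i)) < f (u i)"
      using S(3) u by (auto simp: N_def)
    then have "f (H 1 (u i)) - f (u i) < 0"
      using dec[OF _ point_in] u KP by auto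
    with le \<open>i < r\<close> have "g u < (\<Sum>i<r. 0)"
      unfolding g_def by (intro sum_strict_mono_ex1) auto
    then show ?thesis by simp
  qed
  obtain m where m: "m \<in> K" "\<And>u. u \<in> K \<Longrightarrow> g u \<le> g m"
    using continuous_map_real_attains_sup[OF K False g_cont] by blast
  show thesis
  proof (rule that[OF H])
    show "- g m > 0"
      using g_neg m(1) by simp
    show "total (\<lambda>i\<in>{..<r}. H 1 (u i)) \<le> total u - - g m" if "u \<in> K" for u
      using m(2)[OF that] by (simp add: g_eq)
  qed
qed

lemma total_deform_le:
  assumes "fiber_deformation X p f h" and "u \<in> topspace P"
  shows "total (\<lambda>i\<in>{..<r}. h 1 (u i)) \<le> total u"
  unfolding total_def using fiber_deformation_le[OF assms(1) point_in[OF assms(2)]]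
  by (intro sum_mono) simp

lemma deform_in_P:
  assumes h: "fiber_deformation X p f h" and u: "u \<in> topspace P"
  shows "(\<lambda>i\<in>{..<r}. h 1 (u i)) \<in> topspace P"
proof -
  have "p (h 1 (u i)) = p (u i)" if "i < r" for i
    using h point_in[OF u that] by (simp add: fiber_deformation_def)
  moreover have "p (u i) = p (u j)" if "i < r" "j < r" for i j
    using fiber_productD(3)[OF u[unfolded topspace_fiber_power_space]] that by blast
  ultimately have eq: "p (h 1 (u i)) = p (h 1 (u j))" if "i < r" "j < r" for i j
    using that by metis
  have "h 1 (u i) \<in> topspace X" if "i < r" for i
    using fiber_deformation_in[OF h point_in[OF u that]] by simp
  then show ?thesis
    unfolding topspace_fiber_power_space
  proof (intro fiber_productI)
    show "p ((\<lambda>i\<in>{..<r}. h 1 (u i)) i) = p ((\<lambda>i\<in>{..<r}. h 1 (u i)) j)" if "i < r" "j < r" for i j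
      using eq[OF that] that by simp
  qed simp_all
qed

lemma sublevel_mono: "a \<le> b \<Longrightarrow> sublevel a \<subseteq> sublevel b"
  by (auto simp: sublevel_def)

text \<open>The complement of \<open>U\<close> is compact, so \<open>total\<close> has a minimum
  there, which exceeds \<open>a\<close>. Half of the excess serves as \<open>e\<close>.\<close>

lemma sublevel_in_open:
  assumes "openin P U" and "sublevel a \<subseteq> U"
  obtains e where "e > 0" "sublevel (a + e) \<subseteq> U"
proof (cases "topspace P - U = {}")
  case True
  with that[of 1] show thesis
    by (auto simp: sublevel_def)
next
  case False
  have "compactin P (topspace P - U)"
    using assms(1) compact_P by (intro closedin_compact_space) auto
  moreover have "continuous_map P euclideanreal (\<lambda>u. - total u)"
    by (intro continuous_map_minus continuous_total)
  ultimately obtain m where m: "m \<in> topspace P - U" "\<And>u. u \<in> topspace P - U \<Longrightarrow> total m \<le> total u"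
    using continuous_map_real_attains_sup[of P "topspace P - U" "\<lambda>u. - total u"] False by auto
  have "total m > a"
    using m(1) assms(2) by (auto simp: sublevel_def)
  moreover have "sublevel (a + (total m - a) / 2) \<subseteq> U"
  proof
    fix u assume u: "u \<in> sublevel (a + (total m - a) / 2)"
    show "u \<in> U"
    proof (rule ccontr)
      assume "u \<notin> U"
      with u m(2)[of u] \<open>total m > a\<close> show False
        by (auto simp: sublevel_def field_simps)
    qed
  qed
  ultimately show thesis
    using that[of "(total m - a) / 2"] by simp
qed

text \<open>A cover of a sublevel set by open sets also covers a slightly higher sublevel
  set.\<close>

lemma TC_sublevel_right:
  obtains e where "e > 0" "TC_rel r X p (sublevel (a + e)) \<le> TC_rel r X p (sublevel a)"
proof (cases "TC_rel r X p (sublevel a)")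
  case (enat n)
  then obtain U where U: "\<forall>i<n. planned r X p (U i)" "sublevel a \<subseteq> (\<Union>i<n. U i)"
    by (metis TC_rel_le_iff order_refl)
  have "openin P (\<Union>i<n. U i)"
    using U(1) planned_openin by blast
  then obtain e where e: "e > 0" "sublevel (a + e) \<subseteq> (\<Union>i<n. U i)"
    using sublevel_in_open U(2) by blast
  then have "TC_rel r X p (sublevel (a + e)) \<le> TC_rel r X p (sublevel a)"
    unfolding enat TC_rel_le_iff using U(1) by blast
  with e(1) that show thesis by blast
next
  case infinity
  with that[of 1] show thesis by simp
qed

section \<open>Passing a level when there are finitely many critical values\<close>

context
  assumes finite_critical_values: "finite (f ` C)"
begin

lemma finite_critical_totals: "finite (total ` {u \<in> topspace P. \<forall>i<r. u i \<in> C})"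
proof -
  have "total ` {u \<in> topspace P. \<forall>i<r. u i \<in> C} \<subseteq>
      (\<lambda>\<nu>. \<Sum>i<r. \<nu> i) ` (\<Pi>\<^sub>E i\<in>{..<r}. f ` C)"
  proof
    fix s assume "s \<in> total ` {u \<in> topspace P. \<forall>i<r. u i \<in> C}"
    then obtain u where u: "\<forall>i<r. u i \<in> C" "s = total u"
      by auto
    then show "s \<in> (\<lambda>\<nu>. \<Sum>i<r. \<nu> i) ` (\<Pi>\<^sub>E i\<in>{..<r}. f ` C)"
      by (intro image_eqI[of _ _ "\<lambda>i\<in>{..<r}. f (u i)"]) (auto simp: total_def)
  qed
  moreover have "finite (\<Pi>\<^sub>E i\<in>{..<r}. f ` C)"
    using finite_critical_values by (intro finite_PiE) auto
  ultimately show ?thesis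
    using finite_subset by blast
qed

text \<open>Tuples with different vectors of critical values are separated by the distances between
  critical values, so \<open>TC_rel_UN_separated\<close> charges only the largest contribution to
  the level.\<close>

lemma TC_critical_level:
  "TC_rel r X p {u \<in> topspace P. (\<forall>i<r. u i \<in> C) \<and> total u = \<mu>} \<le> level_bound \<mu>"
proof -
  define N where "N = {\<nu> \<in> (\<Pi>\<^sub>E i\<in>{..<r}. f ` C). (\<Sum>i<r. \<nu> i) = \<mu>}"
  \<comment> \<open>The gaps between distinct critical values. The number 1 that is inserted below
    provides for the case of at most one critical value.\<close>
  define D where "D = (\<lambda>(a, b). \<bar>a - b\<bar>) ` ((f ` C \<times> f ` C) - Id)"
  obtain d :: real where d: "d > 0" "\<And>a b. \<lbrakk>a \<in> f ` C; b \<in> f ` C; a \<noteq> b\<rbrakk> \<Longrightarrow> d \<le> \<bar>a - b\<bar>"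
  proof -
    have "finite D"
      unfolding D_def using finite_critical_values by simp
    then have "finite (insert 1 D)" by simp
    show thesis
    proof (rule that[of "Min (insert 1 D)"])
      show "Min (insert 1 D) > 0"
        using \<open>finite D\<close> by (auto simp: D_def)
      show "Min (insert 1 D) \<le> \<bar>a - b\<bar>" if "a \<in> f ` C" "b \<in> f ` C" "a \<noteq> b" for a b
        using that \<open>finite (insert 1 D)\<close> by (intro Min_le) (auto simp: D_def image_iff intro!: bexI[of _ "(a, b)"])
    qed
  qed
  \<comment> \<open>Half of the lower bound \<open>d\<close> for the gaps keeps the neighborhoods of
    different vectors disjoint.\<close>
  define O' where "O' \<nu> = {u \<in> topspace P. \<forall>i<r. \<bar>f (u i) - \<nu> i\<bar> < d / 2}" for \<nu>
  have "TC_rel r X p (\<Union>\<nu>\<in>N. critical_tuples \<nu>) \<le> level_bound \<mu>"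
  proof (rule TC_rel_UN_separated[where O'=O'])
    show "TC_rel r X p (critical_tuples \<nu>) \<le> level_bound \<mu>" if "\<nu> \<in> N" for \<nu>
      unfolding level_bound_def using that by (intro SUP_upper) (simp add: N_def)
    show "openin P (O' \<nu>)" for \<nu>
    proof -
      have "openin P {u \<in> topspace P. \<bar>f (u i) - \<nu> i\<bar> \<in> {..<d / 2}}" if "i < r" for i
        by (rule openin_continuous_map_preimage[where Y=euclideanreal])
           (use continuous_coord[OF that] in \<open>auto intro!: continuous_map_real_abs continuous_map_diff\<close>)
      then have "openin P (\<Inter> (insert (topspace P) ((\<lambda>i. {u \<in> topspace P. \<bar>f (u i) - \<nu> i\<bar> \<in> {..<d / 2}}) ` {..<r})))"
        by (intro openin_Inter) auto
      also have "\<dots> = O' \<nu>"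
        by (auto simp: O'_def)
      finally show ?thesis .
    qed
    show "critical_tuples \<nu> \<subseteq> O' \<nu>" for \<nu>
    proof
      fix u assume "u \<in> critical_tuples \<nu>"
      note u = fiber_productD[OF this[unfolded critical_tuples_def]]
      have "u \<in> topspace P"
        unfolding topspace_fiber_power_space by (rule fiber_productI) (use u(1,2) C_sub in blast, use u(2) in blast, rule u(3))
      with u(1) d(1) show "u \<in> O' \<nu>"
        by (auto simp: O'_def)
    qed
    show "O' \<nu> \<inter> O' \<nu>' = {}" if N: "\<nu> \<in> N" "\<nu>' \<in> N" and ne: "\<nu> \<noteq> \<nu>'" for \<nu> \<nu>'
    proof -
      obtain i where i: "\<nu> i \<noteq> \<nu>' i"
        using ne by auto
      \<comment> \<open>Members of \<open>N\<close> are extensional, so they can differ only at an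
        index below \<open>r\<close>.\<close>
      have "i < r"
        using N i unfolding N_def PiE_def extensional_def by force
      then have "d \<le> \<bar>\<nu> i - \<nu>' i\<bar>"
        using N i by (intro d(2)) (auto simp: N_def)
      then have "\<not> (\<bar>f (u i) - \<nu> i\<bar> < d / 2 \<and> \<bar>f (u i) - \<nu>' i\<bar> < d / 2)" for u
        by linarith
      with \<open>i < r\<close> show ?thesis
        unfolding O'_def by blast
    qed
  qed
  moreover have "{u \<in> topspace P. (\<forall>i<r. u i \<in> C) \<and> total u = \<mu>} \<subseteq> (\<Union>\<nu>\<in>N. critical_tuples \<nu>)"
  proof
    fix u assume u: "u \<in> {u \<in> topspace P. (\<forall>i<r. u i \<in> C) \<and> total u = \<mu>}"
    then have "(\<lambda>i\<in>{..<r}. f (u i)) \<in> N"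
      by (auto simp: N_def total_def)
    moreover have "u \<in> critical_tuples (\<lambda>i\<in>{..<r}. f (u i))"
    proof -
      have "u \<in> fiber_product r p (\<lambda>_. topspace X)"
        using u by (simp add: topspace_fiber_power_space)
      note fp = fiber_productD(2,3)[OF this]
      have "u i \<in> {x \<in> C. f x = (\<lambda>i\<in>{..<r}. f (u i)) i}" if "i < r" for i
        using u that by simp
      with fp show ?thesis
        unfolding critical_tuples_def by (intro fiber_productI)
    qed
    ultimately show "u \<in> (\<Union>\<nu>\<in>N. critical_tuples \<nu>)"
      by blast
  qed
  ultimately show ?thesis
    using TC_rel_mono order_trans by blast
qed

text \<open>If \<open>level_bound x\<close> is finite, it pays for a planned cover \<open>?U\<close>
  of the critical tuples on the level. The rest of the upper sublevel set is pushed into the lower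
  one.\<close>

lemma TC_sublevel_cross:
  obtains d where "d > 0"
    "TC_rel r X p (sublevel (x + d)) \<le> TC_rel r X p (sublevel (x - d)) + level_bound x"
proof (cases "level_bound x")
  case (enat n)
  define Cx where "Cx = {u \<in> topspace P. (\<forall>i<r. u i \<in> C) \<and> total u = x}"
  obtain U where U: "\<forall>i<n. planned r X p (U i)" "Cx \<subseteq> (\<Union>i<n. U i)"
    using TC_critical_level[of x] unfolding enat TC_rel_le_iff Cx_def by blast
  let ?U = "\<Union>i<n. U i"
  have opU: "openin P ?U"
    using U(1) planned_openin by blast
  obtain d0 where d0: "d0 > 0"
    "\<And>s. s \<in> total ` {u \<in> topspace P. \<forall>i<r. u i \<in> C} \<Longrightarrow> s \<noteq> x \<Longrightarrow> d0 \<le> dist x s"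
  proof -
    obtain d0 where "d0 > 0"
      and *: "\<forall>s\<in>total ` {u \<in> topspace P. \<forall>i<r. u i \<in> C}. s \<noteq> x \<longrightarrow> d0 \<le> dist x s"
      using finite_set_avoid[OF finite_critical_totals, of x] by (elim exE conjE)
    show thesis
      using that[OF \<open>d0 > 0\<close>] * by blast
  qed
  \<comment> \<open>The strip around \<open>x\<close> is so narrow that \<open>x\<close> is the only
    value of \<open>total\<close> in it at tuples of critical points. These are removed with
    \<open>?U\<close>, so each tuple in \<open>K\<close> has an entry outside
    \<open>C\<close>.\<close>
  define K where "K = {u \<in> topspace P. total u \<in> {x - d0/2..x + d0/2}} - ?U"
  have "closedin P {u \<in> topspace P. total u \<in> {x - d0/2..x + d0/2}}"
    by (rule closedin_continuous_map_preimage[OF continuous_total]) auto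
  then have "compactin P K"
    unfolding K_def using opU compact_P by (intro closedin_compact_space closedin_diff)
  moreover have "\<exists>i<r. u i \<notin> C" if "u \<in> K" for u
  proof (rule ccontr)
    assume "\<not> (\<exists>i<r. u i \<notin> C)"
    then have crit: "u \<in> topspace P" "\<forall>i<r. u i \<in> C"
      using that by (auto simp: K_def)
    have "dist x (total u) < d0"
      using that d0(1) by (auto simp: K_def dist_real_def abs_less_iff)
    with d0(2)[of "total u"] crit have "total u = x"
      by force
    with crit U(2) that show False
      by (auto simp: Cx_def K_def)
  qed
  ultimately obtain h e where h: "fiber_deformation X p f h" and e: "e > 0"
    and dec: "\<And>u. u \<in> K \<Longrightarrow> total (\<lambda>i\<in>{..<r}. h 1 (u i)) \<le> total u - e"
    using strict_decrease by blast
  \<comment> \<open>The bound \<open>e / 2\<close> lets a drop by \<open>e\<close> lead from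
    \<open>x + d\<close> to \<open>x - d\<close>. By the bound \<open>d0 / 2\<close>, tuples outside
    both \<open>K\<close> and \<open>?U\<close> already lie below \<open>x - d\<close>.\<close>
  define d where "d = min (e / 2) (d0 / 2)"
  have d: "d > 0" "d \<le> e / 2" "d \<le> d0 / 2"
    using e d0 by (auto simp: d_def)
  have "TC_rel r X p (sublevel (x + d) - ?U) \<le> TC_rel r X p (sublevel (x - d))"
  proof (rule TC_rel_deform[OF r h])
    show "sublevel (x + d) - ?U \<subseteq> topspace P"
      by (auto simp: sublevel_def)
    fix u assume u: "u \<in> sublevel (x + d) - ?U"
    then have uP: "u \<in> topspace P" and ut: "total u \<le> x + d"
      by (auto simp: sublevel_def)
    have "total (\<lambda>i\<in>{..<r}. h 1 (u i)) \<le> x - d"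
    proof (cases "u \<in> K")
      case True
      then show ?thesis
        using dec[OF True] ut d by linarith
    next
      case False
      then have "total u < x - d0 / 2"
        using u uP ut d by (auto simp: K_def)
      then show ?thesis
        using total_deform_le[OF h uP] d by linarith
    qed
    then show "(\<lambda>i\<in>{..<r}. h 1 (u i)) \<in> sublevel (x - d)"
      using deform_in_P[OF h uP] by (simp add: sublevel_def)
  qed
  moreover have "TC_rel r X p ?U \<le> level_bound x"
    unfolding enat TC_rel_le_iff using U(1) by blast
  moreover have "TC_rel r X p (sublevel (x + d)) \<le> TC_rel r X p (sublevel (x + d) - ?U) + TC_rel r X p ?U"
    by (rule order_trans[OF TC_rel_mono TC_rel_Un]) auto
  ultimately show thesis
    using that[OF d(1)] add_mono order_trans by blast
next
  case infinity
  with that[of 1] show thesis by simp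
qed

text \<open>\<open>Bolzano\<close> reduces a statement that is additive in intervals to short
  intervals around each point \<open>x\<close>. There it is \<open>TC_sublevel_cross\<close>, except
  for \<open>a = x\<close>: then the level \<open>x\<close> is not in \<open>{a<..b}\<close> and
  must not be charged, and \<open>TC_sublevel_right\<close> takes over.\<close>

lemma TC_sublevel_interval:
  assumes "a \<le> b" and fin: "finite {\<mu>. level_bound \<mu> \<noteq> 0}"
  shows "TC_rel r X p (sublevel b) \<le>
    TC_rel r X p (sublevel a) + sum level_bound ({\<mu>. level_bound \<mu> \<noteq> 0} \<inter> {a<..b})"
  using assms(1)
proof (induction a b rule: Bolzano)
  case (trans a b c)
  let ?M = "{\<mu>. level_bound \<mu> \<noteq> 0}"
  have "?M \<inter> {a<..c} = (?M \<inter> {a<..b}) \<union> (?M \<inter> {b<..c})"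
    using trans by auto
  moreover have "sum level_bound ((?M \<inter> {a<..b}) \<union> (?M \<inter> {b<..c})) =
      sum level_bound (?M \<inter> {a<..b}) + sum level_bound (?M \<inter> {b<..c})"
    using fin by (intro sum.union_disjoint) auto
  ultimately show ?case
    using order_trans[OF trans(2) add_right_mono[OF trans(1)]] by (simp only: add.assoc)
next
  case (local x)
  obtain e where e: "e > 0" "TC_rel r X p (sublevel (x + e)) \<le> TC_rel r X p (sublevel x)"
    by (rule TC_sublevel_right)
  obtain d where d: "d > 0"
    "TC_rel r X p (sublevel (x + d)) \<le> TC_rel r X p (sublevel (x - d)) + level_bound x"
    by (rule TC_sublevel_cross)
  show ?case
  proof (intro exI[of _ "min d e"] conjI allI impI)
    fix a b assume ab: "a \<le> x \<and> x \<le> b \<and> b - a < min d e"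
    let ?S = "{\<mu>. level_bound \<mu> \<noteq> 0} \<inter> {a<..b}"
    show "TC_rel r X p (sublevel b) \<le> TC_rel r X p (sublevel a) + sum level_bound ?S"
    proof (cases "a = x")
      case True
      have "TC_rel r X p (sublevel b) \<le> TC_rel r X p (sublevel (x + e))"
        using ab True by (intro TC_rel_mono sublevel_mono) auto
      also have "\<dots> \<le> TC_rel r X p (sublevel a)"
        using e True by simp
      finally show ?thesis
        by (simp add: add_increasing2)
    next
      case False
      have "level_bound x \<le> sum level_bound ?S"
      proof (cases "level_bound x = 0")
        case nz: False
        then show ?thesis
          using ab False fin by (intro member_le_sum) auto
      qed simp
      moreover have "TC_rel r X p (sublevel (x - d)) \<le> TC_rel r X p (sublevel a)"
        using ab by (intro TC_rel_mono sublevel_mono) auto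
      moreover have "TC_rel r X p (sublevel b) \<le> TC_rel r X p (sublevel (x + d))"
        using ab by (intro TC_rel_mono sublevel_mono) auto
      ultimately show ?thesis
        using d(2) by (meson add_mono order_trans)
    qed
  qed (use d e in auto)
qed

end

theorem TC_seq_le:
  "TC_seq r X p \<le> (\<Sum>\<^sub>\<infinity>\<mu>\<in>(UNIV :: real set). level_bound \<mu>)"
proof (cases "(\<Sum>\<^sub>\<infinity>\<mu>\<in>(UNIV :: real set). level_bound \<mu>) = \<infinity>")
  case False
  let ?M = "{\<mu>. level_bound \<mu> \<noteq> 0}"
  have fin: "finite ?M" and eq: "(\<Sum>\<^sub>\<infinity>\<mu>\<in>(UNIV :: real set). level_bound \<mu>) = sum level_bound ?M"
    using enat_infsum_finite_support[OF False] by auto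
  have "(\<lambda>c. real r * c) ` f ` C \<subseteq> ?M"
  proof clarify
    fix x assume x: "x \<in> C" and 0: "level_bound (real r * f x) = 0"
    have "TC_rel r X p (critical_tuples (\<lambda>_. f x)) \<le> level_bound (real r * f x)"
      unfolding level_bound_def by (intro SUP_upper) simp
    then have "critical_tuples (\<lambda>_. f x) = {}"
      using 0 by (simp add: TC_rel_eq_0_iff)
    moreover have "(\<lambda>i\<in>{..<r}. x) \<in> critical_tuples (\<lambda>_. f x)"
      using x by (simp add: critical_tuples_def fiber_product_def)
    ultimately show False by blast
  qed
  then have "finite ((\<lambda>c. real r * c) ` f ` C)"
    using fin finite_subset by blast
  moreover have "inj_on (\<lambda>c. real r * c) (f ` C)"
    using r by (auto simp: inj_on_def)
  ultimately have "finite (f ` C)"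
    by (rule finite_imageD)
  note interval = TC_sublevel_interval[OF this _ fin]
  have "\<exists>b. \<forall>u\<in>topspace P. \<bar>total u\<bar> < b"
  proof -
    have "compact (total ` topspace P)"
      using image_compactin[of P "topspace P" euclideanreal total] compact_P continuous_total
      by (simp add: compactin_euclidean_iff compact_space_def)
    then obtain b where "\<forall>s\<in>total ` topspace P. norm s \<le> b"
      using compact_imp_bounded bounded_iff by blast
    then show ?thesis
      by (intro exI[of _ "b + 1"]) fastforce
  qed
  then obtain b where b: "\<And>u. u \<in> topspace P \<Longrightarrow> \<bar>total u\<bar> < b"
    by blast
  \<comment> \<open>If \<open>P\<close> is empty, \<open>b\<close> may be negative;
    \<open>max b 0\<close> keeps the two end points in order.\<close>
  then have sub: "sublevel (max b 0) = topspace P" "sublevel (- max b 0) = {}"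
    by (force simp: sublevel_def)+
  have "TC_seq r X p = TC_rel r X p (sublevel (max b 0))"
    by (simp add: TC_seq_def sub)
  also have "\<dots> \<le> TC_rel r X p (sublevel (- max b 0)) + sum level_bound (?M \<inter> {- max b 0<..max b 0})"
    by (rule interval) simp
  also have "\<dots> \<le> sum level_bound ?M"
    using fin by (simp add: sub TC_rel_empty sum_mono2)
  finally show ?thesis
    by (simp add: eq)
qed simp

end

section \<open>Maps of constant rank in finite-dimensional inner product spaces\<close>

text \<open>An orthogonal spanning set is normalized. The expansion formula holds because the
  difference of its sides is orthogonal to the whole span, hence to itself.\<close>

lemma finite_orthonormal_basis:
  assumes "\<exists>S::('m::real_inner) set. finite S \<and> span S = UNIV"
  obtains B :: "('m::real_inner) set" where "finite B" "\<And>u v. \<lbrakk>u \<in> B; v \<in> B\<rbrakk> \<Longrightarrow> inner u v = (if u = v then 1 else 0)"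
    "span B = UNIV" "\<And>x. (\<Sum>b\<in>B. inner x b *\<^sub>R b) = x"
proof -
  obtain S :: "'m set" where "finite S" "span S = UNIV"
    using assms by blast
  then obtain D :: "'m set" where D: "finite D" "span D = UNIV" "pairwise orthogonal D"
    using basis_orthogonal by metis
  define B where "B = (\<lambda>x. x /\<^sub>R norm x) ` (D - {0})"
  have fin: "finite B"
    using D by (simp add: B_def)
  have on: "inner u v = (if u = v then 1 else 0)" if uv: "u \<in> B" "v \<in> B" for u v
  proof -
    obtain x y where xy: "x \<in> D" "x \<noteq> 0" "u = x /\<^sub>R norm x" "y \<in> D" "y \<noteq> 0" "v = y /\<^sub>R norm y"
      using uv by (auto simp: B_def)
    show ?thesis
    proof (cases "x = y")
      case True
      then show ?thesis
        using xy by (simp add: dot_square_norm power2_eq_square)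
    next
      case False
      then have 0: "inner x y = 0"
        using D(3) xy unfolding pairwise_def orthogonal_def by blast
      then have uv0: "inner u v = 0"
        using xy by simp
      moreover have "u \<noteq> v"
      proof
        assume "u = v"
        with uv0 have "u = 0" by simp
        with xy show False by simp
      qed
      ultimately show ?thesis by simp
    qed
  qed
  have "D \<subseteq> span B"
  proof
    fix x assume x: "x \<in> D"
    show "x \<in> span B"
    proof (cases "x = 0")
      case False
      then have "x /\<^sub>R norm x \<in> span B"
        using x by (intro span_base) (auto simp: B_def)
      then have "norm x *\<^sub>R (x /\<^sub>R norm x) \<in> span B"
        by (rule span_scale)
      with False show ?thesis by simp
    qed (simp add: span_zero)
  qed
  then have sp: "span B = UNIV"
    using D(2) by (metis span_minimal subspace_span top.extremum_uniqueI)
  have rep: "(\<Sum>b\<in>B. inner x b *\<^sub>R b) = x" for x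
  proof -
    let ?y = "x - (\<Sum>b\<in>B. inner x b *\<^sub>R b)"
    have "orthogonal ?y c" if "c \<in> B" for c
    proof -
      have "inner (\<Sum>b\<in>B. inner x b *\<^sub>R b) c = (\<Sum>b\<in>B. inner x b * (if b = c then 1 else 0))"
        unfolding inner_sum_left using on that by (intro sum.cong) auto
      also have "\<dots> = inner x c"
        using fin that by (simp add: if_distrib cong: if_cong)
      finally show ?thesis
        by (simp add: orthogonal_def inner_diff_left)
    qed
    moreover have "?y \<in> span B"
      by (simp add: sp)
    ultimately have "orthogonal ?y ?y"
      using orthogonal_to_span[of ?y B ?y] by blast
    then show ?thesis
      by (simp add: orthogonal_def)
  qed
  show thesis
    using that[OF fin on sp rep] .
qed

text \<open>A basis of \<open>W\<close> is sent to a spanning set of the image of \<open>W\<close>.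
  By the dimension bound this set has as many elements as the basis and is independent.\<close>

lemma subspace_image_inj:
  fixes P :: "'a::euclidean_space \<Rightarrow> 'b::euclidean_space"
  assumes P: "linear P" and W: "subspace W" and d: "dim W \<le> dim (P ` W)" and v: "v \<in> W" "P v = 0"
  shows "v = 0"
proof -
  obtain B where B: "B \<subseteq> W" "independent B" "W \<subseteq> span B" "card B = dim W"
    using basis_exists[of W] by blast
  have fB: "finite B"
    using B(2) independent_imp_finite by blast
  have WB: "W = span B"
    using B W by (simp add: span_minimal subset_antisym)
  have PW: "P ` W = span (P ` B)"
    unfolding WB using linear_span_image[OF P] by simp
  have le: "dim (P ` W) \<le> card (P ` B)"
    unfolding PW dim_span using fB by (simp add: dim_le_card')
  have card: "card (P ` B) = card B"
    using le d B(4) card_image_le[OF fB, of P] by simp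
  have "independent (P ` B)"
    by (rule card_le_dim_spanning[of _ "P ` W"])
       (use B(1) fB le d B(4) card PW in \<open>auto simp: span_superset\<close>)
  moreover have "inj_on P B"
    using card fB by (simp add: eq_card_imp_inj_on)
  ultimately have "inj_on P (span B)"
    using linear_inj_on_span_independent_image[OF P] by blast
  with v WB show ?thesis
    using linear_0[OF P] span_zero by (metis inj_on_contraD)
qed

text \<open>
  In coordinates in which a part of \<open>f\<close> of full rank is linear, \<open>f\<close> is constant along the kernel
  of \<open>f' x0\<close>, so its image is that of a subspace of smaller dimension.
\<close>

lemma constant_rank_negligible_euclidean:
  fixes f :: "'a::euclidean_space \<Rightarrow> 'b::euclidean_space"
  assumes S: "open S" "x0 \<in> S"
    and der: "\<And>x. x \<in> S \<Longrightarrow> (f has_derivative f' x) (at x)"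
    and cont: "\<And>v. continuous_on S (\<lambda>x. f' x v)"
    and rank: "\<And>x. x \<in> S \<Longrightarrow> dim (range (f' x)) \<le> dim (range (f' x0))"
    and low: "range (f' x0) \<noteq> UNIV"
  obtains N where "open N" "x0 \<in> N" "N \<subseteq> S" "negligible (f ` N)"
proof -
  define A where "A = f' x0"
  define R where "R = range A"
  have lin: "linear (f' x)" if "x \<in> S" for x
    using der[OF that] has_derivative_linear by blast
  have linA: "linear A"
    unfolding A_def using lin S by blast
  have R: "subspace R"
    unfolding R_def using linA by (intro linear_subspace_image) auto
  obtain T where T: "linear T" "\<And>z. z \<in> R \<Longrightarrow> A (T z) = z"
    using linear_exists_right_inverse_on[OF linA subspace_UNIV] unfolding R_def by blast
  obtain Pr where Pr: "linear Pr" "range Pr \<subseteq> R" "\<And>z. z \<in> R \<Longrightarrow> Pr z = z"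
    using linear_exists_left_inverse_on[OF linear_id R] by auto
  \<comment> \<open>\<open>T\<close> is a section of \<open>A\<close> over its range
    \<open>R\<close>, and \<open>Pr\<close> is a projection onto \<open>R\<close>. So
    \<open>g\<close> replaces the component \<open>T (A x)\<close> of \<open>x\<close> by
    \<open>T (Pr (f x))\<close>. Its derivative at \<open>x0\<close> is the identity, which makes it
    a local change of coordinates.\<close>
  define g where "g x = T (Pr (f x)) + (x - T (A x))" for x
  define g' where "g' x v = T (Pr (f' x v)) + (v - T (A v))" for x v
  have bT: "bounded_linear T" and bP: "bounded_linear Pr" and bA: "bounded_linear A"
    using T Pr linA by (simp_all add: linear_conv_bounded_linear)
  have g_der: "(g has_derivative g' x) (at x)" if "x \<in> S" for x
    unfolding g_def g'_def
    by (intro derivative_intros bounded_linear.has_derivative[OF bT]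
        bounded_linear.has_derivative[OF bP] bounded_linear.has_derivative[OF bA] der that)
  have blin: "bounded_linear (g' x)" if "x \<in> S" for x
    using g_der[OF that] has_derivative_bounded_linear by blast
  define G where "G x = Blinfun (g' x)" for x
  have G: "blinfun_apply (G x) = g' x" if "x \<in> S" for x
    unfolding G_def using blin[OF that] by (simp add: bounded_linear_Blinfun_apply)
  have "continuous_on S (\<lambda>x. blinfun_apply (G x) v)" for v
  proof -
    have "continuous_on S (\<lambda>x. g' x v)"
      unfolding g'_def by (intro continuous_intros bounded_linear.continuous_on[OF bT]
          bounded_linear.continuous_on[OF bP] cont)
    then show ?thesis
      using G by (simp cong: continuous_on_cong)
  qed
  then have contG: "continuous_on S G"
    by (rule continuous_on_blinfun_componentwise)
  have "g' x0 v = v" for v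
    using T(2) Pr(3) by (simp add: g'_def R_def flip: A_def)
  then have G0: "id_blinfun o\<^sub>L G x0 = id_blinfun"
    using G[OF S(2)] by (intro blinfun_eqI) simp
  obtain U V h h' where IF: "open U" "U \<subseteq> S" "x0 \<in> U" "open V" "g x0 \<in> V" "homeomorphism U V g h"
    "\<And>y. y \<in> V \<Longrightarrow> (h has_derivative h' y) (at y)"
    using inverse_function_theorem[OF S(1) _ contG S(2) G0, of g] g_der G by metis
  have hU: "h y \<in> U" "g (h y) = y" if "y \<in> V" for y
    using IF(6) that by (auto simp: homeomorphism_def)
  define F where "F y = f (h y)" for y
  define F' where "F' y v = f' (h y) (h' y v)" for y v
  have F_der: "(F has_derivative F' y) (at y)" if "y \<in> V" for y
    unfolding F_def F'_def using has_derivative_compose[OF IF(7)[OF that] der] hU IF(2) that by blast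
  \<comment> \<open>Applying \<open>A\<close> to \<open>g (h y) = y\<close> kills the summand
    \<open>h y - T (A (h y))\<close>: in the new coordinates the component \<open>Pr\<close> of the
    map is linear.\<close>
  have PF: "Pr (F y) = A y" if "y \<in> V" for y
  proof -
    have "y = T (Pr (F y)) + (h y - T (A (h y)))"
      using hU(2)[OF that] by (simp add: g_def F_def)
    then have "A y = A (T (Pr (F y))) + (A (h y) - A (T (A (h y))))"
      using linA by (metis linear_add linear_diff)
    then show ?thesis
      using T(2) Pr(2) by (simp add: R_def image_subset_iff)
  qed
  have PF': "Pr (F' y v) = A v" if y: "y \<in> V" for y v
  proof -
    have "((\<lambda>y. Pr (F y)) has_derivative (\<lambda>v. Pr (F' y v))) (at y)"
      by (rule bounded_linear.has_derivative[OF bP F_der[OF y]])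
    moreover have "((\<lambda>y. Pr (F y)) has_derivative A) (at y)"
      by (rule has_derivative_transform_within_open[OF bounded_linear_imp_has_derivative[OF bA] IF(4) y])
         (simp add: PF)
    ultimately show ?thesis
      using has_derivative_unique by metis
  qed
  \<comment> \<open>\<open>Pr\<close> sends the range of \<open>F' y\<close> onto \<open>R\<close>,
    and the rank bound says that this range has no larger dimension. So \<open>Pr\<close> is
    injective on it, and \<open>Pr (F' y v) = A v = 0\<close> forces
    \<open>F' y v = 0\<close>.\<close>
  have F'0: "F' y v = 0" if y: "y \<in> V" and v: "A v = 0" for y v
  proof (rule subspace_image_inj[OF Pr(1)])
    have linF': "linear (F' y)"
      using F_der[OF y] has_derivative_linear by blast
    show "subspace (range (F' y))"
      using linear_subspace_image[OF linF'] by auto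
    have "range (F' y) \<subseteq> range (f' (h y))"
      by (auto simp: F'_def)
    then have "dim (range (F' y)) \<le> dim (range (f' (h y)))"
      by (rule dim_subset)
    also have "\<dots> \<le> dim R"
      unfolding R_def A_def using rank hU(1)[OF y] IF(2) by blast
    also have "R = Pr ` range (F' y)"
      unfolding R_def using PF'[OF y] by (auto simp: image_image)
    finally show "dim (range (F' y)) \<le> dim (Pr ` range (F' y))" .
    show "Pr (F' y v) = 0"
      using PF'[OF y] v by simp
  qed auto
  obtain e where e: "e > 0" "ball (g x0) e \<subseteq> V"
    using IF(4,5) open_contains_ball by blast
  obtain c where c: "c > 0" "\<And>v. norm (T (A v)) \<le> norm v * c"
    using bounded_linear.pos_bounded[OF bounded_linear_compose[OF bT bA]] by auto
  \<comment> \<open>Both \<open>y\<close> and its projection \<open>?y0 + T (A (y - ?y0))\<close>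
    have to stay within \<open>e\<close> of \<open>?y0\<close>, hence the two bounds.\<close>
  define d where "d = min e (e / c)"
  have d: "d > 0" "d \<le> e" "d * c \<le> e"
    using e c by (auto simp: d_def field_simps min_def)
  let ?y0 = "g x0"
  define Z where "Z = {z \<in> R. ?y0 + T z \<in> ball ?y0 e}"
  \<comment> \<open>The point and its projection differ by a vector in the kernel of
    \<open>A\<close>, and \<open>F\<close> has zero derivative along the segment between
    them.\<close>
  have F_eq: "F y = F (?y0 + T (A (y - ?y0))) \<and> A (y - ?y0) \<in> Z" if y: "y \<in> ball ?y0 d" for y
  proof -
    define y' where "y' = ?y0 + T (A (y - ?y0))"
    have "norm (y - ?y0) < d"
      using y by (simp add: dist_norm norm_minus_commute)
    then have "norm (T (A (y - ?y0))) < e"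
      using c(2)[of "y - ?y0"] d(3) mult_strict_right_mono[OF _ c(1), of "norm (y - ?y0)" d] by linarith
    then have y': "y' \<in> ball ?y0 e"
      by (simp add: y'_def dist_norm)
    have ye: "y \<in> ball ?y0 e"
      using y d by auto
    have "A (T (A (y - ?y0))) = A (y - ?y0)"
      by (rule T(2)) (simp add: R_def)
    then have A0: "A (y - y') = 0"
      unfolding y'_def by (simp add: linear_diff[OF linA] linear_add[OF linA])
    have seg: "y' + s *\<^sub>R (y - y') \<in> V" if "s \<in> {0..1}" for s
    proof -
      have "y' + s *\<^sub>R (y - y') = (1 - s) *\<^sub>R y' + s *\<^sub>R y"
        by (simp add: algebra_simps)
      moreover have "(1 - s) *\<^sub>R y' + s *\<^sub>R y \<in> ball ?y0 e"
        using that y' ye by (intro convexD[OF convex_ball]) auto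
      ultimately show ?thesis
        using e(2) by auto
    qed
    have "((\<lambda>s. F (y' + s *\<^sub>R (y - y'))) has_derivative (\<lambda>t. 0)) (at s within {0..1})" if "s \<in> {0..1}" for s
    proof -
      have "((\<lambda>s. y' + s *\<^sub>R (y - y')) has_derivative (\<lambda>t. t *\<^sub>R (y - y'))) (at s within {0..1})"
        by (auto intro!: derivative_eq_intros)
      from has_derivative_compose[OF this F_der[OF seg[OF that]]]
      have "((\<lambda>s. F (y' + s *\<^sub>R (y - y'))) has_derivative (\<lambda>t. F' (y' + s *\<^sub>R (y - y')) (t *\<^sub>R (y - y')))) (at s within {0..1})" .
      moreover have "F' (y' + s *\<^sub>R (y - y')) (t *\<^sub>R (y - y')) = 0" for t
        using A0 linA by (intro F'0 seg that) (simp add: linear_scale)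
      ultimately show ?thesis by simp
    qed
    then have "F (y' + 0 *\<^sub>R (y - y')) = F (y' + 1 *\<^sub>R (y - y'))"
      using has_derivative_zero_unique[of "{0..1::real}" "\<lambda>s. F (y' + s *\<^sub>R (y - y'))" 0 1] by simp
    then show ?thesis
      using y' by (simp add: y'_def Z_def R_def)
  qed
  define N where "N = {x \<in> U. g x \<in> ball ?y0 d}"
  have "continuous_on U g"
    using IF(6) by (simp add: homeomorphism_def)
  then have "open N"
    using continuous_open_preimage[OF _ IF(1) open_ball[of ?y0 d]] by (simp add: N_def vimage_def Int_def)
  moreover have "f ` N \<subseteq> (\<lambda>z. F (?y0 + T z)) ` Z"
  proof
    fix w assume "w \<in> f ` N"
    then obtain x where x: "x \<in> U" "g x \<in> ball ?y0 d" "w = f x"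
      by (auto simp: N_def)
    have "w = F (g x)"
      using IF(6) x by (simp add: F_def homeomorphism_def)
    with F_eq[OF x(2)] show "w \<in> (\<lambda>z. F (?y0 + T z)) ` Z"
      by auto
  qed
  \<comment> \<open>\<open>Z\<close> lies in the proper subspace \<open>R\<close> of the target
    space, and a differentiable map from a subset of that space to the space itself preserves null
    sets.\<close>
  moreover have "negligible ((\<lambda>z. F (?y0 + T z)) ` Z)"
  proof (rule negligible_differentiable_image_negligible)
    have "dim R < DIM('b)"
      using low R unfolding R_def A_def
      by (metis dim_eq_full dim_subset_UNIV order_le_imp_less_or_eq span_eq_iff)
    then show "negligible Z"
      using negligible_lowdim[of R] negligible_subset[of R Z] by (auto simp: Z_def)
    show "(\<lambda>z. F (?y0 + T z)) differentiable_on Z"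
      unfolding differentiable_on_def
    proof
      fix z assume "z \<in> Z"
      then have "?y0 + T z \<in> V"
        using e(2) by (auto simp: Z_def)
      moreover have "((\<lambda>z. ?y0 + T z) has_derivative T) (at z within Z)"
        using bT by (auto intro!: derivative_eq_intros bounded_linear_imp_has_derivative)
      ultimately show "(\<lambda>z. F (?y0 + T z)) differentiable at z within Z"
        using has_derivative_compose F_der unfolding differentiable_def by blast
    qed
  qed simp
  ultimately have N: "open N" "negligible (f ` N)"
    using negligible_subset by blast+
  show thesis
    by (rule that[OF N(1) _ _ N(2)]) (use IF(2,3) d(1) in \<open>auto simp: N_def\<close>)
qed

text \<open>
  The inverse function theorem and Lebesgue measure are available for the class
  \<^class>\<open>euclidean_space\<close> only. The following type is in this class for every \<open>'m\<close>,
  and it is \<open>'m \<times> real\<close> if \<open>'m\<close> is finite-dimensional; the extra factor takes care of dimension \<open>0\<close>.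
\<close>

typedef (overloaded) 'm padded =
  "{x :: 'm::real_inner \<times> real. (\<exists>S::'m set. finite S \<and> span S = UNIV) \<or> fst x = 0}"
  morphisms unpad pad
  by (rule exI[of _ 0]) simp

setup_lifting type_definition_padded

instantiation padded :: (real_inner) real_vector
begin

lift_definition zero_padded :: "'a padded" is 0 by simp
lift_definition plus_padded :: "'a padded \<Rightarrow> 'a padded \<Rightarrow> 'a padded" is "(+)" by auto
lift_definition minus_padded :: "'a padded \<Rightarrow> 'a padded \<Rightarrow> 'a padded" is "(-)" by auto
lift_definition uminus_padded :: "'a padded \<Rightarrow> 'a padded" is uminus by auto
lift_definition scaleR_padded :: "real \<Rightarrow> 'a padded \<Rightarrow> 'a padded" is scaleR by auto
instance
proof
  fix x y z :: "'a padded" and a b :: real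
  show "x + y + z = x + (y + z)" by transfer (rule add.assoc)
  show "x + y = y + x" by transfer (rule add.commute)
  show "0 + x = x" by transfer simp
  show "- x + x = 0" by transfer simp
  show "x - y = x + - y" by transfer simp
  show "a *\<^sub>R (x + y) = a *\<^sub>R x + a *\<^sub>R y" by transfer (rule scaleR_add_right)
  show "(a + b) *\<^sub>R x = a *\<^sub>R x + b *\<^sub>R x" by transfer (rule scaleR_add_left)
  show "a *\<^sub>R b *\<^sub>R x = (a * b) *\<^sub>R x" by transfer simp
  show "1 *\<^sub>R x = x" by transfer simp
qed

end

instantiation padded :: (real_inner) real_inner
begin

lift_definition inner_padded :: "'a padded \<Rightarrow> 'a padded \<Rightarrow> real" is inner .
lift_definition norm_padded :: "'a padded \<Rightarrow> real" is norm .
lift_definition dist_padded :: "'a padded \<Rightarrow> 'a padded \<Rightarrow> real" is dist .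
definition sgn_padded :: "'a padded \<Rightarrow> 'a padded" where
  "sgn_padded x = x /\<^sub>R norm x"
definition uniformity_padded :: "('a padded \<times> 'a padded) filter" where
  "uniformity_padded = (INF e\<in>{0<..}. principal {(x, y). dist x y < e})"
definition open_padded :: "'a padded set \<Rightarrow> bool" where
  "open_padded U = (\<forall>x\<in>U. eventually (\<lambda>(x', y). x' = x \<longrightarrow> y \<in> U) uniformity)"

instance
proof
  fix x y z :: "'a padded" and a :: real and U :: "'a padded set"
  show "dist x y = norm (x - y)" by transfer (rule dist_norm)
  show "sgn x = x /\<^sub>R norm x" by (rule sgn_padded_def)
  show "uniformity = (INF e\<in>{0<..}. principal {(x, y::'a padded). dist x y < e})"
    by (rule uniformity_padded_def)
  show "open U = (\<forall>x\<in>U. eventually (\<lambda>(x', y). x' = x \<longrightarrow> y \<in> U) uniformity)"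
    by (rule open_padded_def)
  show "inner x y = inner y x" by transfer (rule inner_commute)
  show "inner (x + y) z = inner x z + inner y z" by transfer (rule inner_add_left)
  show "inner (a *\<^sub>R x) y = a * inner x y" by transfer simp
  show "0 \<le> inner x x" by transfer simp
  show "inner x x = 0 \<longleftrightarrow> x = 0" by transfer simp
  show "norm x = sqrt (inner x x)" by transfer (rule norm_eq_sqrt_inner)
qed

end

section \<open>Transfer between model spaces and padded spaces\<close>

lemma bounded_linear_unpad: "bounded_linear unpad"
  by (intro bounded_linear_intro[where K=1]) (transfer, simp)+

lemma unpad_pad:
  fixes x :: "'m::real_inner \<times> real"
  assumes "\<exists>S::'m set. finite S \<and> span S = UNIV"
  shows "unpad (pad x) = x"
  using assms by (intro pad_inverse) blast

lemma bounded_linear_pad: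
  assumes "\<exists>S::'m::real_inner set. finite S \<and> span S = UNIV"
  shows "bounded_linear (pad :: 'm \<times> real \<Rightarrow> 'm padded)"
proof -
  have inj: "u = v" if "unpad u = unpad v" for u v :: "'m padded"
    using that by (simp add: unpad_inject)
  note [simp] = unpad_pad[OF assms] plus_padded.rep_eq scaleR_padded.rep_eq norm_padded.rep_eq
  show ?thesis
    by (rule bounded_linear_intro[where K=1]) (auto intro!: inj)
qed

lemma padded_finite_dimensional: "\<exists>S::'m::real_inner padded set. finite S \<and> span S = UNIV"
proof (cases "\<exists>S::'m set. finite S \<and> span S = UNIV")
  case True
  then obtain S :: "'m set" where S: "finite S" "span S = UNIV"
    by blast
  note lin = bounded_linear.linear[OF bounded_linear_pad[OF True]]
  define A where "A = (\<lambda>x. pad (x, 0 :: real)) ` S"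
  have linA: "linear (\<lambda>x::'m. pad (x, 0 :: real))"
    using linear_compose[OF _ lin, of "\<lambda>x. (x, 0)"] by (auto simp: o_def linear_iff)
  have "x \<in> span (insert (pad (0, 1)) A)" for x :: "'m padded"
  proof -
    obtain y t where yt: "unpad x = (y, t)"
      by fastforce
    then have "x = pad ((y, 0) + t *\<^sub>R (0, 1))"
      using unpad_inverse[of x] by simp
    then have x: "x = pad (y, 0) + t *\<^sub>R pad (0, 1)"
      using lin by (simp only: linear_add linear_scale)
    have "pad (y, 0) \<in> span A"
      using linear_span_image[OF linA, of S] S(2) by (auto simp: A_def)
    then have "pad (y, 0) \<in> span (insert (pad (0, 1)) A)"
      using span_mono[of A "insert (pad (0, 1)) A"] by blast
    moreover have "pad (0, 1) \<in> span (insert (pad (0, 1)) A)"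
      by (simp add: span_base)
    ultimately show ?thesis
      unfolding x by (intro span_add span_scale)
  qed
  then show ?thesis
    using S(1) by (intro exI[of _ "insert (pad (0, 1)) A"]) (auto simp: A_def)
next
  case False
  have up: "unpad (pad (0 :: 'm, 1 :: real)) = (0, 1)"
    by (rule pad_inverse) simp
  have "x \<in> span {pad (0, 1)}" for x :: "'m padded"
  proof -
    have "fst (unpad x) = 0"
      using unpad[of x] False by auto
    then have "unpad x = unpad (snd (unpad x) *\<^sub>R pad (0, 1))"
      by (simp add: scaleR_padded.rep_eq up prod_eq_iff)
    then have "x = snd (unpad x) *\<^sub>R pad (0, 1)"
      by (simp only: unpad_inject)
    then show ?thesis
      by (metis span_base span_scale singletonI)
  qed
  then show ?thesis
    by (intro exI[of _ "{pad (0, 1)}"]) auto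
qed

instantiation padded :: (real_inner) euclidean_space
begin

definition Basis_padded :: "'a padded set" where
  "Basis_padded = (SOME B. finite B \<and> (\<forall>u\<in>B. \<forall>v\<in>B. inner u v = (if u = v then 1 else 0)) \<and> span B = UNIV)"

instance
proof -
  have "\<exists>B::'a padded set. finite B \<and> (\<forall>u\<in>B. \<forall>v\<in>B. inner u v = (if u = v then 1 else 0)) \<and> span B = UNIV"
    using finite_orthonormal_basis[OF padded_finite_dimensional] by metis
  from someI_ex[OF this] have B: "finite (Basis :: 'a padded set)"
    "\<forall>u\<in>Basis. \<forall>v\<in>Basis. inner u v = (if u = (v :: 'a padded) then 1 else 0)"
    "span (Basis :: 'a padded set) = UNIV"
    unfolding Basis_padded_def by blast+
  have "unpad (pad (0 :: 'a, 1 :: real)) = (0, 1)"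
    by (rule pad_inverse) simp
  then have nz: "pad (0 :: 'a, 1) \<noteq> 0"
    by (metis zero_neq_one snd_conv snd_zero zero_padded.rep_eq)
  have zero: "x = 0" if "\<forall>u\<in>Basis. inner x u = 0" for x :: "'a padded"
  proof -
    have "orthogonal x x"
      using orthogonal_to_span[of x Basis x] B(3) that by (auto simp: orthogonal_def)
    then show ?thesis
      by (simp add: orthogonal_def)
  qed
  show "OFCLASS('a padded, euclidean_space_class)"
  proof
    show "(Basis :: 'a padded set) \<noteq> {}"
      using nz B(3) by (metis span_empty UNIV_I singletonD)
  qed (use B zero in auto)
qed

end

text \<open>A set is measured by the cylinder over it in the extra direction. In dimension 0 the
  cylinder over the point is a line, which is not null, so \<open>open_not_null_set\<close> includes
  this case.\<close>

definition null_set :: "'m::real_inner set \<Rightarrow> bool" where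
  "null_set S \<longleftrightarrow> negligible {z :: 'm padded. fst (unpad z) \<in> S}"

lemma null_set_subset: "null_set T \<Longrightarrow> S \<subseteq> T \<Longrightarrow> null_set S"
  unfolding null_set_def by (rule negligible_subset) auto

lemma null_set_countable_Union:
  assumes "countable \<F>" and "\<And>S. S \<in> \<F> \<Longrightarrow> null_set S"
  shows "null_set (\<Union>\<F>)"
proof -
  have "{z. fst (unpad z) \<in> \<Union>\<F>} = \<Union> ((\<lambda>S. {z. fst (unpad z) \<in> S}) ` \<F>)"
    by auto
  with assms show ?thesis
    unfolding null_set_def by (auto intro!: negligible_countable_Union)
qed

lemma open_not_null_set:
  fixes S :: "'m::real_inner set"
  assumes fd: "\<exists>S::'m set. finite S \<and> span S = UNIV" and S: "open S" "S \<noteq> {}"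
  shows "\<not> null_set S"
proof -
  have "open ((\<lambda>z. fst (unpad z)) -` S)"
    by (intro open_vimage[OF S(1)] continuous_on_fst bounded_linear.continuous_on[OF bounded_linear_unpad] continuous_on_id)
  moreover obtain x where "x \<in> S"
    using S(2) by blast
  then have "pad (x, 0) \<in> (\<lambda>z. fst (unpad z)) -` S"
    by (simp add: unpad_pad[OF fd])
  ultimately show ?thesis
    using open_not_negligible unfolding null_set_def vimage_def by blast
qed

text \<open>The Euclidean version is applied to the product of \<open>f\<close> with the identity of
  the extra factor. Ranks are compared through a linear map \<open>L\<close> because equivariance
  provides the comparison in this form and \<open>L\<close> extends to the padded space.\<close>

lemma constant_rank_null_set:
  fixes f :: "'m::real_inner \<Rightarrow> 'n::real_inner"
  assumes fdm: "\<exists>S::'m set. finite S \<and> span S = UNIV" and fdn: "\<exists>S::'n set. finite S \<and> span S = UNIV"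
    and S: "open S" "x0 \<in> S"
    and der: "\<And>x. x \<in> S \<Longrightarrow> (f has_derivative f' x) (at x)"
    and cont: "\<And>v. continuous_on S (\<lambda>x. f' x v)"
    and rank: "\<And>x. x \<in> S \<Longrightarrow> \<exists>L::'n \<Rightarrow> 'n. linear L \<and> range (f' x) \<subseteq> L ` range (f' x0)"
    and low: "range (f' x0) \<noteq> UNIV"
  obtains N where "open N" "x0 \<in> N" "N \<subseteq> S" "null_set (f ` N)"
proof -
  let ?fst = "\<lambda>z::'m padded. fst (unpad z)"
  define F :: "'m padded \<Rightarrow> 'n padded" where "F z = pad (f (?fst z), snd (unpad z))" for z
  define F' :: "'m padded \<Rightarrow> 'm padded \<Rightarrow> 'n padded" where
    "F' z v = pad (f' (?fst z) (?fst v), snd (unpad v))" for z v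
  note padn = bounded_linear_pad[OF fdn] and unpadm = unpad_pad[OF fdm] and unpadn = unpad_pad[OF fdn]
  have fst_der: "(?fst has_derivative ?fst) (at z)" for z
    by (intro has_derivative_fst bounded_linear_imp_has_derivative bounded_linear_unpad)
  have snd_der: "((\<lambda>z. snd (unpad z)) has_derivative (\<lambda>z. snd (unpad z))) (at z)" for z :: "'m padded"
    by (intro has_derivative_snd bounded_linear_imp_has_derivative bounded_linear_unpad)
  have fst_cont: "continuous_on A ?fst" for A
    by (intro continuous_on_fst bounded_linear.continuous_on[OF bounded_linear_unpad] continuous_on_id)
  obtain N where N: "open N" "pad (x0, 0) \<in> N" "N \<subseteq> ?fst -` S" "negligible (F ` N)"
  proof (rule constant_rank_negligible_euclidean[of "?fst -` S" "pad (x0, 0)" F F'])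
    show "open (?fst -` S)"
      using S(1) open_vimage[OF _ fst_cont] by blast
    show "pad (x0, 0) \<in> ?fst -` S"
      using S(2) by (simp add: unpadm)
    show "(F has_derivative F' z) (at z)" if "z \<in> ?fst -` S" for z
      unfolding F_def F'_def
      by (intro bounded_linear.has_derivative[OF padn] has_derivative_Pair snd_der
          has_derivative_compose[OF fst_der der]) (use that in simp)
    show "continuous_on (?fst -` S) (\<lambda>z. F' z v)" for v
      unfolding F'_def
      by (intro bounded_linear.continuous_on[OF padn] continuous_on_Pair continuous_on_const
          continuous_on_compose2[OF cont fst_cont]) auto
    show "range (F' (pad (x0, 0))) \<noteq> UNIV"
    proof -
      obtain w where w: "w \<notin> range (f' x0)"
        using low by blast
      have "pad (w, 0) \<notin> range (F' (pad (x0, 0)))"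
      proof
        assume "pad (w, 0) \<in> range (F' (pad (x0, 0)))"
        then obtain v where "pad (w, 0) = pad (f' x0 (?fst v), snd (unpad v))"
          by (auto simp: F'_def unpadm)
        then have "(w, 0) = (f' x0 (?fst v), snd (unpad v))"
          by (metis unpadn)
        with w show False by auto
      qed
      then show ?thesis by blast
    qed
    show "dim (range (F' z)) \<le> dim (range (F' (pad (x0, 0))))" if z: "z \<in> ?fst -` S" for z
    proof -
      obtain L where L: "linear L" "range (f' (?fst z)) \<subseteq> L ` range (f' x0)"
        using rank[of "?fst z"] z by auto
      define \<Lambda> :: "'n padded \<Rightarrow> 'n padded" where "\<Lambda> w = pad (L (fst (unpad w)), snd (unpad w))" for w
      have "linear \<Lambda>"
      proof -
        have "linear (\<lambda>w::'n \<times> real. (L (fst w), snd w))"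
          using L(1) by (auto simp: linear_iff)
        from linear_compose[OF linear_compose[OF bounded_linear.linear[OF bounded_linear_unpad] this]
            bounded_linear.linear[OF padn]]
        show ?thesis
          by (simp add: \<Lambda>_def[abs_def] o_def)
      qed
      moreover have "range (F' z) \<subseteq> \<Lambda> ` range (F' (pad (x0, 0)))"
      proof
        fix w assume "w \<in> range (F' z)"
        then obtain v where v: "w = pad (f' (?fst z) (?fst v), snd (unpad v))"
          by (auto simp: F'_def)
        obtain y where y: "f' (?fst z) (?fst v) = L (f' x0 y)"
          using L(2) by blast
        have "w = \<Lambda> (F' (pad (x0, 0)) (pad (y, snd (unpad v))))"
          by (simp add: v y \<Lambda>_def F'_def unpadm unpadn)
        then show "w \<in> \<Lambda> ` range (F' (pad (x0, 0)))"
          by blast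
      qed
      ultimately show ?thesis
        by (meson dim_image_le dim_subset order_trans)
    qed
  qed blast
  obtain e where e: "e > 0" "ball (pad (x0, 0)) e \<subseteq> N"
    using N(1,2) open_contains_ball by blast
  \<comment> \<open>Radius \<open>e/2\<close> leaves room for a shift by less than
    \<open>e/2\<close> in the extra direction within \<open>N\<close>.\<close>
  define M where "M = {x. pad (x, 0) \<in> ball (pad (x0, 0)) (e/2)}"
  have padm: "continuous_on UNIV (\<lambda>x::'m. pad (x, 0::real))"
    by (intro bounded_linear.continuous_on[OF bounded_linear_pad[OF fdm]] continuous_intros)
  show thesis
  proof (rule that)
    show "open M"
      using open_vimage[OF open_ball padm] unfolding M_def vimage_def .
    show "x0 \<in> M"
      using e by (simp add: M_def)
    show "M \<subseteq> S"
    proof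
      fix x assume "x \<in> M"
      then have "pad (x, 0) \<in> N"
        using e by (auto simp: M_def)
      with N(3) show "x \<in> S"
        by (auto simp: unpadm)
    qed
    \<comment> \<open>The cylinder is unbounded in the extra direction, whereas the null set
      obtained from \<open>N\<close> need only contain a short piece over each point. Countably many
      rational translates of it cover the cylinder.\<close>
    have "{w. fst (unpad w) \<in> f ` M} \<subseteq> (\<Union>t\<in>\<rat>. (+) (pad (0, t)) ` (F ` N))"
    proof
      fix w :: "'n padded" assume "w \<in> {w. fst (unpad w) \<in> f ` M}"
      then obtain x where x: "x \<in> M" "fst (unpad w) = f x"
        by auto
      obtain t where t: "t \<in> \<rat>" "snd (unpad w) - e/2 < t" "t < snd (unpad w)"
        using Rats_dense_in_real[of "snd (unpad w) - e/2" "snd (unpad w)"] e by auto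
      let ?s = "snd (unpad w) - t"
      have "dist (pad (x, ?s)) (pad (x, 0)) = \<bar>?s\<bar>"
        by (simp add: dist_padded.rep_eq unpadm dist_Pair_Pair dist_real_def)
      then have "dist (pad (x, ?s)) (pad (x, 0)) < e/2"
        using t by simp
      moreover have "dist (pad (x0, 0)) (pad (x, 0)) < e/2"
        using x(1) by (simp add: M_def)
      ultimately have "dist (pad (x0, 0)) (pad (x, ?s)) < e"
        using dist_triangle_half_l dist_commute by metis
      then have "pad (x, ?s) \<in> N"
        using e(2) by auto
      moreover have "w = pad (0, t) + F (pad (x, ?s))"
      proof -
        have "unpad w = unpad (pad (0, t) + F (pad (x, ?s)))"
          by (simp add: plus_padded.rep_eq F_def unpadm unpadn prod_eq_iff x(2))
        then show ?thesis
          by (simp only: unpad_inject)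
      qed
      ultimately show "w \<in> (\<Union>t\<in>\<rat>. (+) (pad (0, t)) ` (F ` N))"
        using t(1) by blast
    qed
    moreover have "negligible (\<Union>t\<in>\<rat>. (+) (pad (0, t)) ` (F ` N))"
    proof (rule negligible_countable_Union)
      show "countable ((\<lambda>t. (+) (pad (0 :: 'n, t)) ` (F ` N)) ` \<rat>)"
        using countable_rat by blast
      show "negligible A" if "A \<in> (\<lambda>t. (+) (pad (0 :: 'n, t)) ` (F ` N)) ` \<rat>" for A
        using that negligible_translation[OF N(4)] by auto
    qed
    ultimately show "null_set (f ` M)"
      unfolding null_set_def using negligible_subset by blast
  qed
qed

section \<open>Coordinate representations\<close>

lemma Ck_on_1:
  "Ck_on 1 f S \<longleftrightarrow>
     (\<exists>f'. (\<forall>x\<in>S. (f has_derivative f' x) (at x)) \<and> (\<forall>v. continuous_on S (\<lambda>x. f' x v)))"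
  by simp

lemma Ck_on_1_subset: "Ck_on 1 f S \<Longrightarrow> T \<subseteq> S \<Longrightarrow> Ck_on 1 f T"
  unfolding Ck_on_1 by (meson continuous_on_subset subsetD)

lemma Ck_on_1_cong:
  assumes "open T" and "Ck_on 1 f T" and "\<And>x. x \<in> T \<Longrightarrow> f x = g x"
  shows "Ck_on 1 g T"
proof -
  obtain f' where f': "\<forall>x\<in>T. (f has_derivative f' x) (at x)" "\<forall>v. continuous_on T (\<lambda>x. f' x v)"
    using assms(2) unfolding Ck_on_1 by blast
  have "(g has_derivative f' x) (at x)" if "x \<in> T" for x
    by (rule has_derivative_transform_within_open[OF f'(1)[rule_format, OF that] assms(1) that assms(3)])
  with f'(2) show ?thesis
    unfolding Ck_on_1 by blast
qed

text \<open>Continuity of \<open>f' x v\<close> is given for fixed \<open>v\<close> only, while the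
  chain rule inserts the varying vector \<open>g' x v\<close>. Expanding it in a finite orthonormal
  basis reduces the claim to fixed directions.\<close>

lemma Ck_on_1_compose:
  fixes f :: "'m::real_inner \<Rightarrow> 'n::real_inner" and g :: "'k::real_inner \<Rightarrow> 'm"
  assumes fd: "\<exists>S::'m set. finite S \<and> span S = UNIV"
    and f: "Ck_on 1 f S" and g: "Ck_on 1 g T" and gT: "g ` T \<subseteq> S"
  shows "Ck_on 1 (f \<circ> g) T"
proof -
  obtain f' where f': "\<And>x. x \<in> S \<Longrightarrow> (f has_derivative f' x) (at x)" "\<And>v. continuous_on S (\<lambda>x. f' x v)"
    using f unfolding Ck_on_1 by blast
  obtain g' where g': "\<And>x. x \<in> T \<Longrightarrow> (g has_derivative g' x) (at x)" "\<And>v. continuous_on T (\<lambda>x. g' x v)"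
    using g unfolding Ck_on_1 by blast
  obtain B :: "'m set" where B: "\<And>x. (\<Sum>b\<in>B. inner x b *\<^sub>R b) = x"
    using finite_orthonormal_basis[OF fd] by metis
  have gc: "continuous_on T g"
    using g'(1) has_derivative_continuous continuous_at_imp_continuous_on by blast
  have "continuous_on T (\<lambda>x. f' (g x) (g' x v))" for v
  proof -
    have "f' (g x) (g' x v) = (\<Sum>b\<in>B. inner (g' x v) b *\<^sub>R f' (g x) b)" if "x \<in> T" for x
    proof -
      have lin: "linear (f' (g x))"
        using f'(1) gT that has_derivative_linear by blast
      have "f' (g x) (\<Sum>b\<in>B. inner (g' x v) b *\<^sub>R b) = (\<Sum>b\<in>B. inner (g' x v) b *\<^sub>R f' (g x) b)"
        using lin by (simp add: linear_sum linear_scale)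
      then show ?thesis
        by (simp only: B)
    qed
    moreover have "continuous_on T (\<lambda>x. \<Sum>b\<in>B. inner (g' x v) b *\<^sub>R f' (g x) b)"
      by (intro continuous_intros g'(2) continuous_on_compose2[OF f'(2) gc gT])
    ultimately show ?thesis
      by (simp cong: continuous_on_cong)
  qed
  moreover have "((f \<circ> g) has_derivative (\<lambda>v. f' (g x) (g' x v))) (at x)" if "x \<in> T" for x
    using has_derivative_compose[OF g'(1)[OF that] f'(1)] gT that by (auto simp: o_def)
  ultimately show ?thesis
    unfolding Ck_on_1 by (intro exI[of _ "\<lambda>x v. f' (g x) (g' x v)"]) blast
qed

section \<open>Charts and the chain rule in coordinates\<close>

definition coord_rep :: "('a, 'm) chart \<Rightarrow> ('b, 'n) chart \<Rightarrow> ('a \<Rightarrow> 'b) \<Rightarrow> 'm \<Rightarrow> 'n" where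
  "coord_rep c d f = snd d \<circ> f \<circ> chart_inv c"

lemma coord_rep_apply: "coord_rep c d f y = snd d (f (chart_inv c y))"
  by (simp add: coord_rep_def)

context
  fixes X :: "'a topology" and c :: "('a, 'm::real_inner) chart"
  assumes c: "is_chart X c"
begin

lemma chart_openin: "openin X (fst c)"
  using c by (simp add: is_chart_def)

lemma chart_subset: "fst c \<subseteq> topspace X"
  using chart_openin openin_subset by blast

lemma chart_image_open: "open (snd c ` fst c)"
  using c by (simp add: is_chart_def)

lemma chart_inj: "inj_on (snd c) (fst c)"
proof -
  have "homeomorphic_map (subtopology X (fst c)) (top_of_set (snd c ` fst c)) (snd c)"
    using c by (simp add: is_chart_def)
  from homeomorphic_imp_injective_map[OF this] show ?thesis
    using chart_subset by (simp add: Int_absorb1)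
qed

lemma chart_inv_chart: "x \<in> fst c \<Longrightarrow> chart_inv c (snd c x) = x"
  unfolding chart_inv_def using chart_inj by simp

lemma chart_chart_inv: "y \<in> snd c ` fst c \<Longrightarrow> snd c (chart_inv c y) = y"
  unfolding chart_inv_def by (simp add: f_inv_into_f)

lemma chart_inv_in: "y \<in> snd c ` fst c \<Longrightarrow> chart_inv c y \<in> fst c"
  unfolding chart_inv_def by (simp add: inv_into_into)

lemma continuous_map_chart: "continuous_map (subtopology X (fst c)) euclidean (snd c)"
proof -
  have "homeomorphic_map (subtopology X (fst c)) (top_of_set (snd c ` fst c)) (snd c)"
    using c by (simp add: is_chart_def)
  from homeomorphic_imp_continuous_map[OF this] show ?thesis
    unfolding continuous_map_in_subtopology by blast
qed

lemma continuous_map_chart_inv: "continuous_map (top_of_set (snd c ` fst c)) X (chart_inv c)"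
proof -
  obtain g where g: "homeomorphic_maps (subtopology X (fst c)) (top_of_set (snd c ` fst c)) (snd c) g"
    using c unfolding is_chart_def homeomorphic_map_maps by blast
  have "chart_inv c y = g y" if "y \<in> snd c ` fst c" for y
  proof -
    have "g y \<in> fst c" "snd c (g y) = y"
      using g that chart_subset unfolding homeomorphic_maps_def continuous_map_def by auto
    then show ?thesis
      using chart_inv_chart by metis
  qed
  moreover have "continuous_map (top_of_set (snd c ` fst c)) X g"
    using g unfolding homeomorphic_maps_def continuous_map_in_subtopology by blast
  ultimately show ?thesis
    using continuous_map_eq[of "top_of_set (snd c ` fst c)" X g "chart_inv c"]
    by (metis topspace_euclidean_subtopology)
qed

lemma chart_image_open_subset:
  assumes "openin X W"
  shows "open (snd c ` (fst c \<inter> W))"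
proof -
  have "openin (top_of_set (snd c ` fst c)) {y \<in> topspace (top_of_set (snd c ` fst c)). chart_inv c y \<in> W}"
    using openin_continuous_map_preimage[OF continuous_map_chart_inv assms] .
  then have "open {y \<in> snd c ` fst c. chart_inv c y \<in> W}"
    using chart_image_open openin_open_trans by auto
  also have "{y \<in> snd c ` fst c. chart_inv c y \<in> W} = snd c ` (fst c \<inter> W)"
    using chart_inv_chart by (auto simp: image_iff)
  finally show ?thesis .
qed

lemma chart_preimage_openin:
  assumes "open V"
  shows "openin X {x \<in> fst c. snd c x \<in> V}"
proof -
  have "openin (subtopology X (fst c)) {x \<in> topspace (subtopology X (fst c)). snd c x \<in> V}"
    by (rule openin_continuous_map_preimage[OF continuous_map_chart]) (use assms in simp)
  then show ?thesis
    using openin_trans_full[OF _ chart_openin] chart_subset by (simp add: Int_absorb1)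
qed

end

lemma has_derivative_coord_rep_eq:
  assumes c: "is_chart X c" and D: "(coord_rep c d f has_derivative D) (at (snd c x))"
    and W: "openin X W" "x \<in> fst c" "x \<in> W" and eq: "\<And>y. y \<in> W \<Longrightarrow> f y = g y"
  shows "(coord_rep c d g has_derivative D) (at (snd c x))"
proof (rule has_derivative_transform_within_open[OF D chart_image_open_subset[OF c W(1)]])
  show "snd c x \<in> snd c ` (fst c \<inter> W)"
    using W by blast
  show "coord_rep c d f y = coord_rep c d g y" if "y \<in> snd c ` (fst c \<inter> W)" for y
    using that eq chart_inv_chart[OF c] by (auto simp: coord_rep_apply)
qed

text \<open>Only the behavior on \<open>W\<close> matters, so \<open>f\<close> may be meaningful
  merely near \<open>x\<close>, such as an orbit map followed by a local trivialization.\<close>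

lemma has_derivative_coord_rep_comp_local:
  assumes c: "is_chart X c" and d: "is_chart Y d"
    and f: "(coord_rep c d f has_derivative A) (at (snd c x))"
    and g: "(coord_rep d e g has_derivative B) (at (snd d (f x)))"
    and x: "x \<in> fst c" "x \<in> W" and W: "openin X W" "\<And>y. y \<in> W \<Longrightarrow> f y \<in> fst d"
  shows "(coord_rep c e (g \<circ> f) has_derivative (B \<circ> A)) (at (snd c x))"
proof -
  have "coord_rep c d f (snd c x) = snd d (f x)"
    using chart_inv_chart[OF c x(1)] by (simp add: coord_rep_apply)
  then have comp: "((coord_rep d e g \<circ> coord_rep c d f) has_derivative (B \<circ> A)) (at (snd c x))"
    using diff_chain_at[OF f] g by simp
  show ?thesis
  proof (rule has_derivative_transform_within_open[OF comp chart_image_open_subset[OF c W(1)]])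
    show "snd c x \<in> snd c ` (fst c \<inter> W)"
      using x by blast
    show "(coord_rep d e g \<circ> coord_rep c d f) y = coord_rep c e (g \<circ> f) y"
      if "y \<in> snd c ` (fst c \<inter> W)" for y
      using that chart_inv_chart[OF c] chart_inv_chart[OF d] W(2) by (auto simp: coord_rep_apply)
  qed
qed

lemma has_derivative_coord_rep_comp:
  assumes c: "is_chart X c" and d: "is_chart Y d"
    and f: "(coord_rep c d f has_derivative A) (at (snd c x))"
    and g: "(coord_rep d e g has_derivative B) (at (snd d (f x)))"
    and x: "x \<in> fst c" "f x \<in> fst d"
    and W: "openin X {y \<in> topspace X. f y \<in> fst d}"
  shows "(coord_rep c e (g \<circ> f) has_derivative (B \<circ> A)) (at (snd c x))"
  by (rule has_derivative_coord_rep_comp_local[OF c d f g x(1) _ W])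
     (use x chart_subset[OF c] in auto)

text \<open>The part of \<open>smooth_manifold\<close> that the chain rule in charts relies on; it
  passes directly to open submanifolds and products.\<close>

definition atlas :: "('a, 'm::real_inner) mfd \<Rightarrow> bool" where
  "atlas M \<longleftrightarrow> (\<forall>c\<in>charts M. is_chart (mtop M) c)"

lemma atlasD: "atlas M \<Longrightarrow> c \<in> charts M \<Longrightarrow> is_chart (mtop M) c"
  by (simp add: atlas_def)

lemma smooth_manifold_atlas: "smooth_manifold M \<Longrightarrow> atlas M"
  by (simp add: atlas_def smooth_manifold_def)

lemma smooth_manifold_chart: "smooth_manifold M \<Longrightarrow> x \<in> pts M \<Longrightarrow> \<exists>c\<in>charts M. x \<in> fst c"
  unfolding smooth_manifold_def by blast

lemma smooth_map_Ck1: "smooth_map M N f \<Longrightarrow> Ck_map 1 M N f"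
  unfolding smooth_map_def by blast

lemma Ck_map_continuous: "Ck_map k M N f \<Longrightarrow> continuous_map (mtop M) (mtop N) f"
  by (simp add: Ck_map_def)

lemma Ck_map_coord_rep:
  "\<lbrakk>Ck_map 1 M N f; c \<in> charts M; d \<in> charts N\<rbrakk> \<Longrightarrow> Ck_on 1 (coord_rep c d f) (snd c ` (fst c \<inter> f -` fst d))"
  unfolding Ck_map_def coord_rep_def by blast

lemma Ck_map_has_derivative:
  assumes "Ck_map 1 M N f" and "c \<in> charts M" "d \<in> charts N" and "x \<in> fst c" "f x \<in> fst d"
  obtains D where "(coord_rep c d f has_derivative D) (at (snd c x))"
  using Ck_map_coord_rep[OF assms(1-3)] assms(4,5) unfolding Ck_on_1 by blast

lemma Ck_map_preimage_openin:
  assumes "Ck_map k M N f" and "openin (mtop N) W"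
  shows "openin (mtop M) {y \<in> pts M. f y \<in> W}"
  using openin_continuous_map_preimage[OF Ck_map_continuous[OF assms(1)] assms(2)] .

section \<open>Open submanifolds and products\<close>

lemma is_chart_open_submfd:
  assumes c: "is_chart X c" and U: "openin X U"
  shows "is_chart (subtopology X U) (fst c \<inter> U, snd c)"
  unfolding is_chart_def fst_conv snd_conv
proof (intro conjI)
  show "openin (subtopology X U) (fst c \<inter> U)"
    using chart_openin[OF c] by (simp add: openin_subtopology_Int)
  show "open (snd c ` (fst c \<inter> U))"
    by (rule chart_image_open_subset[OF c U])
  have "homeomorphic_map (subtopology (subtopology X (fst c)) (fst c \<inter> U))
      (subtopology (top_of_set (snd c ` fst c)) (snd c ` (fst c \<inter> U))) (snd c)"
  proof (rule homeomorphic_map_subtopologies)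
    show "homeomorphic_map (subtopology X (fst c)) (top_of_set (snd c ` fst c)) (snd c)"
      using c by (simp add: is_chart_def)
    show "snd c ` (topspace (subtopology X (fst c)) \<inter> (fst c \<inter> U)) =
        topspace (top_of_set (snd c ` fst c)) \<inter> snd c ` (fst c \<inter> U)"
      using chart_subset[OF c] by auto
  qed
  moreover have "subtopology (subtopology X (fst c)) (fst c \<inter> U) = subtopology (subtopology X U) (fst c \<inter> U)"
    by (simp add: subtopology_subtopology Int_absorb1 Int_absorb2 inf_commute)
  moreover have "subtopology (top_of_set (snd c ` fst c)) (snd c ` (fst c \<inter> U)) = top_of_set (snd c ` (fst c \<inter> U))"
    by (simp add: subtopology_subtopology image_mono Int_absorb1)
  ultimately show "homeomorphic_map (subtopology (subtopology X U) (fst c \<inter> U)) (top_of_set (snd c ` (fst c \<inter> U))) (snd c)"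
    by simp
qed

lemma chart_inv_restrict:
  assumes c: "is_chart X c" and U: "openin X U" and y: "y \<in> snd c ` (fst c \<inter> U)"
  shows "chart_inv (fst c \<inter> U, snd c) y = chart_inv c y"
  using y chart_inv_chart[OF c] chart_inv_chart[OF is_chart_open_submfd[OF c U]] by auto

lemma atlas_open_submfd: "atlas M \<Longrightarrow> openin (mtop M) U \<Longrightarrow> atlas (open_submfd M U)"
  unfolding atlas_def open_submfd_def using is_chart_open_submfd by fastforce

definition prod_chart :: "('a, 'm) chart \<Rightarrow> ('b, 'n) chart \<Rightarrow> ('a \<times> 'b, 'm \<times> 'n) chart" where
  "prod_chart c d = (fst c \<times> fst d, map_prod (snd c) (snd d))"

lemma prod_chart_simps [simp]:
  "fst (prod_chart c d) = fst c \<times> fst d" "snd (prod_chart c d) (x, y) = (snd c x, snd d y)"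
  "snd (prod_chart c d) ` (A \<times> B) = snd c ` A \<times> snd d ` B"
  by (auto simp: prod_chart_def)

lemma prod_mfd_simps [simp]:
  "mtop (prod_mfd M N) = prod_topology (mtop M) (mtop N)"
  "charts (prod_mfd M N) = {prod_chart c d | c d. c \<in> charts M \<and> d \<in> charts N}"
  by (simp_all add: prod_mfd_def prod_chart_def)

lemma prod_chart_in: "\<lbrakk>c \<in> charts M; d \<in> charts N\<rbrakk> \<Longrightarrow> prod_chart c d \<in> charts (prod_mfd M N)"
  unfolding prod_mfd_simps by blast

lemma is_chart_prod:
  assumes "is_chart X c" and "is_chart Y d"
  shows "is_chart (prod_topology X Y) (prod_chart c d)"
  unfolding is_chart_def
proof (intro conjI)
  show "openin (prod_topology X Y) (fst (prod_chart c d))"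
    using chart_openin[OF assms(1)] chart_openin[OF assms(2)] by (simp add: openin_prod_Times_iff)
  show "open (snd (prod_chart c d) ` fst (prod_chart c d))"
    using chart_image_open[OF assms(1)] chart_image_open[OF assms(2)] by (simp add: open_Times)
  obtain g h where "homeomorphic_maps (subtopology X (fst c)) (top_of_set (snd c ` fst c)) (snd c) g"
    "homeomorphic_maps (subtopology Y (fst d)) (top_of_set (snd d ` fst d)) (snd d) h"
    using assms unfolding is_chart_def homeomorphic_map_maps by blast
  then have "homeomorphic_maps (prod_topology (subtopology X (fst c)) (subtopology Y (fst d)))
      (prod_topology (top_of_set (snd c ` fst c)) (top_of_set (snd d ` fst d)))
      (\<lambda>(x, y). (snd c x, snd d y)) (\<lambda>(x, y). (g x, h y))"
    unfolding homeomorphic_maps_prod by blast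
  moreover have "(\<lambda>(x, y). (snd c x, snd d y)) = snd (prod_chart c d)"
    by (simp add: prod_chart_def map_prod_def)
  ultimately show "homeomorphic_map (subtopology (prod_topology X Y) (fst (prod_chart c d)))
      (top_of_set (snd (prod_chart c d) ` fst (prod_chart c d))) (snd (prod_chart c d))"
    unfolding homeomorphic_map_maps
    by (auto simp: subtopology_Times)
qed

lemma atlas_prod: "atlas M \<Longrightarrow> atlas N \<Longrightarrow> atlas (prod_mfd M N)"
  unfolding atlas_def using is_chart_prod by fastforce

lemma chart_inv_prod:
  assumes c: "is_chart X c" and d: "is_chart Y d" and y: "y \<in> snd c ` fst c" and z: "z \<in> snd d ` fst d"
  shows "chart_inv (prod_chart c d) (y, z) = (chart_inv c y, chart_inv d z)"
proof -
  have "(y, z) = snd (prod_chart c d) (chart_inv c y, chart_inv d z)"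
    using chart_chart_inv[OF c y] chart_chart_inv[OF d z] by simp
  moreover have "(chart_inv c y, chart_inv d z) \<in> fst (prod_chart c d)"
    using chart_inv_in[OF c y] chart_inv_in[OF d z] by simp
  ultimately show ?thesis
    using chart_inv_chart[OF is_chart_prod[OF c d]] by metis
qed

lemma Ck_map_slice_left:
  fixes M :: "('a, 'm::real_inner) mfd" and N :: "('b, 'n::real_inner) mfd"
  assumes F: "Ck_map 1 (prod_mfd M N) P F" and M: "atlas M" and N: "smooth_manifold N" and b: "b \<in> pts N"
  shows "Ck_map 1 M P (\<lambda>a. F (a, b))"
  unfolding Ck_map_def
proof (intro conjI ballI)
  have "continuous_map (mtop M) (mtop P) (F \<circ> (\<lambda>a. (a, b)))"
    by (rule continuous_map_compose[of _ "prod_topology (mtop M) (mtop N)"])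
       (use Ck_map_continuous[OF F] b in \<open>auto simp: continuous_map_pairwise o_def\<close>)
  then show "continuous_map (mtop M) (mtop P) (\<lambda>a. F (a, b))"
    by (simp add: o_def)
  fix c e assume c: "c \<in> charts M" and e: "e \<in> charts P"
  obtain d where d: "d \<in> charts N" "b \<in> fst d"
    using smooth_manifold_chart[OF N b] by blast
  note cc = atlasD[OF M c] and dd = atlasD[OF smooth_manifold_atlas[OF N] d(1)]
  let ?T = "snd c ` (fst c \<inter> (\<lambda>a. F (a, b)) -` fst e)"
  let ?S = "snd (prod_chart c d) ` (fst (prod_chart c d) \<inter> F -` fst e)"
  let ?i = "\<lambda>y. (y, snd d b)"
  have "Ck_on 1 (coord_rep (prod_chart c d) e F) ?S"
    by (rule Ck_map_coord_rep[OF F _ e]) (use c d in \<open>blast intro: prod_chart_in\<close>)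
  then obtain F' where F': "\<And>q. q \<in> ?S \<Longrightarrow> (coord_rep (prod_chart c d) e F has_derivative F' q) (at q)"
    "\<And>v. continuous_on ?S (\<lambda>q. F' q v)"
    unfolding Ck_on_1 by blast
  have iT: "?i ` ?T \<subseteq> ?S"
    using d by (force simp: prod_chart_def)
  have "(coord_rep c e (\<lambda>a. F (a, b)) has_derivative (\<lambda>v. F' (?i y) (v, 0))) (at y)" if y: "y \<in> ?T" for y
  proof (rule has_derivative_transform_within_open[OF _ chart_image_open[OF cc]])
    have "(?i has_derivative (\<lambda>v. (v, 0))) (at y)"
      by (auto intro!: derivative_eq_intros)
    from has_derivative_compose[OF this F'(1)] iT y
    show "((\<lambda>y. coord_rep (prod_chart c d) e F (?i y)) has_derivative (\<lambda>v. F' (?i y) (v, 0))) (at y)"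
      by blast
    show "y \<in> snd c ` fst c"
      using y by blast
    show "coord_rep (prod_chart c d) e F (?i y) = coord_rep c e (\<lambda>a. F (a, b)) y" if "y \<in> snd c ` fst c" for y
      using chart_inv_prod[OF cc dd that, of "snd d b"] chart_inv_chart[OF dd d(2)] d(2)
      by (simp add: coord_rep_apply)
  qed
  moreover have "continuous_on ?T (\<lambda>y. F' (?i y) (v, 0))" for v
    by (rule continuous_on_compose2[OF F'(2) _ iT]) (intro continuous_intros)
  ultimately have "Ck_on 1 (coord_rep c e (\<lambda>a. F (a, b))) ?T"
    unfolding Ck_on_1 by (intro exI[of _ "\<lambda>y v. F' (?i y) (v, 0)"]) blast
  then show "Ck_on 1 (snd e \<circ> (\<lambda>a. F (a, b)) \<circ> chart_inv c) ?T"
    by (simp only: coord_rep_def)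
qed

lemma Ck_map_slice_right:
  fixes M :: "('a, 'm::real_inner) mfd" and N :: "('b, 'n::real_inner) mfd"
  assumes F: "Ck_map 1 (prod_mfd M N) P F" and M: "smooth_manifold M" and N: "atlas N" and a: "a \<in> pts M"
  shows "Ck_map 1 N P (\<lambda>b. F (a, b))"
  unfolding Ck_map_def
proof (intro conjI ballI)
  have "continuous_map (mtop N) (mtop P) (F \<circ> (\<lambda>b. (a, b)))"
    by (rule continuous_map_compose[of _ "prod_topology (mtop M) (mtop N)"])
       (use Ck_map_continuous[OF F] a in \<open>auto simp: continuous_map_pairwise o_def\<close>)
  then show "continuous_map (mtop N) (mtop P) (\<lambda>b. F (a, b))"
    by (simp add: o_def)
  fix d e assume d: "d \<in> charts N" and e: "e \<in> charts P"
  obtain c where c: "c \<in> charts M" "a \<in> fst c"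
    using smooth_manifold_chart[OF M a] by blast
  note dd = atlasD[OF N d] and cc = atlasD[OF smooth_manifold_atlas[OF M] c(1)]
  let ?T = "snd d ` (fst d \<inter> (\<lambda>b. F (a, b)) -` fst e)"
  let ?S = "snd (prod_chart c d) ` (fst (prod_chart c d) \<inter> F -` fst e)"
  let ?i = "\<lambda>y. (snd c a, y)"
  have "Ck_on 1 (coord_rep (prod_chart c d) e F) ?S"
    by (rule Ck_map_coord_rep[OF F _ e]) (use c d in \<open>blast intro: prod_chart_in\<close>)
  then obtain F' where F': "\<And>q. q \<in> ?S \<Longrightarrow> (coord_rep (prod_chart c d) e F has_derivative F' q) (at q)"
    "\<And>v. continuous_on ?S (\<lambda>q. F' q v)"
    unfolding Ck_on_1 by blast
  have iT: "?i ` ?T \<subseteq> ?S"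
    using c by (force simp: prod_chart_def)
  have "(coord_rep d e (\<lambda>b. F (a, b)) has_derivative (\<lambda>v. F' (?i y) (0, v))) (at y)" if y: "y \<in> ?T" for y
  proof (rule has_derivative_transform_within_open[OF _ chart_image_open[OF dd]])
    have "(?i has_derivative (\<lambda>v. (0, v))) (at y)"
      by (auto intro!: derivative_eq_intros)
    from has_derivative_compose[OF this F'(1)] iT y
    show "((\<lambda>y. coord_rep (prod_chart c d) e F (?i y)) has_derivative (\<lambda>v. F' (?i y) (0, v))) (at y)"
      by blast
    show "y \<in> snd d ` fst d"
      using y by blast
    show "coord_rep (prod_chart c d) e F (?i y) = coord_rep d e (\<lambda>b. F (a, b)) y" if "y \<in> snd d ` fst d" for y
      using chart_inv_prod[OF cc dd _ that, of "snd c a"] chart_inv_chart[OF cc c(2)] c(2)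
      by (simp add: coord_rep_apply)
  qed
  moreover have "continuous_on ?T (\<lambda>y. F' (?i y) (0, v))" for v
    by (rule continuous_on_compose2[OF F'(2) _ iT]) (intro continuous_intros)
  ultimately have "Ck_on 1 (coord_rep d e (\<lambda>b. F (a, b))) ?T"
    unfolding Ck_on_1 by (intro exI[of _ "\<lambda>y v. F' (?i y) (0, v)"]) blast
  then show "Ck_on 1 (snd e \<circ> (\<lambda>b. F (a, b)) \<circ> chart_inv d) ?T"
    by (simp only: coord_rep_def)
qed

lemma has_derivative_coord_rep_id:
  assumes d: "is_chart X d" and x: "x \<in> fst d"
  shows "(coord_rep d d (\<lambda>y. y) has_derivative (\<lambda>v. v)) (at (snd d x))"
  by (rule has_derivative_transform_within_open[OF has_derivative_ident chart_image_open[OF d]])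
     (use x chart_chart_inv[OF d] in \<open>auto simp: coord_rep_apply\<close>)

section \<open>Orbit maps of transitive actions are submersions\<close>

lemma lie_group_mult_Ck1:
  assumes "lie_group G MG" and "a \<in> carrier G"
  shows "Ck_map 1 MG MG (\<lambda>b. a \<otimes>\<^bsub>G\<^esub> b)"
proof -
  have G: "smooth_manifold MG" "pts MG = carrier G"
    "smooth_map (prod_mfd MG MG) MG (\<lambda>(a, b). a \<otimes>\<^bsub>G\<^esub> b)"
    using assms(1) by (simp_all add: lie_group_def)
  show ?thesis
    using Ck_map_slice_right[OF smooth_map_Ck1[OF G(3)] G(1) smooth_manifold_atlas[OF G(1)]] assms(2) G(2)
    by simp
qed

lemma action_Ck1:
  assumes "lie_group G MG" and M: "smooth_manifold M" and act: "smooth_action G MG M \<Phi>"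
  shows "x \<in> pts M \<Longrightarrow> Ck_map 1 MG M (\<lambda>a. \<Phi> a x)" and "a \<in> carrier G \<Longrightarrow> Ck_map 1 M M (\<Phi> a)"
proof -
  have G: "smooth_manifold MG" "pts MG = carrier G"
    using assms(1) by (simp_all add: lie_group_def)
  have F: "Ck_map 1 (prod_mfd MG M) M (\<lambda>(a, x). \<Phi> a x)"
    using act unfolding smooth_action_def by (blast intro: smooth_map_Ck1)
  show "x \<in> pts M \<Longrightarrow> Ck_map 1 MG M (\<lambda>a. \<Phi> a x)"
    using Ck_map_slice_left[OF F smooth_manifold_atlas[OF G(1)] M] by simp
  show "a \<in> carrier G \<Longrightarrow> Ck_map 1 M M (\<Phi> a)"
    using Ck_map_slice_right[OF F G(1) smooth_manifold_atlas[OF M]] G(2) by (simp add: eta_contract_eq)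
qed

text \<open>By equivariance, the orbit map has the same rank everywhere.\<close>

lemma orbit_map_derivative_range:
  fixes B :: "('b, 'n::real_inner) mfd"
  assumes lie: "lie_group G MG" and B: "smooth_manifold B" and act: "smooth_action G MG B \<phi>" and b: "b \<in> pts B"
    and a: "a1 \<in> carrier G" "a2 \<in> carrier G"
    and c: "c1 \<in> charts MG" "c2 \<in> charts MG" "a1 \<in> fst c1" "a2 \<in> fst c2"
    and d: "d1 \<in> charts B" "d2 \<in> charts B" "\<phi> a1 b \<in> fst d1" "\<phi> a2 b \<in> fst d2"
    and D1: "(coord_rep c1 d1 (\<lambda>a. \<phi> a b) has_derivative D1) (at (snd c1 a1))"
    and D2: "(coord_rep c2 d2 (\<lambda>a. \<phi> a b) has_derivative D2) (at (snd c2 a2))"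
  obtains L :: "'n \<Rightarrow> 'n" where "linear L" "inj L" "range D1 \<subseteq> L ` range D2"
proof -
  have MG: "smooth_manifold MG" "pts MG = carrier G"
    using lie by (simp_all add: lie_group_def)
  interpret G: group G
    using lie by (simp add: lie_group_def)
  interpret A: group_action G "pts B" \<phi>
    using act by (simp add: smooth_action_def)
  \<comment> \<open>The element \<open>g\<close> takes \<open>a2\<close> to \<open>a1\<close>. The
    orbit map equals the action of \<open>g\<close> after itself after left translation by the
    inverse of \<open>g\<close>, so the chain rule gives
    \<open>D1 = L \<circ> (D2 \<circ> M)\<close>.\<close>
  define g where "g = a1 \<otimes>\<^bsub>G\<^esub> inv\<^bsub>G\<^esub> a2"
  have g: "g \<in> carrier G" "inv\<^bsub>G\<^esub> g \<in> carrier G"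
    using a by (simp_all add: g_def)
  have ga: "g \<otimes>\<^bsub>G\<^esub> a2 = a1" "inv\<^bsub>G\<^esub> g \<otimes>\<^bsub>G\<^esub> a1 = a2"
    using a by (simp_all add: g_def G.m_assoc G.inv_mult_group)
  have inv: "\<phi> (inv\<^bsub>G\<^esub> g) (\<phi> g x) = x" if "x \<in> pts B" for x
    using A.orbit_sym_aux[OF g(1) that] by simp
  have gb: "\<phi> g (\<phi> a2 b) = \<phi> a1 b"
    using A.composition_rule[OF b g(1) a(2)] ga(1) by simp
  let ?l = "\<lambda>a. inv\<^bsub>G\<^esub> g \<otimes>\<^bsub>G\<^esub> a"
  let ?\<theta> = "\<lambda>a. \<phi> a b"
  note cc = atlasD[OF smooth_manifold_atlas[OF MG(1)]] and dd = atlasD[OF smooth_manifold_atlas[OF B]]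
  note l = lie_group_mult_Ck1[OF lie g(2)] and \<theta> = action_Ck1(1)[OF lie B act b]
    and \<phi>g = action_Ck1(2)[OF lie B act g(1)] and \<phi>gi = action_Ck1(2)[OF lie B act g(2)]
  obtain M where M: "(coord_rep c1 c2 ?l has_derivative M) (at (snd c1 a1))"
    using Ck_map_has_derivative[OF l c(1,2,3)] ga(2) c(4) by metis
  obtain L where L: "(coord_rep d2 d1 (\<phi> g) has_derivative L) (at (snd d2 (\<phi> a2 b)))"
    using Ck_map_has_derivative[OF \<phi>g d(2,1,4)] gb d(3) by metis
  obtain K where K: "(coord_rep d1 d2 (\<phi> (inv\<^bsub>G\<^esub> g)) has_derivative K) (at (snd d1 (\<phi> a1 b)))"
    using Ck_map_has_derivative[OF \<phi>gi d(1,2,3)] gb inv[OF A.element_image[OF a(2) b refl]] d(4) by metis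
  have 1: "(coord_rep c1 d2 (?\<theta> \<circ> ?l) has_derivative (D2 \<circ> M)) (at (snd c1 a1))"
    by (rule has_derivative_coord_rep_comp[OF cc[OF c(1)] cc[OF c(2)] M])
       (use D2 c ga(2) Ck_map_preimage_openin[OF l chart_openin[OF cc[OF c(2)]]] in simp_all)
  have "continuous_map (mtop MG) (mtop B) (?\<theta> \<circ> ?l)"
    using continuous_map_compose[OF Ck_map_continuous[OF l] Ck_map_continuous[OF \<theta>]] .
  then have W: "openin (mtop MG) {y \<in> pts MG. (?\<theta> \<circ> ?l) y \<in> fst d2}"
    using openin_continuous_map_preimage chart_openin[OF dd[OF d(2)]] by blast
  have "(coord_rep c1 d1 (\<phi> g \<circ> (?\<theta> \<circ> ?l)) has_derivative (L \<circ> (D2 \<circ> M))) (at (snd c1 a1))"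
    by (rule has_derivative_coord_rep_comp[OF cc[OF c(1)] dd[OF d(2)] 1 _ _ _ W])
       (use L c d ga(2) in simp_all)
  moreover have "(\<phi> g \<circ> (?\<theta> \<circ> ?l)) y = ?\<theta> y" if "y \<in> pts MG" for y
  proof -
    have y: "y \<in> carrier G"
      using that MG by simp
    then have "\<phi> g (\<phi> (?l y) b) = \<phi> (g \<otimes>\<^bsub>G\<^esub> ?l y) b"
      using A.composition_rule[OF b g(1), of "?l y"] g by simp
    also have "g \<otimes>\<^bsub>G\<^esub> ?l y = y"
      using g y by (simp flip: G.m_assoc)
    finally show ?thesis
      by simp
  qed
  ultimately have "(coord_rep c1 d1 ?\<theta> has_derivative (L \<circ> (D2 \<circ> M))) (at (snd c1 a1))"
    using has_derivative_coord_rep_eq[OF cc[OF c(1)] _ openin_topspace c(3)] a MG by metis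
  then have D1_eq: "D1 = L \<circ> (D2 \<circ> M)"
    using D1 has_derivative_unique by blast
  \<comment> \<open>The derivative \<open>K\<close> of the action of the inverse of \<open>g\<close>
    is a left inverse of \<open>L\<close>, hence \<open>L\<close> is injective.\<close>
  have W2: "openin (mtop B) {y \<in> pts B. \<phi> g y \<in> fst d1}"
    by (rule Ck_map_preimage_openin[OF \<phi>g chart_openin[OF dd[OF d(1)]]])
  have "(coord_rep d2 d2 (\<phi> (inv\<^bsub>G\<^esub> g) \<circ> \<phi> g) has_derivative (K \<circ> L)) (at (snd d2 (\<phi> a2 b)))"
    by (rule has_derivative_coord_rep_comp[OF dd[OF d(2)] dd[OF d(1)] L _ _ _ W2])
       (use K d gb in simp_all)
  then have "(coord_rep d2 d2 (\<lambda>y. y) has_derivative (K \<circ> L)) (at (snd d2 (\<phi> a2 b)))"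
    by (rule has_derivative_coord_rep_eq[OF dd[OF d(2)] _ openin_topspace d(4)])
       (use inv A.element_image[OF a(2) b refl] in simp_all)
  then have "K \<circ> L = (\<lambda>v. v)"
    using has_derivative_unique has_derivative_coord_rep_id[OF dd[OF d(2)] d(4)] by blast
  then have "inj L"
    by (metis comp_apply injI)
  moreover have "linear L"
    using L has_derivative_linear by blast
  ultimately show thesis
    using that[of L] unfolding D1_eq by (auto simp: image_comp)
qed

text \<open>If the derivative at the unit is not onto, the rank is deficient and constant, so every
  group element whose orbit point lies in the domain of \<open>d\<close> has a basic neighborhood
  with null image. A countable base then makes the domain of \<open>d\<close> null, although its
  chart image is open and nonempty.\<close>

lemma orbit_map_submersion:
  fixes MG :: "('g, 'm::real_inner) mfd" and B :: "('b, 'n::real_inner) mfd"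
  assumes lie: "lie_group G MG" and B: "smooth_manifold B" and act: "smooth_action G MG B \<phi>"
    and trans: "transitive_action G (pts B) \<phi>" and b: "b \<in> pts B"
    and c: "c \<in> charts MG" "\<one>\<^bsub>G\<^esub> \<in> fst c" and d: "d \<in> charts B" "b \<in> fst d"
    and D: "(coord_rep c d (\<lambda>a. \<phi> a b) has_derivative D) (at (snd c \<one>\<^bsub>G\<^esub>))"
  shows "range D = UNIV"
proof (rule ccontr)
  assume nD: "range D \<noteq> UNIV"
  have MG: "smooth_manifold MG" "pts MG = carrier G"
    using lie by (simp_all add: lie_group_def)
  interpret G: group G
    using lie by (simp add: lie_group_def)
  interpret A: transitive_action G "pts B" \<phi>
    by (rule trans)
  let ?\<theta> = "\<lambda>a. \<phi> a b"
  note cc = atlasD[OF smooth_manifold_atlas[OF MG(1)]] and dd = atlasD[OF smooth_manifold_atlas[OF B]]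
  note \<theta> = action_Ck1(1)[OF lie B act b]
  have one: "?\<theta> \<one>\<^bsub>G\<^esub> = b"
    using A.id_eq_one b by (metis restrict_apply')
  have fdm: "\<exists>S::'m set. finite S \<and> span S = UNIV" and fdn: "\<exists>S::'n set. finite S \<and> span S = UNIV"
    using MG(1) B by (simp_all add: smooth_manifold_def)
  have "second_countable (mtop MG)"
    using MG(1) by (simp add: smooth_manifold_def)
  then obtain \<B> where \<B>: "countable \<B>"
    and base: "\<forall>U x. openin (mtop MG) U \<and> x \<in> U \<longrightarrow> (\<exists>V\<in>\<B>. x \<in> V \<and> V \<subseteq> U)"
    unfolding second_countable_def by blast
  define \<G> where "\<G> = {V \<in> \<B>. null_set (snd d ` (?\<theta> ` V))}"
  have local: "\<exists>V\<in>\<G>. a \<in> V" if a: "a \<in> carrier G" and ad: "?\<theta> a \<in> fst d" for a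
  proof -
    obtain e where e: "e \<in> charts MG" "a \<in> fst e"
      using smooth_manifold_chart[OF MG(1)] a MG(2) by blast
    let ?W = "{y \<in> pts MG. ?\<theta> y \<in> fst d}"
    have W: "openin (mtop MG) ?W"
      by (rule Ck_map_preimage_openin[OF \<theta> chart_openin[OF dd[OF d(1)]]])
    let ?S = "snd e ` (fst e \<inter> ?W)"
    have sub: "fst e \<subseteq> pts MG"
      by (rule chart_subset[OF cc[OF e(1)]])
    have "fst e \<inter> ?W = fst e \<inter> ?\<theta> -` fst d"
      using sub by blast
    then have "Ck_on 1 (coord_rep e d ?\<theta>) ?S"
      using Ck_map_coord_rep[OF \<theta> e(1) d(1)] by metis
    then obtain f' where f': "\<And>x. x \<in> ?S \<Longrightarrow> (coord_rep e d ?\<theta> has_derivative f' x) (at x)"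
      "\<And>v. continuous_on ?S (\<lambda>x. f' x v)"
      unfolding Ck_on_1 by blast
    have aS: "snd e a \<in> ?S"
      using e ad a MG by blast
    obtain N where N: "open N" "snd e a \<in> N" "N \<subseteq> ?S" "null_set (coord_rep e d ?\<theta> ` N)"
    proof (rule constant_rank_null_set[OF fdm fdn chart_image_open_subset[OF cc[OF e(1)] W] aS f'])
      show "\<exists>L::'n \<Rightarrow> 'n. linear L \<and> range (f' x) \<subseteq> L ` range (f' (snd e a))" if "x \<in> ?S" for x
      proof -
        obtain y where y: "y \<in> fst e" "y \<in> carrier G" "?\<theta> y \<in> fst d" "x = snd e y"
          using \<open>x \<in> ?S\<close> MG(2) by blast
        show ?thesis
          using orbit_map_derivative_range[OF lie B act b y(2) a e(1) e(1) y(1) e(2) d(1) d(1) y(3) ad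
              f'(1)[OF \<open>x \<in> ?S\<close>, unfolded y(4)] f'(1)[OF aS]] y(4) by metis
      qed
      \<comment> \<open>As \<open>L\<close> is injective, a surjective derivative at
        \<open>a\<close> would make the derivative \<open>D\<close> at the unit surjective.\<close>
      show "range (f' (snd e a)) \<noteq> UNIV"
      proof
        assume U: "range (f' (snd e a)) = UNIV"
        obtain L :: "'n \<Rightarrow> 'n" where L: "inj L" "range (f' (snd e a)) \<subseteq> L ` range D"
          by (rule orbit_map_derivative_range[OF lie B act b a G.one_closed e(1) c(1) e(2) c(2) d(1) d(1) ad _ f'(1)[OF aS] D])
             (use one d in simp_all)
        have "w \<in> range D" for w
        proof -
          have "L w \<in> L ` range D"
            using L(2) U by blast
          with L(1) show ?thesis
            by (simp add: inj_image_mem_iff)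
        qed
        with nD show False by blast
      qed
    qed blast+
    have "openin (mtop MG) {y \<in> fst e. snd e y \<in> N}"
      by (rule chart_preimage_openin[OF cc[OF e(1)] N(1)])
    then obtain V where V: "V \<in> \<B>" "a \<in> V" "V \<subseteq> {y \<in> fst e. snd e y \<in> N}"
      using base e(2) N(2) by blast
    have "snd d ` (?\<theta> ` V) \<subseteq> coord_rep e d ?\<theta> ` N"
    proof clarify
      fix y assume "y \<in> V"
      then have y: "y \<in> fst e" "snd e y \<in> N"
        using V(3) by auto
      then have "snd d (?\<theta> y) = coord_rep e d ?\<theta> (snd e y)"
        using chart_inv_chart[OF cc[OF e(1)]] by (simp add: coord_rep_apply)
      with y show "snd d (?\<theta> y) \<in> coord_rep e d ?\<theta> ` N"
        by blast
    qed
    then have "V \<in> \<G>"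
      using V(1) null_set_subset[OF N(4)] by (simp add: \<G>_def)
    with V(2) show ?thesis by blast
  qed
  \<comment> \<open>Transitivity puts every point of the chart domain on the orbit of
    \<open>b\<close>.\<close>
  have "snd d ` fst d \<subseteq> (\<Union>V\<in>\<G>. snd d ` (?\<theta> ` V))"
  proof clarify
    fix y assume y: "y \<in> fst d"
    then have "y \<in> pts B"
      using chart_subset[OF dd[OF d(1)]] by blast
    then obtain a where a: "a \<in> carrier G" "?\<theta> a = y"
      using A.unique_orbit[OF b] by blast
    with y local[of a] show "snd d y \<in> (\<Union>V\<in>\<G>. snd d ` (?\<theta> ` V))"
      by blast
  qed
  moreover have "null_set (\<Union>V\<in>\<G>. snd d ` (?\<theta> ` V))"
    using \<B> by (intro null_set_countable_Union) (auto simp: \<G>_def)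
  ultimately have "null_set (snd d ` fst d)"
    using null_set_subset by blast
  then show False
    using open_not_null_set[OF fdn chart_image_open[OF dd[OF d(1)]]] d(2) by blast
qed

section \<open>Vertical descent at noncritical points\<close>

lemma Ck_map_open_submfd:
  assumes f: "Ck_map 1 M N f" and M: "atlas M" and N: "atlas N" and U: "openin (mtop M) U"
  shows "Ck_map 1 (open_submfd M U) N f"
  unfolding Ck_map_def
proof (intro conjI ballI)
  show "continuous_map (mtop (open_submfd M U)) (mtop N) f"
    using Ck_map_continuous[OF f] by (simp add: open_submfd_def continuous_map_from_subtopology)
  fix c d assume "c \<in> charts (open_submfd M U)" and d: "d \<in> charts N"
  then obtain c0 where c0: "c0 \<in> charts M" "c = (fst c0 \<inter> U, snd c0)"
    by (auto simp: open_submfd_def)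
  note cc = atlasD[OF M c0(1)]
  let ?W = "{y \<in> pts M. f y \<in> fst d} \<inter> U"
  have W: "openin (mtop M) ?W"
    by (intro openin_Int U Ck_map_preimage_openin[OF f] chart_openin[OF atlasD[OF N d]])
  let ?T = "snd c ` (fst c \<inter> f -` fst d)"
  have T: "?T = snd c0 ` (fst c0 \<inter> ?W)"
    using chart_subset[OF cc] by (auto simp: c0(2))
  have "Ck_on 1 (coord_rep c0 d f) ?T"
    by (rule Ck_on_1_subset[OF Ck_map_coord_rep[OF f c0(1) d]]) (auto simp: c0(2))
  moreover have "coord_rep c0 d f y = coord_rep c d f y" if "y \<in> ?T" for y
  proof -
    have "y \<in> snd c0 ` (fst c0 \<inter> U)"
      using that unfolding T by blast
    from chart_inv_restrict[OF cc U this] show ?thesis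
      by (simp add: coord_rep_apply c0(2))
  qed
  moreover have "open ?T"
    unfolding T by (rule chart_image_open_subset[OF cc W])
  ultimately have "Ck_on 1 (coord_rep c d f) ?T"
    using Ck_on_1_cong by blast
  then show "Ck_on 1 (snd d \<circ> f \<circ> chart_inv c) ?T"
    by (simp only: coord_rep_def)
qed

lemma restrict_chart_in:
  assumes "c \<in> charts M"
  shows "(fst c \<inter> U, snd c) \<in> charts (open_submfd M U)"
  unfolding open_submfd_def mfd.simps using assms by (intro CollectI exI[of _ c] conjI refl)

abbreviation real_chart :: "(real, real) chart" where
  "real_chart \<equiv> (UNIV, id)"

lemma charts_real_mfd: "charts real_mfd = {real_chart}"
  by (simp add: real_mfd_def)

lemma atlas_real_mfd: "atlas real_mfd"
  by (simp add: atlas_def real_mfd_def is_chart_def homeomorphic_map_id)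

lemma noncritical_derivative:
  assumes E: "smooth_manifold E" and f: "Ck_map 1 E real_mfd f" and x: "x \<in> pts E" "x \<notin> critical_set E f (f x)"
  obtains c D v where "c \<in> charts E" "x \<in> fst c"
    "(coord_rep c real_chart f has_derivative D) (at (snd c x))" "D v \<noteq> 0"
proof -
  \<comment> \<open>\<open>differential\<close> evaluates a tangent vector in exactly this chosen
    chart, so the nonzero derivative is found there.\<close>
  define c where "c = (SOME c. c \<in> charts_at E x)"
  have "\<exists>c. c \<in> charts_at E x"
    using smooth_manifold_chart[OF E x(1)] by (auto simp: charts_at_def)
  then have "c \<in> charts_at E x"
    unfolding c_def by (rule someI_ex)
  then have c: "c \<in> charts E" "x \<in> fst c"
    by (auto simp: charts_at_def)
  obtain D where D: "(coord_rep c real_chart f has_derivative D) (at (snd c x))"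
    using Ck_map_has_derivative[OF f c(1) _ c(2), of real_chart] by (auto simp: charts_real_mfd)
  then have fr: "frechet_derivative (id \<circ> f \<circ> chart_inv c) (at (snd c x)) = D"
    using frechet_derivative_at by (fastforce simp: coord_rep_def)
  obtain v where v: "differential E real_mfd f x v \<noteq> (\<lambda>_. 0)"
    using x by (auto simp: critical_set_def)
  have "D (v c) \<noteq> 0"
  proof
    assume "D (v c) = 0"
    moreover have "differential E real_mfd f x v =
        (\<lambda>d. if d \<in> charts_at real_mfd (f x) then frechet_derivative (snd d \<circ> f \<circ> chart_inv c) (at (snd c x)) (v c) else 0)"
      by (simp only: differential_def Let_def c_def)
    moreover have "(if d \<in> charts_at real_mfd (f x) then frechet_derivative (snd d \<circ> f \<circ> chart_inv c) (at (snd c x)) (v c) else 0) = 0" for d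
    proof (cases "d \<in> charts_at real_mfd (f x)")
      case True
      then have "d = real_chart"
        by (simp add: charts_at_def charts_real_mfd)
      with \<open>D (v c) = 0\<close> fr show ?thesis by simp
    qed simp
    ultimately have "differential E real_mfd f x v = (\<lambda>_. 0)"
      by simp
    with v show False by simp
  qed
  with that[OF c D] show thesis by blast
qed

text \<open>Vectors that project onto the first factor span the product together with the second
  factor. This is applied to the orbit directions and the fiber directions in a bundle
  chart.\<close>

lemma linear_pair_zero:
  assumes Q: "linear Q" and v: "range (fst \<circ> W) = UNIV" and 0: "\<And>m. Q (W m) = 0" "\<And>w. Q (0, w) = 0"
  shows "Q z = 0"
proof -
  have "fst z \<in> range (fst \<circ> W)"
    using v by simp
  then obtain m where "fst z = fst (W m)"
    by auto
  then have z: "z = W m + (0, snd z - snd (W m))"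
    by (simp add: prod_eq_iff)
  have "Q z = Q (W m) + Q (0, snd z - snd (W m))"
    by (subst z) (rule linear_add[OF Q])
  with 0 show ?thesis by simp
qed

text \<open>Straight lines in the fiber coordinates of a bundle chart keep the base point fixed. If
  \<open>f\<close> has negative derivative at \<open>x\<close> in one of these directions, the same
  direction works for a uniform time at all nearby points, as the derivative is continuous.\<close>

lemma vertical_descent:
  fixes MG :: "('g, 'mg::real_inner) mfd" and E :: "('e, 'me::real_inner) mfd"
    and B :: "('b, 'mb::real_inner) mfd" and F :: "('f, 'mf::real_inner) mfd"
  assumes lie: "lie_group G MG"
    and actE: "smooth_action G MG E \<Phi>" and actB: "smooth_action G MG B \<phi>"
    and fib: "smooth_fiber_bundle E B F p"
    and equiv: "\<And>a y. \<lbrakk>a \<in> carrier G; y \<in> pts E\<rbrakk> \<Longrightarrow> p (\<Phi> a y) = \<phi> a (p y)"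
    and trans: "transitive_action G (pts B) \<phi>"
    and f: "Ck_map 1 E real_mfd f"
    and f_inv: "\<And>a y. \<lbrakk>a \<in> carrier G; y \<in> pts E\<rbrakk> \<Longrightarrow> f (\<Phi> a y) = f y"
    and x: "x \<in> pts E" "x \<notin> critical_set E f (f x)"
  obtains V \<epsilon> K where "openin (mtop E) V" "x \<in> V" "\<epsilon> > (0::real)"
    "continuous_map (prod_topology (top_of_set {0..\<epsilon>}) (subtopology (mtop E) V)) (mtop E) (\<lambda>(s, y). K s y)"
    "\<And>y. y \<in> V \<Longrightarrow> K 0 y = y" "\<And>y s. \<lbrakk>y \<in> V; s \<in> {0..\<epsilon>}\<rbrakk> \<Longrightarrow> p (K s y) = p y"
    "\<And>y s. \<lbrakk>y \<in> V; s \<in> {0<..\<epsilon>}\<rbrakk> \<Longrightarrow> f (K s y) < f y"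
proof -
  have E: "smooth_manifold E" and B: "smooth_manifold B" and F: "smooth_manifold F" and p: "smooth_map E B p"
    using fib by (simp_all add: smooth_fiber_bundle_def)
  have MG: "smooth_manifold MG" "pts MG = carrier G"
    using lie by (simp_all add: lie_group_def)
  interpret G: group G
    using lie by (simp add: lie_group_def)
  interpret AE: group_action G "pts E" \<Phi>
    using actE by (simp add: smooth_action_def)
  interpret AB: group_action G "pts B" \<phi>
    using actB by (simp add: smooth_action_def)
  note atE = smooth_manifold_atlas[OF E] and atB = smooth_manifold_atlas[OF B]
    and atF = smooth_manifold_atlas[OF F] and atG = smooth_manifold_atlas[OF MG(1)]
  have p_cont: "continuous_map (mtop E) (mtop B) p"
    using Ck_map_continuous[OF smooth_map_Ck1[OF p]] .
  have px: "p x \<in> pts B"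
    using continuous_map_funspace[OF p_cont] x by blast
  obtain U \<psi> where U: "openin (mtop B) U" "p x \<in> U"
    and \<psi>_diff: "diffeomorphism (open_submfd E (pts E \<inter> p -` U)) (prod_mfd (open_submfd B U) F) \<psi>"
    and fst_\<psi>: "\<forall>y\<in>pts E \<inter> p -` U. fst (\<psi> y) = p y"
    using fib px unfolding smooth_fiber_bundle_def by blast
  define D where "D = pts E \<inter> p -` U"
  define E' where "E' = open_submfd E D"
  define Q where "Q = prod_mfd (open_submfd B U) F"
  have D: "openin (mtop E) D"
    using openin_continuous_map_preimage[OF p_cont U(1)] by (simp add: D_def Int_def vimage_def)
  have DE: "D \<subseteq> pts E"
    by (auto simp: D_def)
  have xD: "x \<in> D"
    using x U by (simp add: D_def)
  have mtopE': "mtop E' = subtopology (mtop E) D"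
    by (simp add: E'_def open_submfd_def)
  have ptsE': "pts E' = D"
    using DE by (auto simp: mtopE')
  have atE': "atlas E'"
    unfolding E'_def by (rule atlas_open_submfd[OF atE D])
  have atQ: "atlas Q"
    unfolding Q_def by (intro atlas_prod atlas_open_submfd atB atF U)
  obtain g where \<psi>_smooth: "smooth_map E' Q \<psi>" and g_smooth: "smooth_map Q E' g"
    and inverse: "\<forall>y\<in>pts E'. g (\<psi> y) = y" "\<forall>z\<in>pts Q. \<psi> (g z) = z"
    using \<psi>_diff unfolding diffeomorphism_def D_def[symmetric] E'_def[symmetric] Q_def[symmetric] by blast
  note \<psi> = smooth_map_Ck1[OF \<psi>_smooth] and g = smooth_map_Ck1[OF g_smooth]
  have g\<psi>: "g (\<psi> y) = y" if "y \<in> D" for y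
    using inverse(1) that ptsE' by blast
  have \<psi>g: "\<psi> (g z) = z" if "z \<in> pts Q" for z
    using inverse(2) that by blast
  have \<psi>Q: "\<psi> y \<in> pts Q" if "y \<in> D" for y
    using continuous_map_funspace[OF Ck_map_continuous[OF \<psi>]] that ptsE' by blast
  have gD: "g z \<in> D" if "z \<in> pts Q" for z
    using continuous_map_funspace[OF Ck_map_continuous[OF g]] that ptsE' by blast
  have fst\<psi>: "fst (\<psi> y) = p y" if "y \<in> D" for y
    using fst_\<psi> that by (simp add: D_def)

  obtain c0 Fd v0 where c0: "c0 \<in> charts E" "x \<in> fst c0"
    and Fd: "(coord_rep c0 real_chart f has_derivative Fd) (at (snd c0 x))" and v0: "Fd v0 \<noteq> 0"
    by (rule noncritical_derivative[OF E f x])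
  define c where "c = (fst c0 \<inter> D, snd c0)"
  have c: "c \<in> charts E'" "x \<in> fst c"
    unfolding c_def E'_def using c0 xD by (simp_all add: restrict_chart_in)
  have snd_c [simp]: "snd c = snd c0"
    by (simp add: c_def)
  obtain d0 where d0: "d0 \<in> charts B" "p x \<in> fst d0"
    using smooth_manifold_chart[OF B px] by blast
  define d where "d = (fst d0 \<inter> U, snd d0)"
  have d: "d \<in> charts (open_submfd B U)"
    unfolding d_def using d0 by (simp add: restrict_chart_in)
  have "snd (\<psi> x) \<in> pts F"
    using \<psi>Q[OF xD] by (auto simp: Q_def)
  then obtain k where k: "k \<in> charts F" "snd (\<psi> x) \<in> fst k"
    using smooth_manifold_chart[OF F] by blast
  \<comment> \<open>In these coordinates base and fiber are split, and the vertical directions are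
    the vectors \<open>(0, w)\<close>.\<close>
  define e where "e = prod_chart d k"
  have e: "e \<in> charts Q"
    unfolding e_def Q_def by (intro prod_chart_in d k)
  have \<psi>xe: "\<psi> x \<in> fst e"
    using fst\<psi>[OF xD] d0 U k by (auto simp: e_def d_def mem_Times_iff)
  note cc = atlasD[OF atE' c(1)] and ee = atlasD[OF atQ e] and c0c = atlasD[OF atE c0(1)]
  have dd: "is_chart (mtop (open_submfd B U)) d"
    using atlasD[OF atlas_open_submfd[OF atB U(1)] d] .
  note kk = atlasD[OF atF k(1)]
  have fst_e: "fst e \<subseteq> pts Q"
    by (rule chart_subset[OF ee])

  have f': "Ck_map 1 E' real_mfd f"
    unfolding E'_def by (rule Ck_map_open_submfd[OF f atE atlas_real_mfd D])
  define ft where "ft = coord_rep e real_chart (f \<circ> g)"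
  \<comment> \<open>On this part of the chart image the inverse trivialization \<open>g\<close>
    lands in the chart \<open>c\<close>, so that \<open>ft\<close> is \<open>C^1\<close> as a
    composition through \<open>c\<close>.\<close>
  define S where "S = snd e ` (fst e \<inter> {z \<in> pts Q. g z \<in> fst c})"
  have "open S"
    unfolding S_def
    by (intro chart_image_open_subset[OF ee] Ck_map_preimage_openin[OF g] chart_openin[OF cc])
  have "Ck_on 1 ft S"
  proof (rule Ck_on_1_cong[OF \<open>open S\<close>])
    show "Ck_on 1 (coord_rep c real_chart f \<circ> coord_rep e c g) S"
    proof (rule Ck_on_1_compose)
      show "\<exists>S::'me set. finite S \<and> span S = UNIV"
        using E by (simp add: smooth_manifold_def)
      show "Ck_on 1 (coord_rep c real_chart f) (snd c ` fst c)"
        using Ck_map_coord_rep[OF f' c(1), of real_chart] by (simp only: charts_real_mfd fst_conv vimage_UNIV Int_UNIV_right singleton_iff)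
      show "Ck_on 1 (coord_rep e c g) S"
        by (rule Ck_on_1_subset[OF Ck_map_coord_rep[OF g e c(1)]]) (auto simp: S_def)
      show "coord_rep e c g ` S \<subseteq> snd c ` fst c"
        using chart_inv_chart[OF ee] by (auto simp: S_def coord_rep_apply)
    qed
    show "(coord_rep c real_chart f \<circ> coord_rep e c g) q = ft q" if "q \<in> S" for q
      using that chart_inv_chart[OF ee] chart_inv_chart[OF cc] by (auto simp: S_def ft_def coord_rep_apply)
  qed
  then obtain ft' where ft': "\<And>q. q \<in> S \<Longrightarrow> (ft has_derivative ft' q) (at q)"
    "\<And>v. continuous_on S (\<lambda>q. ft' q v)"
    unfolding Ck_on_1 by blast
  define q0 where "q0 = snd e (\<psi> x)"
  have q0: "q0 \<in> S"
    using \<psi>xe fst_e g\<psi>[OF xD] c(2) by (auto simp: S_def q0_def)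
  have lin: "linear (ft' q0)"
    using ft'(1)[OF q0] has_derivative_linear by blast

  \<comment> \<open>Otherwise the derivative of \<open>ft\<close> vanishes on the fiber directions
    and, by invariance, on the orbit directions. These span everything, which contradicts
    \<open>Fd v0 \<noteq> 0\<close>.\<close>
  have "\<exists>w. ft' q0 (0, w) \<noteq> 0"
  proof (rule ccontr)
    assume "\<not> (\<exists>w. ft' q0 (0, w) \<noteq> 0)"
    then have vert: "ft' q0 (0, w) = 0" for w
      by blast
    obtain \<Psi> where \<Psi>: "(coord_rep c e \<psi> has_derivative \<Psi>) (at (snd c x))"
      using Ck_map_has_derivative[OF \<psi> c(1) e c(2) \<psi>xe] .
    obtain cG where cG: "cG \<in> charts MG" "\<one>\<^bsub>G\<^esub> \<in> fst cG"
      using smooth_manifold_chart[OF MG(1)] MG(2) G.one_closed by blast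
    note gg = atlasD[OF atG cG(1)]
    note orb = action_Ck1(1)[OF lie E actE x(1)]
    have onex: "\<Phi> \<one>\<^bsub>G\<^esub> x = x"
      using AE.id_eq_one x(1) by (metis restrict_apply')
    obtain Od where "(coord_rep cG c0 (\<lambda>a. \<Phi> a x) has_derivative Od) (at (snd cG \<one>\<^bsub>G\<^esub>))"
      using Ck_map_has_derivative[OF orb cG(1) c0(1) cG(2)] onex c0(2) by metis
    \<comment> \<open>A coordinate representation into \<open>c\<close> uses only the map of
      \<open>c\<close>, which is that of \<open>c0\<close>.\<close>
    then have Od: "(coord_rep cG c (\<lambda>a. \<Phi> a x) has_derivative Od) (at (snd cG \<one>\<^bsub>G\<^esub>))"
      by (simp add: coord_rep_def)
    have V_open: "openin (mtop E) {y \<in> D. y \<in> fst c \<and> \<psi> y \<in> fst e}"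
    proof -
      have "openin (mtop E') (fst c \<inter> {y \<in> pts E'. \<psi> y \<in> fst e})"
        by (intro openin_Int chart_openin[OF cc] Ck_map_preimage_openin[OF \<psi>] chart_openin[OF ee])
      then have "openin (mtop E) (fst c \<inter> {y \<in> pts E'. \<psi> y \<in> fst e})"
        unfolding mtopE' using openin_trans_full[OF _ D] by blast
      also have "fst c \<inter> {y \<in> pts E'. \<psi> y \<in> fst e} = {y \<in> D. y \<in> fst c \<and> \<psi> y \<in> fst e}"
        using ptsE' by blast
      finally show ?thesis .
    qed
    define W where "W = {a \<in> pts MG. \<Phi> a x \<in> {y \<in> D. y \<in> fst c \<and> \<psi> y \<in> fst e}}"
    have W: "openin (mtop MG) W"
      unfolding W_def by (rule Ck_map_preimage_openin[OF orb V_open])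
    have oneW: "\<one>\<^bsub>G\<^esub> \<in> W"
      using onex MG(2) xD c(2) \<psi>xe by (simp add: W_def)
    have Wd: "(coord_rep cG e (\<psi> \<circ> (\<lambda>a. \<Phi> a x)) has_derivative (\<Psi> \<circ> Od)) (at (snd cG \<one>\<^bsub>G\<^esub>))"
      by (rule has_derivative_coord_rep_comp_local[OF gg cc Od _ cG(2) oneW W])
         (use \<Psi> onex in \<open>simp_all add: W_def\<close>)
    have "(coord_rep cG real_chart ((f \<circ> g) \<circ> (\<psi> \<circ> (\<lambda>a. \<Phi> a x))) has_derivative (ft' q0 \<circ> (\<Psi> \<circ> Od)))
        (at (snd cG \<one>\<^bsub>G\<^esub>))"
      by (rule has_derivative_coord_rep_comp_local[OF gg ee Wd _ cG(2) oneW W])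
         (use ft'(1)[OF q0] onex in \<open>simp_all add: W_def ft_def q0_def\<close>)
    then have "(coord_rep cG real_chart (\<lambda>a. f x) has_derivative (ft' q0 \<circ> (\<Psi> \<circ> Od))) (at (snd cG \<one>\<^bsub>G\<^esub>))"
      by (rule has_derivative_coord_rep_eq[OF gg _ W cG(2) oneW])
         (use g\<psi> f_inv x(1) MG(2) in \<open>simp add: W_def\<close>)
    moreover have "(coord_rep cG real_chart (\<lambda>a. f x) has_derivative (\<lambda>_. 0)) (at (snd cG \<one>\<^bsub>G\<^esub>))"
      by (simp add: coord_rep_def o_def)
    ultimately have tangent0: "ft' q0 ((\<Psi> \<circ> Od) m) = 0" for m
      using has_derivative_unique by (metis comp_apply)
    \<comment> \<open>By equivariance the base component of the orbit map of \<open>x\<close> is the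
      orbit map of \<open>p x\<close>, whose derivative is onto.\<close>
    have "(coord_rep cG d0 (\<lambda>a. \<phi> a (p x)) has_derivative (fst \<circ> (\<Psi> \<circ> Od))) (at (snd cG \<one>\<^bsub>G\<^esub>))"
    proof (rule has_derivative_transform_within_open[OF _ chart_image_open_subset[OF gg W]])
      show "((\<lambda>m. fst (coord_rep cG e (\<psi> \<circ> (\<lambda>a. \<Phi> a x)) m)) has_derivative (fst \<circ> (\<Psi> \<circ> Od))) (at (snd cG \<one>\<^bsub>G\<^esub>))"
        using has_derivative_fst[OF Wd] by (simp add: o_def)
      show "snd cG \<one>\<^bsub>G\<^esub> \<in> snd cG ` (fst cG \<inter> W)"
        using cG(2) oneW by blast
      fix m assume "m \<in> snd cG ` (fst cG \<inter> W)"
      then obtain a where a: "a \<in> fst cG" "a \<in> W" "m = snd cG a"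
        by blast
      have "fst (snd e z) = snd d0 (fst z)" for z
        by (cases z) (simp add: e_def d_def)
      with a show "fst (coord_rep cG e (\<psi> \<circ> (\<lambda>a. \<Phi> a x)) m) = coord_rep cG d0 (\<lambda>a. \<phi> a (p x)) m"
        using fst\<psi> equiv x(1) MG(2) chart_inv_chart[OF gg] by (simp add: coord_rep_apply W_def)
    qed
    from orbit_map_submersion[OF lie B actB trans px cG d0 this]
    have "range (fst \<circ> (\<Psi> \<circ> Od)) = UNIV" .
    then have zero: "ft' q0 z = 0" for z
      using linear_pair_zero[where W="\<Psi> \<circ> Od", OF lin _ tangent0 vert] by blast
    have "(coord_rep c real_chart ((f \<circ> g) \<circ> \<psi>) has_derivative (ft' q0 \<circ> \<Psi>)) (at (snd c x))"
      by (rule has_derivative_coord_rep_comp[OF cc ee \<Psi> _ c(2) \<psi>xe])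
         (use ft'(1)[OF q0] Ck_map_preimage_openin[OF \<psi> chart_openin[OF ee]] in \<open>simp_all add: ft_def q0_def\<close>)
    then have "(coord_rep c real_chart f has_derivative (ft' q0 \<circ> \<Psi>)) (at (snd c x))"
      by (rule has_derivative_coord_rep_eq[OF cc _ openin_topspace c(2)])
         (use g\<psi> ptsE' xD in simp_all)
    moreover have "(coord_rep c real_chart f has_derivative Fd) (at (snd c x))"
    proof (rule has_derivative_transform_within_open[OF Fd[folded snd_c] chart_image_open_subset[OF c0c D]])
      show "snd c x \<in> snd c0 ` (fst c0 \<inter> D)"
        using c0 xD by simp
      show "coord_rep c0 real_chart f y = coord_rep c real_chart f y" if "y \<in> snd c0 ` (fst c0 \<inter> D)" for y
        using chart_inv_restrict[OF c0c D that] by (simp add: coord_rep_apply c_def)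
    qed
    ultimately have "Fd = ft' q0 \<circ> \<Psi>"
      using has_derivative_unique by blast
    with zero v0 show False by simp
  qed
  then obtain w1 where "ft' q0 (0, w1) \<noteq> 0" by blast
  moreover have "ft' q0 (0, - w1) = - ft' q0 (0, w1)"
    using linear_neg[OF lin, of "(0, w1)"] by simp
  ultimately obtain w where w: "ft' q0 (0, w) < 0"
    by (metis less_neg_neg linorder_neqE_linordered_idom neg_less_0_iff_less)

  have "open {q \<in> S. ft' q (0, w) \<in> {..<0}}"
    using continuous_open_preimage[OF ft'(2) \<open>open S\<close> open_lessThan] by (simp add: Int_def vimage_def)
  moreover have "q0 \<in> {q \<in> S. ft' q (0, w) \<in> {..<0}}"
    using q0 w by simp
  ultimately obtain \<rho> where \<rho>: "\<rho> > 0" "ball q0 \<rho> \<subseteq> {q \<in> S. ft' q (0, w) \<in> {..<0}}"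
    using open_contains_ball by blast
  \<comment> \<open>A line that starts within \<open>\<rho>/2\<close> of \<open>q0\<close> and runs
    for time \<open>\<epsilon>\<close> with velocity \<open>(0, w)\<close> stays in the ball of
    radius \<open>\<rho>\<close>; the summand 1 makes the estimate strict.\<close>
  define \<epsilon> where "\<epsilon> = \<rho> / (2 * (norm w + 1))"
  have \<epsilon>: "\<epsilon> > 0"
    using \<rho>(1) by (simp add: \<epsilon>_def add_nonneg_pos)
  define V where "V = {y \<in> pts E'. \<psi> y \<in> {z \<in> fst e. snd e z \<in> ball q0 (\<rho>/2)}}"
  define path where "path s y = snd e (\<psi> y) + s *\<^sub>R (0, w)" for s y
  define K where "K s y = g (chart_inv e (path s y))" for s y
  have path_0: "path 0 y = snd e (\<psi> y)" for y
    unfolding path_def by (simp only: scaleR_zero_left add_0_right)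
  have path_in: "path s y \<in> ball q0 \<rho>" if "y \<in> V" "s \<in> {0..\<epsilon>}" for s y
  proof -
    have "norm (s *\<^sub>R (0 :: 'mb, w)) \<le> \<epsilon> * norm w"
      using that(2) by (simp add: norm_Pair mult_right_mono)
    also have "\<dots> = \<rho> / 2 * (norm w / (norm w + 1))"
      by (simp add: \<epsilon>_def)
    also have "\<dots> < \<rho> / 2 * 1"
      using \<rho>(1) by (intro mult_strict_left_mono) (simp_all add: divide_less_eq add_nonneg_pos)
    finally have "norm (s *\<^sub>R (0 :: 'mb, w)) < \<rho> / 2"
      by simp
    moreover have "dist q0 (snd e (\<psi> y)) < \<rho> / 2"
      using that(1) by (simp add: V_def)
    ultimately have "dist q0 (path s y) < \<rho> / 2 + \<rho> / 2"
      using dist_triangle[of q0 "path s y" "snd e (\<psi> y)"] by (simp add: path_def dist_norm)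
    then show ?thesis by simp
  qed
  have S_sub: "S \<subseteq> snd e ` fst e"
    by (auto simp: S_def)
  have path_S: "path s y \<in> S" if "y \<in> V" "s \<in> {0..\<epsilon>}" for s y
    using path_in[OF that] \<rho>(2) by blast
  have VE: "V \<subseteq> D"
    using ptsE' by (auto simp: V_def)
  have V_E': "openin (mtop E') V"
    unfolding V_def by (intro Ck_map_preimage_openin[OF \<psi>] chart_preimage_openin[OF ee] open_ball)
  then have V_open: "openin (mtop E) V"
    unfolding mtopE' using openin_trans_full[OF _ D] by blast
  show thesis
  proof (rule that[OF V_open _ \<epsilon>])
    show "x \<in> V"
      using xD \<psi>xe \<rho>(1) ptsE' by (simp add: V_def flip: q0_def)
    show "continuous_map (prod_topology (top_of_set {0..\<epsilon>}) (subtopology (mtop E) V)) (mtop E) (\<lambda>(s, y). K s y)"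
    proof -
      let ?T = "prod_topology (top_of_set {0..\<epsilon>}) (subtopology (mtop E) V)"
      have TV: "topspace ?T = {0..\<epsilon>} \<times> V"
        using VE DE by auto
      have "continuous_map (subtopology (mtop E') V) (subtopology (mtop Q) (fst e)) \<psi>"
        by (intro continuous_map_into_subtopology continuous_map_from_subtopology Ck_map_continuous[OF \<psi>])
           (auto simp: V_def)
      from continuous_map_compose[OF this continuous_map_chart[OF ee]]
      have "continuous_map (subtopology (mtop E) V) euclidean (\<lambda>y. snd e (\<psi> y))"
        using VE by (simp add: o_def mtopE' subtopology_subtopology Int_absorb1)
      from continuous_map_compose[OF continuous_map_snd this]
      have 1: "continuous_map ?T euclidean (\<lambda>t. snd e (\<psi> (snd t)))"
        by (simp add: o_def)
      have "continuous_map (top_of_set {0..\<epsilon>}) euclidean (\<lambda>s. s *\<^sub>R (0 :: 'mb, w))"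
        by (simp add: continuous_intros)
      from continuous_map_compose[OF continuous_map_fst this]
      have 2: "continuous_map ?T euclidean (\<lambda>t. fst t *\<^sub>R (0 :: 'mb, w))"
        by (simp add: o_def)
      have "continuous_map ?T euclidean (\<lambda>t. path (fst t) (snd t))"
        unfolding path_def by (rule continuous_map_add[OF 1 2])
      moreover have "(\<lambda>t. path (fst t) (snd t)) \<in> topspace ?T \<rightarrow> snd e ` fst e"
        using path_S S_sub unfolding TV by auto
      ultimately have "continuous_map ?T (top_of_set (snd e ` fst e)) (\<lambda>t. path (fst t) (snd t))"
        by (rule continuous_map_into_subtopology)
      from continuous_map_compose[OF continuous_map_compose[OF this continuous_map_chart_inv[OF ee]] Ck_map_continuous[OF g]]
      have "continuous_map ?T (subtopology (mtop E) D) (\<lambda>t. K (fst t) (snd t))"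
        by (simp add: o_def mtopE' K_def)
      then show ?thesis
        by (simp add: continuous_map_in_subtopology case_prod_unfold)
    qed
    show "K 0 y = y" if "y \<in> V" for y
    proof -
      have "\<psi> y \<in> fst e" "y \<in> D"
        using that VE by (auto simp: V_def)
      then show ?thesis
        using chart_inv_chart[OF ee] g\<psi> by (simp add: K_def path_0)
    qed
    show "p (K s y) = p y" if y: "y \<in> V" and s: "s \<in> {0..\<epsilon>}" for y s
    proof -
      have ye: "\<psi> y \<in> fst e" and yD: "y \<in> D"
        using y VE by (auto simp: V_def)
      have im: "path s y \<in> snd e ` fst e"
        using path_S[OF y s] S_sub by blast
      then have z: "chart_inv e (path s y) \<in> pts Q"
        using chart_inv_in[OF ee] fst_e by blast
      have "p (K s y) = fst (\<psi> (g (chart_inv e (path s y))))"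
        unfolding K_def using fst\<psi>[OF gD[OF z]] by simp
      also have "\<dots> = fst (chart_inv e (path s y))"
        using \<psi>g[OF z] by simp
      \<comment> \<open>The inverse of a product chart acts on the factors separately, and
        \<open>path\<close> does not change the base coordinate.\<close>
      also have "\<dots> = chart_inv d (fst (path s y))"
      proof -
        have "fst (path s y) \<in> snd d ` fst d" "snd (path s y) \<in> snd k ` fst k"
          using im unfolding e_def by (auto simp: mem_Times_iff)
        from chart_inv_prod[OF dd kk this] show ?thesis
          by (simp add: e_def)
      qed
      also have "fst (path s y) = snd d (fst (\<psi> y))"
        by (cases "\<psi> y") (simp add: path_def e_def)
      also have "chart_inv d (snd d (fst (\<psi> y))) = fst (\<psi> y)"
        using ye by (intro chart_inv_chart[OF dd]) (auto simp: e_def mem_Times_iff)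
      also have "\<dots> = p y"
        by (rule fst\<psi>[OF yD])
      finally show ?thesis .
    qed
    show "f (K s y) < f y" if y: "y \<in> V" and s: "s \<in> {0<..\<epsilon>}" for y s
    proof -
      have "ft (path s y) < ft (path 0 y)"
      proof (rule DERIV_neg_imp_decreasing[of 0 s "\<lambda>t. ft (path t y)"])
        fix t assume t: "0 \<le> t" "t \<le> s"
        then have te: "t \<in> {0..\<epsilon>}"
          using s by simp
        have "((\<lambda>t. path t y) has_derivative (\<lambda>h. h *\<^sub>R (0, w))) (at t)"
          unfolding path_def by (auto intro!: derivative_eq_intros)
        from has_derivative_compose[OF this ft'(1)[OF path_S[OF y te]]]
        have der: "((\<lambda>t. ft (path t y)) has_derivative (\<lambda>h. ft' (path t y) (h *\<^sub>R (0, w)))) (at t)" .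
        have "linear (ft' (path t y))"
          using ft'(1)[OF path_S[OF y te]] has_derivative_linear by blast
        from linear_scale[OF this]
        have "(\<lambda>h. ft' (path t y) (h *\<^sub>R (0, w))) = (*) (ft' (path t y) (0, w))"
          by (simp add: fun_eq_iff mult.commute del: scaleR_Pair)
        with der have "((\<lambda>t. ft (path t y)) has_real_derivative ft' (path t y) (0, w)) (at t)"
          by (simp add: has_field_derivative_def)
        moreover have "ft' (path t y) (0, w) < 0"
          using path_in[OF y te] \<rho>(2) by blast
        ultimately show "\<exists>l. ((\<lambda>t. ft (path t y)) has_real_derivative l) (at t) \<and> l < 0"
          by blast
      qed (use s in simp)
      moreover have "ft (path t y) = f (K t y)" for t
        by (simp add: ft_def K_def coord_rep_apply)
      moreover have "K 0 y = y"
      proof -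
        have "\<psi> y \<in> fst e" "y \<in> D"
          using y VE by (auto simp: V_def)
        then show ?thesis
          using chart_inv_chart[OF ee] g\<psi> by (simp add: K_def path_0)
      qed
      ultimately show ?thesis by simp
    qed
  qed
qed

text \<open>The time of descent is multiplied by a cutoff function that is positive at
  \<open>x\<close> and vanishes near the complement of \<open>V\<close>, so the deformation extends
  by the identity to \<open>X\<close>.\<close>

lemma fiber_deformation_of_descent:
  fixes X :: "'a topology" and \<epsilon> :: real
  assumes X: "compact_space X" "Hausdorff_space X" and V: "openin X V" "x \<in> V" and \<epsilon>: "\<epsilon> > 0"
    and K: "continuous_map (prod_topology (top_of_set {0..\<epsilon>}) (subtopology X V)) X (\<lambda>(s, y). K s y)"
    and K0: "\<And>y. y \<in> V \<Longrightarrow> K 0 y = y" and Kp: "\<And>y s. \<lbrakk>y \<in> V; s \<in> {0..\<epsilon>}\<rbrakk> \<Longrightarrow> p (K s y) = p y"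
    and Kf: "\<And>y s. \<lbrakk>y \<in> V; s \<in> {0<..\<epsilon>}\<rbrakk> \<Longrightarrow> f (K s y) < f y"
  shows "\<exists>h. fiber_deformation X p f h \<and> f (h 1 x) < f x"
proof -
  have VX: "V \<subseteq> topspace X"
    using V(1) openin_subset by blast
  have "completely_regular_space X"
    using X by (simp add: compact_Hausdorff_or_regular_imp_normal_space normal_imp_completely_regular_space)
  moreover have "closedin X (topspace X - V)" "x \<in> topspace X - (topspace X - V)"
    using V VX by auto
  ultimately obtain \<beta>0 :: "'a \<Rightarrow> real" where \<beta>0: "continuous_map X (top_of_set {0..1}) \<beta>0"
    "\<beta>0 x = 0" "\<beta>0 ` (topspace X - V) \<subseteq> {1}"
    unfolding completely_regular_space_def by metis
  have \<beta>0c: "continuous_map X euclideanreal \<beta>0" and \<beta>0r: "\<And>y. y \<in> topspace X \<Longrightarrow> \<beta>0 y \<in> {0..1}"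
    using \<beta>0(1) by (auto simp: continuous_map_in_subtopology)
  \<comment> \<open>The cutoff is \<epsilon> at \<open>x\<close>, where \<open>\<beta>0\<close> is
    0, and it already vanishes where \<open>\<beta>0\<close> exceeds 1/2. The latter is an open set
    containing the complement of \<open>V\<close>, and on its overlap with \<open>V\<close> both
    definitions of \<open>h\<close> give the identity.\<close>
  define \<beta> where "\<beta> y = \<epsilon> * max 0 (1 - 2 * \<beta>0 y)" for y
  have \<beta>_range: "\<beta> y \<in> {0..\<epsilon>}" if "y \<in> topspace X" for y
    using \<beta>0r[OF that] \<epsilon> by (auto simp: \<beta>_def mult_left_le)
  have t\<beta>: "t * \<beta> y \<in> {0..\<epsilon>}" if "y \<in> topspace X" "t \<in> {0..1}" for t y
    using \<beta>_range[OF that(1)] that(2) mult_mono[of t 1 "\<beta> y" \<epsilon>] by auto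
  have \<beta>c: "continuous_map X euclideanreal \<beta>"
    unfolding \<beta>_def
    by (intro continuous_map_real_mult continuous_map_real_max continuous_map_diff \<beta>0c) auto
  define h where "h t y = (if y \<in> V then K (t * \<beta> y) y else y)" for t y
  let ?Z = "prod_topology unit_interval X"
  let ?V' = "{y \<in> topspace X. \<beta>0 y \<in> {1/2<..}}"
  have V': "openin X ?V'"
    by (rule openin_continuous_map_preimage[OF \<beta>0c]) auto
  have "continuous_map ?Z X (\<lambda>(t, y). h t y)"
  proof (rule pasting_lemma[where I="{True, False}" and T="\<lambda>b. {0..1} \<times> (if b then V else ?V')"
        and f="\<lambda>b. if b then (\<lambda>(t, y). K (t * \<beta> y) y) else snd"])
    show "openin ?Z ({0..1} \<times> (if b then V else ?V'))" for b
      using V(1) V' openin_topspace[of unit_interval] by (simp add: openin_prod_Times_iff)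
    show "continuous_map (subtopology ?Z ({0..1} \<times> (if b then V else ?V'))) X
        (if b then (\<lambda>(t, y). K (t * \<beta> y) y) else snd)" for b
    proof (cases b)
      case True
      let ?T = "subtopology ?Z ({0..1} \<times> V)"
      have TV: "topspace ?T = {0..1} \<times> V"
        using VX by auto
      have T: "?T = prod_topology unit_interval (subtopology X V)"
        by (simp add: prod_topology_subtopology(2))
      have "continuous_map ?Z euclideanreal (\<lambda>q. fst q * \<beta> (snd q))"
      proof (rule continuous_map_real_mult)
        show "continuous_map ?Z euclideanreal fst"
          using continuous_map_fst[of unit_interval X] by (simp add: continuous_map_in_subtopology)
        show "continuous_map ?Z euclideanreal (\<lambda>q. \<beta> (snd q))"
          using continuous_map_compose[OF continuous_map_snd \<beta>c] by (simp add: o_def)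
      qed
      moreover have "(\<lambda>q. fst q * \<beta> (snd q)) \<in> topspace ?T \<rightarrow> {0..\<epsilon>}"
        unfolding TV using t\<beta> VX by auto
      ultimately have 1: "continuous_map ?T (top_of_set {0..\<epsilon>}) (\<lambda>q. fst q * \<beta> (snd q))"
        by (intro continuous_map_into_subtopology continuous_map_from_subtopology)
      have 2: "continuous_map ?T (subtopology X V) snd"
        unfolding T by (rule continuous_map_snd)
      from continuous_map_compose[OF continuous_map_pairedI[OF 1 2] K] True show ?thesis
        by (simp add: o_def case_prod_unfold)
    next
      case False
      then show ?thesis
        by (simp add: continuous_map_from_subtopology continuous_map_snd)
    qed
    have "K (t * \<beta> y) y = y" if "y \<in> V" "y \<in> ?V'" for t y
      using that K0[of y] by (simp add: \<beta>_def)
    then show "(if b then (\<lambda>(t, y). K (t * \<beta> y) y) else snd) q = (if b' then (\<lambda>(t, y). K (t * \<beta> y) y) else snd) q"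
      if "q \<in> topspace ?Z \<inter> ({0..1} \<times> (if b then V else ?V')) \<inter> ({0..1} \<times> (if b' then V else ?V'))" for b b' q
      using that by (cases b; cases b'; cases q) auto
    show "\<exists>b. b \<in> {True, False} \<and> q \<in> {0..1} \<times> (if b then V else ?V') \<and>
        (\<lambda>(t, y). h t y) q = (if b then (\<lambda>(t, y). K (t * \<beta> y) y) else snd) q" if "q \<in> topspace ?Z" for q
    proof -
      obtain t y where q: "q = (t, y)" "t \<in> {0..1}" "y \<in> topspace X"
        using \<open>q \<in> topspace ?Z\<close> by (cases q) auto
      show ?thesis
      proof (cases "y \<in> V")
        case True
        then show ?thesis
          using q by (intro exI[of _ True]) (simp add: h_def)
      next
        case False
        then have "\<beta>0 y = 1"
          using \<beta>0(3) q(3) by blast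
        with False show ?thesis
          using q by (intro exI[of _ False]) (simp add: h_def)
      qed
    qed
  qed
  moreover have "h 0 y = y" for y
    using K0 by (simp add: h_def)
  moreover have "p (h t y) = p y" if "y \<in> topspace X" "t \<in> {0..1}" for t y
    using Kp t\<beta>[OF that] by (simp add: h_def)
  moreover have "h 1 y = y \<or> f (h 1 y) < f y" if y: "y \<in> topspace X" for y
  proof (cases "y \<in> V \<and> \<beta> y \<noteq> 0")
    case True
    then have "\<beta> y \<in> {0<..\<epsilon>}"
      using \<beta>_range[OF y] by auto
    with True Kf show ?thesis
      by (simp add: h_def)
  next
    case False
    then show ?thesis
      using K0 by (auto simp: h_def)
  qed
  ultimately have "fiber_deformation X p f h"
    by (simp add: fiber_deformation_def)
  moreover have "f (h 1 x) < f x"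
    using Kf[OF V(2), of \<epsilon>] V(2) \<epsilon> \<beta>0(2) by (simp add: h_def \<beta>_def)
  ultimately show ?thesis by blast
qed

theorem corollary8p8:
  fixes r :: nat
    and G :: "('g, 'z) monoid_scheme" and MG :: "('g, 'mg::real_inner) mfd" and gG :: "('g, 'mg) metric"
    and E :: "('e, 'me::real_inner) mfd" and gE :: "('e, 'me) metric"
    and B :: "('b, 'mb::real_inner) mfd" and gB :: "('b, 'mb) metric"
    and F :: "('f, 'mf::real_inner) mfd"
    and \<Phi> :: "'g \<Rightarrow> 'e \<Rightarrow> 'e" and \<phi> :: "'g \<Rightarrow> 'b \<Rightarrow> 'b"
    and p :: "'e \<Rightarrow> 'b" and f :: "'e \<Rightarrow> real"
  assumes "r \<ge> 2"
    and "lie_group G MG" and "connected_space (mtop MG)"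
    and "riemannian_metric MG gG" and "bi_invariant G MG gG"
    and "closed_manifold E" and "closed_manifold B"
    and "smooth_action G MG E \<Phi>" and "smooth_action G MG B \<phi>"
    and "smooth_fiber_bundle E B F p"
    and "\<forall>a\<in>carrier G. \<forall>x\<in>pts E. p (\<Phi> a x) = \<phi> a (p x)"
    and "\<forall>b\<in>pts B. path_connected_space (subtopology (mtop E) (p -` {b}))"
    and "riemannian_metric E gE" and "\<forall>a\<in>carrier G. preserves_metric E gE (\<Phi> a)"
    and "riemannian_metric B gB" and "riemannian_submersion E gE B gB p"
    and "transitive_action G (pts B) \<phi>"
    and "Ck_map 1 E real_mfd f"
    and "\<forall>a\<in>carrier G. \<forall>x\<in>pts E. f (\<Phi> a x) = f x"
  shows "TC_seq r (mtop E) p \<le>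
    (\<Sum>\<^sub>\<infinity>\<mu>\<in>(UNIV :: real set).
       SUP \<nu> \<in> {\<nu> :: nat \<Rightarrow> real. (\<Sum>i<r. \<nu> i) = \<mu>}.
         TC_rel r (mtop E) p (fiber_product r p (\<lambda>i. critical_set E f (\<nu> i))))"
proof -
  \<comment> \<open>The critical points of all values at once; intersecting with a level of
    \<open>f\<close> gives back the single critical sets.\<close>
  define C where "C = {x \<in> pts E. x \<in> critical_set E f (f x)}"
  have E: "compact_space (mtop E)" "Hausdorff_space (mtop E)"
    using assms(6) by (simp_all add: closed_manifold_def smooth_manifold_def)
  have B: "Hausdorff_space (mtop B)"
    using assms(7) by (simp add: closed_manifold_def smooth_manifold_def)
  interpret lusternik_schnirelmann r "mtop E" "mtop B" p f C
  proof
    show "continuous_map (mtop E) (mtop B) p"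
    proof -
      have "smooth_map E B p"
        using assms(10) by (simp only: smooth_fiber_bundle_def)
      then show ?thesis
        by (rule Ck_map_continuous[OF smooth_map_Ck1])
    qed
    show "continuous_map (mtop E) euclideanreal f"
      using Ck_map_continuous[OF assms(18)] by (simp add: real_mfd_def)
    show "\<exists>h. fiber_deformation (mtop E) p f h \<and> f (h 1 x) < f x" if x: "x \<in> pts E" "x \<notin> C" for x
    proof -
      have "x \<notin> critical_set E f (f x)"
        using x by (simp add: C_def)
      from vertical_descent[OF assms(2,8,9,10) assms(11)[rule_format] assms(17,18) assms(19)[rule_format] x(1) this]
      obtain V \<epsilon> K where "openin (mtop E) V" "x \<in> V" "\<epsilon> > (0::real)"
        "continuous_map (prod_topology (top_of_set {0..\<epsilon>}) (subtopology (mtop E) V)) (mtop E) (\<lambda>(s, y). K s y)"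
        "\<And>y. y \<in> V \<Longrightarrow> K 0 y = y" "\<And>y s. \<lbrakk>y \<in> V; s \<in> {0..\<epsilon>}\<rbrakk> \<Longrightarrow> p (K s y) = p y"
        "\<And>y s. \<lbrakk>y \<in> V; s \<in> {0<..\<epsilon>}\<rbrakk> \<Longrightarrow> f (K s y) < f y"
        by blast
      then show ?thesis
        by (rule fiber_deformation_of_descent[OF E])
    qed
  qed (use assms(1) E B in \<open>auto simp: C_def\<close>)
  have "{x \<in> C. f x = \<mu>} = critical_set E f \<mu>" for \<mu>
    by (auto simp: C_def critical_set_def)
  then show ?thesis
    using TC_seq_le by (simp only: level_bound_def critical_tuples_def)
qed

end
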